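(* Consider $\mathbb{C}P^{2n+1}=\mathrm{Sp}(n+1)/(\mathrm{U}(1)\times\mathrm{Sp}(n))$, $n\ge 1$, with the normal invariant metric $g_{normal}=(1,1)$, and let $\gamma:\mathbb{R}\to\mathbb{C}P^{2n+1}$ be the equigeodesic $\gamma(t)=\exp(tA_{11})\cdot o$, where $A_{11}\in\mathfrak{m}_2\subset\mathfrak{sp}(n+1)$. Let $m=\sqrt{2n+4}/(2n+4)$ and fix $b\in\mathbb{R}$ with $0<b<\pi/(2m)$. Then there exist an invariant metric $g$ obtained by a $\mathcal{P}$-perturbation of $g_{normal}$ and $c\in\mathbb{R}$, $0<c\le b$, such that $\gamma(0)$ and $\gamma(c)$ are conjugate along $\gamma$ with respect to the metric $g$.
   Context: Realize $\mathfrak{sp}(n+1)$ as the compact real form of $\mathfrak{sp}(2n+2,\mathbb{C})$, inside $(2n+2)\times(2n+2)$ complex matrices. Let $E_{ij}$ be the elementary matrices, $m=\sqrt{2n+4}/(2n+4)$, and $X_{ij}=\frac{\sqrt2 m}{2}(E_{ij}-E_{n+1+j,n+1+i})$, $X_{-ij}=\frac{\sqrt2 m}{2}(E_{ji}-E_{n+1+i,n+1+j})$, $X^+_{ij}=\frac{\sqrt2 m}{2}(E_{i,n+1+j}+E_{j,n+1+i})$, $X^+_{-ij}=\frac{\sqrt2 m}{2}(E_{n+1+i,j}+E_{n+1+j,i})$ for $1\le i<j\le n+1$, and $X_{ii}=mE_{i,n+1+i}$, $X_{-ii}=mE_{n+1+i,i}$ for $1\le i\le n+1$. Put $A_{ij}=X_{ij}-X_{-ij}$,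 $S_{ij}=\sqrt{-1}(X_{ij}+X_{-ij})$ ($i\le j$), $A^+_{ij}=X^+_{ij}-X^+_{-ij}$, $S^+_{ij}=\sqrt{-1}(X^+_{ij}+X^+_{-ij})$ ($i<j$). These, together with the diagonal matrices in $\mathfrak{sp}(n+1)$, span $\mathfrak{sp}(n+1)$. The Lie algebra $\mathfrak{k}$ of the isotropy group $\mathrm{U}(1)\times\mathrm{Sp}(n)$ is spanned by the diagonal matrices in $\mathfrak{sp}(n+1)$ and by the $A_{ij},S_{ij}$ ($2\le i\le j\le n+1$), $A^+_{ij},S^+_{ij}$ ($2\le i<j\le n+1$). The tangent space at the origin $o$ (the trivial coset) is identified with $\mathfrak{m}=\mathfrak{m}_1\oplus\mathfrak{m}_2$, where $\mathfrak{m}_1=\mathrm{span}_{\mathbb{R}}\{A_{1j},S_{1j},A^+_{1j},S^+_{1j}:2\le j\le n+1\}$ and $\mathfrak{m}_2=\mathrm{span}_{\mathbb{R}}\{A_{11},S_{11}\}$ are the irreducible components of the isotropy representation. $\mathrm{Sp}(n+1)$-invariant metrics correspond to pairs $(\lambda_1,\lambda_2)$ of positive reals: the metric at $o$ is $-\lambda_1(\cdot,\cdot)|_{\mathfrak{m}_1}\oplus-\lambda_2(\cdot,\cdot)|_{\mathfrak{m}_2}$, with $(\cdot,\cdot)$ the Cartan-Killing form. The normal metric is $(1,1)$. An equigeodesic is a curve that is a geodesic for every invariant metric. In general, for a set $\mathcal{P}$ of isotropy components, a $\mathcal{P}$-perturbation of an invariant metric leaves the parameters of the components in $\mathcal{P}$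 unchanged and replaces each other parameter $\lambda_i$ by $\lambda_i+\xi_i>0$, $\xi_i\in\mathbb{R}$. Here $\mathcal{P}=\{\mathfrak{m}_2\}$, i.e. the $\mathcal{P}$-perturbations of $g_{normal}$ are the metrics $(1+\xi,1)$ with $\xi>-1$. *)

theory Defs
  imports "HOL-Analysis.Analysis" "HOL-Library.Option_ord"
begin

section \<open>Riemannian geometry in local coordinates\<close>

primrec Ck_on :: "nat \<Rightarrow> ('a::real_normed_vector \<Rightarrow> 'b::real_normed_vector) \<Rightarrow> 'a set \<Rightarrow> bool" where
  "Ck_on 0 f U \<longleftrightarrow> continuous_on U f"
| "Ck_on (Suc k) f U \<longleftrightarrow>
     (\<forall>x\<in>U. f differentiable (at x)) \<and> (\<forall>u. Ck_on k (\<lambda>x. frechet_derivative f (at x) u) U)"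

definition smooth_on :: "('a::real_normed_vector \<Rightarrow> 'b::real_normed_vector) \<Rightarrow> 'a set \<Rightarrow> bool" where
  "smooth_on f U \<longleftrightarrow> open U \<and> (\<forall>k. Ck_on k f U)"

text \<open>
  A metric in coordinates is a function \<open>G\<close> with \<open>G x u v\<close> the inner product of the coordinate
  vectors \<open>u\<close>, \<open>v\<close> at \<open>x\<close>.  \<open>christoffel G x u v\<close> is the Levi-Civita derivative at \<open>x\<close> of the
  constant coordinate field \<open>v\<close> in direction \<open>u\<close>, given by the Koszul formula.
\<close>

type_synonym 'e coord_metric = "'e \<Rightarrow> 'e \<Rightarrow> 'e \<Rightarrow> real"

definition christoffel :: "'e::euclidean_space coord_metric \<Rightarrow> 'e \<Rightarrow> 'e \<Rightarrow> 'e \<Rightarrow> 'e" where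
  "christoffel G x u v = (THE w. \<forall>z. G x w z =
     (frechet_derivative (\<lambda>y. G y v z) (at x) u
      + frechet_derivative (\<lambda>y. G y u z) (at x) v
      - frechet_derivative (\<lambda>y. G y u v) (at x) z) / 2)"

text \<open>\<open>R(u,v)w = \<nabla>\<^sub>u \<nabla>\<^sub>v w - \<nabla>\<^sub>v \<nabla>\<^sub>u w\<close> for constant coordinate fields (which commute).\<close>

definition curvature :: "'e::euclidean_space coord_metric \<Rightarrow> 'e \<Rightarrow> 'e \<Rightarrow> 'e \<Rightarrow> 'e \<Rightarrow> 'e" where
  "curvature G x u v w =
     frechet_derivative (\<lambda>y. christoffel G y v w) (at x) u
     - frechet_derivative (\<lambda>y. christoffel G y u w) (at x) v
     + christoffel G x u (christoffel G x v w) - christoffel G x v (christoffel G x u w)"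

definition velocity :: "(real \<Rightarrow> 'e::real_normed_vector) \<Rightarrow> real \<Rightarrow> 'e" where
  "velocity x t = vector_derivative x (at t)"

definition covariant_deriv ::
  "'e::euclidean_space coord_metric \<Rightarrow> (real \<Rightarrow> 'e) \<Rightarrow> (real \<Rightarrow> 'e) \<Rightarrow> real \<Rightarrow> 'e" where
  "covariant_deriv G x y t = vector_derivative y (at t) + christoffel G (x t) (velocity x t) (y t)"

definition geodesic_equation ::
  "'e::euclidean_space coord_metric \<Rightarrow> (real \<Rightarrow> 'e) \<Rightarrow> real \<Rightarrow> bool" where
  "geodesic_equation G x t \<longleftrightarrow> covariant_deriv G x (velocity x) t = 0"

definition jacobi_equation ::
  "'e::euclidean_space coord_metric \<Rightarrow> (real \<Rightarrow> 'e) \<Rightarrow> (real \<Rightarrow> 'e) \<Rightarrow> real \<Rightarrow> bool" where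
  "jacobi_equation G x y t \<longleftrightarrow>
     covariant_deriv G x (covariant_deriv G x y) t
     + curvature G (x t) (y t) (velocity x t) (velocity x t) = 0"


section \<open>The compact group \<open>Sp(n+1)\<close> and its Lie algebra\<close>

text \<open>
  Throughout \<open>n = CARD('n)\<close>.  The indices \<open>1 < \<dots> < n+1\<close> are the elements of \<open>'n option\<close>, with
  \<open>1\<close> represented by \<open>None\<close>, the least element.  A row or column index \<open>i\<close> of a
  \<open>(2n+2) \<times> (2n+2)\<close> matrix is \<open>Inl i\<close>, and \<open>n+1+i\<close> is \<open>Inr i\<close>.
\<close>

type_synonym 'n index = "'n option + 'n option"
type_synonym 'n cmat = "((complex, 'n index) vec, 'n index) vec"

definition conj_transpose :: "'n::finite cmat \<Rightarrow> 'n cmat" where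
  "conj_transpose X = (\<chi> i j. cnj (X $ j $ i))"

definition diagonal :: "'n::finite cmat \<Rightarrow> bool" where
  "diagonal X \<longleftrightarrow> (\<forall>i j. i \<noteq> j \<longrightarrow> X $ i $ j = 0)"

definition elem_mat :: "'n::finite index \<Rightarrow> 'n index \<Rightarrow> 'n cmat" where
  "elem_mat p q = (\<chi> i j. if i = p \<and> j = q then 1 else 0)"

definition symp_form :: "'n::finite cmat" where
  "symp_form = (\<Sum>i\<in>UNIV. elem_mat (Inl i) (Inr i) - elem_mat (Inr i) (Inl i))"

definition Sp :: "'n::finite cmat set" where
  "Sp = {g. conj_transpose g ** g = mat 1 \<and> transpose g ** symp_form ** g = symp_form}"

definition sp_algebra :: "'n::finite cmat set" where
  "sp_algebra = {X. conj_transpose X + X = 0 \<and> transpose X ** symp_form + symp_form ** X = 0}"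

definition bracket :: "'n::finite cmat \<Rightarrow> 'n cmat \<Rightarrow> 'n cmat" where
  "bracket X Y = X ** Y - Y ** X"

definition Ad :: "'n::finite cmat \<Rightarrow> 'n cmat \<Rightarrow> 'n cmat" where
  "Ad g X = g ** X ** matrix_inv g"

definition mexp :: "'n::finite cmat \<Rightarrow> 'n cmat" where
  "mexp X = (\<Sum>k. (1 / fact k) *\<^sub>R ((**) X ^^ k) (mat 1))"

text \<open>The trace of an endomorphism of a finite-dimensional real subspace \<open>V\<close>.\<close>

definition trace_on :: "'a::real_vector set \<Rightarrow> ('a \<Rightarrow> 'a) \<Rightarrow> real" where
  "trace_on V f = (let B = (SOME B. B \<subseteq> V \<and> independent B \<and> span B = V)
                   in \<Sum>b\<in>B. representation B (f b) b)"

definition killing_form :: "'n::finite cmat \<Rightarrow> 'n cmat \<Rightarrow> real" where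
  "killing_form X Y = trace_on sp_algebra (\<lambda>Z. bracket X (bracket Y Z))"


section \<open>Root vectors and the isotropy representation\<close>

definition m_const :: "nat \<Rightarrow> real" where
  "m_const n = sqrt (2 * real n + 4) / (2 * real n + 4)"

definition Xp :: "'n::finite option \<Rightarrow> 'n option \<Rightarrow> 'n cmat" where
  "Xp i j = (if i = j then m_const CARD('n) *\<^sub>R elem_mat (Inl i) (Inr i)
     else (sqrt 2 * m_const CARD('n) / 2) *\<^sub>R (elem_mat (Inl i) (Inl j) - elem_mat (Inr j) (Inr i)))"

definition Xm :: "'n::finite option \<Rightarrow> 'n option \<Rightarrow> 'n cmat" where
  "Xm i j = (if i = j then m_const CARD('n) *\<^sub>R elem_mat (Inr i) (Inl i)
     else (sqrt 2 * m_const CARD('n) / 2) *\<^sub>R (elem_mat (Inl j) (Inl i) - elem_mat (Inr i) (Inr j)))"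

definition Xp_plus :: "'n::finite option \<Rightarrow> 'n option \<Rightarrow> 'n cmat" where
  "Xp_plus i j = (sqrt 2 * m_const CARD('n) / 2) *\<^sub>R (elem_mat (Inl i) (Inr j) + elem_mat (Inl j) (Inr i))"

definition Xm_plus :: "'n::finite option \<Rightarrow> 'n option \<Rightarrow> 'n cmat" where
  "Xm_plus i j = (sqrt 2 * m_const CARD('n) / 2) *\<^sub>R (elem_mat (Inr i) (Inl j) + elem_mat (Inr j) (Inl i))"

definition A_mat :: "'n::finite option \<Rightarrow> 'n option \<Rightarrow> 'n cmat" where
  "A_mat i j = Xp i j - Xm i j"

definition S_mat :: "'n::finite option \<Rightarrow> 'n option \<Rightarrow> 'n cmat" where
  "S_mat i j = mat \<i> ** (Xp i j + Xm i j)"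

definition A_plus :: "'n::finite option \<Rightarrow> 'n option \<Rightarrow> 'n cmat" where
  "A_plus i j = Xp_plus i j - Xm_plus i j"

definition S_plus :: "'n::finite option \<Rightarrow> 'n option \<Rightarrow> 'n cmat" where
  "S_plus i j = mat \<i> ** (Xp_plus i j + Xm_plus i j)"

definition isotropy_algebra :: "'n::{finite,linorder} cmat set" where
  "isotropy_algebra = span ({D \<in> sp_algebra. diagonal D}
     \<union> (\<Union>i\<in>{None<..}. \<Union>j\<in>{i..}. {A_mat i j, S_mat i j})
     \<union> (\<Union>i\<in>{None<..}. \<Union>j\<in>{i<..}. {A_plus i j, S_plus i j}))"

datatype component = M1 | M2

fun component_space :: "component \<Rightarrow> 'n::{finite,linorder} cmat set" where
  "component_space M1 =
     span (\<Union>j\<in>{None<..}. {A_mat None j, S_mat None j, A_plus None j, S_plus None j})"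
| "component_space M2 = span {A_mat None None, S_mat None None}"

definition tangent_o :: "'n::{finite,linorder} cmat set" where
  "tangent_o = span (component_space M1 \<union> component_space M2)"

text \<open>
  The projections of \<open>sp_algebra\<close> onto \<open>tangent_o\<close> and onto the single components, along the
  decomposition of \<open>sp_algebra\<close> as the direct sum of \<open>isotropy_algebra\<close> and the two components.
\<close>

definition proj_o :: "'n::{finite,linorder} cmat \<Rightarrow> 'n cmat" where
  "proj_o X = (THE Y. Y \<in> tangent_o \<and> X - Y \<in> isotropy_algebra)"

definition proj_component :: "component \<Rightarrow> 'n::{finite,linorder} cmat \<Rightarrow> 'n cmat" where
  "proj_component i X = (THE Y. Y \<in> component_space i \<and>
     X - Y \<in> span (isotropy_algebra \<union> (\<Union>j\<in>-{i}. component_space j)))"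


section \<open>The homogeneous space \<open>Sp(n+1) / (U(1) \<times> Sp(n))\<close>\<close>

text \<open>
  The factor \<open>U(1)\<close> sits in the rows and columns \<open>1\<close> and \<open>n+2\<close> as \<open>diag(z, cnj z)\<close>, the factor
  \<open>Sp(n)\<close> in the remaining ones; that \<open>g\<close> lies in \<open>Sp\<close> forces the entries of the blocks to be so.
\<close>

definition isotropy_group :: "'n::finite cmat set" where
  "isotropy_group = {g \<in> Sp. \<forall>i\<in>{Inl None, Inr None}. \<forall>j. j \<noteq> i \<longrightarrow> g $ i $ j = 0 \<and> g $ j $ i = 0}"

type_synonym 'n point = "'n cmat set"

definition coset :: "'n::finite cmat \<Rightarrow> 'n point" where
  "coset g = (\<lambda>h. g ** h) ` isotropy_group"

definition origin :: "'n::finite point" where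
  "origin = coset (mat 1)"

definition act :: "'n::finite cmat \<Rightarrow> 'n point \<Rightarrow> 'n point" where
  "act g p = (\<lambda>x. g ** x) ` p"

text \<open>
  The tangent space at \<open>p = g H\<close> is realized as \<open>Ad g\<close> applied to the tangent space at the origin:
  \<open>Z\<close> stands for the velocity at \<open>s = 0\<close> of the curve \<open>exp(s Z) \<cdot> p\<close>.  The isotropy group preserves
  both components, so neither this nor the metric below depends on the representative \<open>g\<close> of
  \<open>p\<close>.  In this realization the differential of the action of \<open>g\<close> is \<open>Ad g\<close>.
\<close>

definition tangent :: "'n::{finite,linorder} point \<Rightarrow> 'n cmat set" where
  "tangent p = {Ad g X | g X. g \<in> p \<and> X \<in> tangent_o}"

definition metric_o :: "(component \<Rightarrow> real) \<Rightarrow> 'n::{finite,linorder} cmat \<Rightarrow> 'n cmat \<Rightarrow> real" where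
  "metric_o lam X Y =
     (\<Sum>i\<in>{M1, M2}. - lam i * killing_form (proj_component i X) (proj_component i Y))"

definition metric_at ::
  "(component \<Rightarrow> real) \<Rightarrow> 'n::{finite,linorder} point \<Rightarrow> 'n cmat \<Rightarrow> 'n cmat \<Rightarrow> real" where
  "metric_at lam p Z W = (let g = (SOME g. g \<in> p)
     in metric_o lam (Ad (matrix_inv g) Z) (Ad (matrix_inv g) W))"

definition invariant_metric :: "(component \<Rightarrow> real) \<Rightarrow> bool" where
  "invariant_metric lam \<longleftrightarrow> (\<forall>i. 0 < lam i)"

definition normal_metric :: "component \<Rightarrow> real" where
  "normal_metric = (\<lambda>i. 1)"

definition perturbation ::
  "component set \<Rightarrow> (component \<Rightarrow> real) \<Rightarrow> (component \<Rightarrow> real) \<Rightarrow> bool" where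
  "perturbation P lam lam' \<longleftrightarrow> (\<exists>\<xi>. \<forall>i.
     (i \<in> P \<longrightarrow> lam' i = lam i) \<and> (i \<notin> P \<longrightarrow> lam i + \<xi> i > 0 \<and> lam' i = lam i + \<xi> i))"


subsection \<open>Charts\<close>

text \<open>
  Local coordinates live in the real vector space of dimension \<open>4n+2\<close> below.  A chart is
  given through its inverse, the parametrization \<open>x \<mapsto> \<sigma>(x) H\<close> with a smooth lift \<open>\<sigma>\<close> to the group;
  since the projection of the group onto the quotient has smooth local sections, every point of
  every chart of the quotient manifold has a neighbourhood on which the chart is of this form.
  The differential of the parametrization at \<open>x\<close> is \<open>chart_deriv \<sigma> x\<close>.
\<close>

type_synonym 'n coords = "complex \<times> (complex, 'n) vec \<times> (complex, 'n) vec"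

definition chart_deriv :: "('n coords \<Rightarrow> 'n cmat) \<Rightarrow> 'n coords \<Rightarrow> 'n coords \<Rightarrow> 'n::{finite,linorder} cmat" where
  "chart_deriv \<sigma> x u =
     Ad (\<sigma> x) (proj_o (matrix_inv (\<sigma> x) ** frechet_derivative \<sigma> (at x) u))"

definition chart :: "'n coords set \<Rightarrow> ('n coords \<Rightarrow> 'n::{finite,linorder} cmat) \<Rightarrow> bool" where
  "chart U \<sigma> \<longleftrightarrow> smooth_on \<sigma> U \<and> \<sigma> ` U \<subseteq> Sp \<and> inj_on (\<lambda>x. coset (\<sigma> x)) U \<and>
     (\<forall>x\<in>U. bij_betw (chart_deriv \<sigma> x) UNIV (tangent (coset (\<sigma> x))))"

definition chart_metric ::
  "(component \<Rightarrow> real) \<Rightarrow> ('n coords \<Rightarrow> 'n::{finite,linorder} cmat) \<Rightarrow> 'n coords coord_metric" where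
  "chart_metric lam \<sigma> x u v = metric_at lam (coset (\<sigma> x)) (chart_deriv \<sigma> x u) (chart_deriv \<sigma> x v)"

text \<open>\<open>x\<close> is the coordinate expression of the curve \<open>\<gamma>\<close> on the open set of times \<open>I\<close>.\<close>

definition coord_curve :: "'n coords set \<Rightarrow> ('n coords \<Rightarrow> 'n::{finite,linorder} cmat) \<Rightarrow>
    (real \<Rightarrow> 'n point) \<Rightarrow> real set \<Rightarrow> (real \<Rightarrow> 'n coords) \<Rightarrow> bool" where
  "coord_curve U \<sigma> \<gamma> I x \<longleftrightarrow>
     chart U \<sigma> \<and> smooth_on x I \<and> (\<forall>t\<in>I. x t \<in> U \<and> \<gamma> t = coset (\<sigma> (x t)))"


subsection \<open>Geodesics, Jacobi fields, conjugate points\<close>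

text \<open>
  The geodesic and Jacobi equations are invariant under changes of coordinates, so it does not
  matter in which chart around a given point of the curve they are tested.
\<close>

definition geodesic :: "(component \<Rightarrow> real) \<Rightarrow> (real \<Rightarrow> 'n::{finite,linorder} point) \<Rightarrow> bool" where
  "geodesic lam \<gamma> \<longleftrightarrow> (\<forall>t0. \<exists>U \<sigma> I x. t0 \<in> I \<and> coord_curve U \<sigma> \<gamma> I x \<and>
     (\<forall>t\<in>I. geodesic_equation (chart_metric lam \<sigma>) x t))"

definition equigeodesic :: "(real \<Rightarrow> 'n::{finite,linorder} point) \<Rightarrow> bool" where
  "equigeodesic \<gamma> \<longleftrightarrow> (\<forall>lam. invariant_metric lam \<longrightarrow> geodesic lam \<gamma>)"

definition jacobi_field ::
  "(component \<Rightarrow> real) \<Rightarrow> (real \<Rightarrow> 'n::{finite,linorder} point) \<Rightarrow> (real \<Rightarrow> 'n cmat) \<Rightarrow> bool" where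
  "jacobi_field lam \<gamma> J \<longleftrightarrow> (\<forall>t0. \<exists>U \<sigma> I x y. t0 \<in> I \<and> coord_curve U \<sigma> \<gamma> I x \<and> smooth_on y I \<and>
     (\<forall>t\<in>I. J t = chart_deriv \<sigma> (x t) (y t) \<and> jacobi_equation (chart_metric lam \<sigma>) x y t))"

definition conjugate_along ::
  "(component \<Rightarrow> real) \<Rightarrow> (real \<Rightarrow> 'n::{finite,linorder} point) \<Rightarrow> real \<Rightarrow> real \<Rightarrow> bool" where
  "conjugate_along lam \<gamma> a c \<longleftrightarrow> a \<noteq> c \<and> geodesic lam \<gamma> \<and>
     (\<exists>J. jacobi_field lam \<gamma> J \<and> (\<exists>t. J t \<noteq> 0) \<and> J a = 0 \<and> J c = 0)"

end

theory Submission
  imports Defs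
begin

text \<open>
  The quotient fibres over the quaternionic projective space with fibre \<open>S\<^sup>2\<close>, and \<open>\<gamma>\<close> is a great
  circle of one fibre.  Enlarging the fibre in proportion to the base, that is, letting \<open>\<lambda>\<^sub>1\<close> tend
  to \<open>0\<close> with \<open>\<lambda>\<^sub>2 = 1\<close>, brings the conjugate points in horizontal directions arbitrarily close to
  the starting point.

  The curve is an orbit of a one-parameter group of isometries.  In the coordinates used here it is
  the straight line \<open>t \<mapsto> t e\<close>, and translations along \<open>e\<close> preserve the metric coefficients \<open>G\<close>.
  The Christoffel symbols are therefore constant along the line, the geodesic equation says that the
  function \<open>z \<mapsto> G\<^sub>z(e,e)\<close> is critical there, and the Jacobi equation becomes a linear equation with
  constant coefficients (\<open>geodesic_line\<close> and \<open>jacobi_line\<close>).  Criticality holds for all parameters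
  because this function is even in the coordinates transversal to the line (\<open>lift_metric_critical\<close>).

  Let \<open>m\<close> be the length of the coordinate vector \<open>e\<close> and let \<open>I(p,q) = (-cnj q, cnj p)\<close>.  For fields \<open>y\<close>
  in the coordinate directions \<open>(p,q)\<close>, which correspond to the first isotropy component, the Jacobi equation is
  \<open>\<lambda>\<^sub>1 y'' + (2 \<lambda>\<^sub>1 - \<lambda>\<^sub>2) m I y' - (\<lambda>\<^sub>1 - \<lambda>\<^sub>2) m\<^sup>2 y = 0\<close>.  Since \<open>I\<^sup>2 = -1\<close>, the function
  \<open>exp(\<theta> t I) B\<close> solves it for \<open>\<theta> = -m\<close> and for \<open>\<theta> = m (\<lambda>\<^sub>2/\<lambda>\<^sub>1 - 1)\<close>.  The difference of these two
  solutions vanishes exactly at the multiples of \<open>2 \<pi> \<lambda>\<^sub>1 / (m \<lambda>\<^sub>2)\<close>, and \<open>\<lambda>\<^sub>1 = b m / (2 \<pi>)\<close>, \<open>\<lambda>\<^sub>2 = 1\<close>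
  puts the first of them at \<open>b\<close>.

  The coefficients \<open>G\<close> come out in closed form as follows.  The Killing form is a multiple of the trace form
  (\<open>killing_form_eq\<close>), so an invariant metric is a weighted sum of squares of the first row of
  \<open>g\<^sup>* dg\<close>.  That row is determined by the first column \<open>V\<close> of \<open>g\<close> and its differential, through
  \<open>|dV|\<^sup>2\<close>, the Hermitian product of \<open>V\<close> and \<open>dV\<close>, and their symplectic product
  (\<open>chart_metric_eq_column\<close>).  The lift of a coordinate vector to the group is a product of rotations
  with a Cayley transform, whose first column is simple enough for these three quantities to be written down
  (\<open>chart_metric_lift\<close>).
\<close>

section \<open>Smooth functions\<close>

text \<open>
  All functions below are smooth on the whole space, and on an open set the restriction is then
  smooth in the sense of \<open>smooth_on\<close>.  Working globally avoids side conditions on domains in the closure rules.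
\<close>

definition smooth_fun :: "('a::real_normed_vector \<Rightarrow> 'b::real_normed_vector) \<Rightarrow> bool" where
  "smooth_fun f \<longleftrightarrow> (\<forall>k. Ck_on k f UNIV)"

lemma Ck_on_SucI:
  assumes "\<And>x. (f has_derivative f' x) (at x)" and "\<And>u. Ck_on k (\<lambda>x. f' x u) UNIV"
  shows "Ck_on (Suc k) f UNIV"
proof -
  have "frechet_derivative f (at x) = f' x" for x
    using frechet_derivative_at[OF assms(1)] by simp
  then show ?thesis using assms by (auto simp: differentiable_def)
qed

lemma Ck_on_SucE:
  assumes "Ck_on (Suc k) f UNIV"
  obtains f' where "\<And>x. (f has_derivative f' x) (at x)" "\<And>u. Ck_on k (\<lambda>x. f' x u) UNIV"
proof
  show "(f has_derivative frechet_derivative f (at x)) (at x)" for x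
    using assms by (simp add: frechet_derivative_works[symmetric])
qed (use assms in simp)

lemma Ck_on_Suc_imp: "Ck_on (Suc k) f UNIV \<Longrightarrow> Ck_on k f UNIV"
proof (induction k arbitrary: f)
  case 0
  then show ?case
    by (simp add: differentiable_imp_continuous_on differentiable_on_def)
next
  case (Suc k)
  then show ?case by (metis Ck_on.simps(2))
qed

lemma Ck_on_const: "Ck_on k (\<lambda>x. c) UNIV"
proof (induction k arbitrary: c)
  case 0 then show ?case by simp
next
  case (Suc k)
  show ?case by (rule Ck_on_SucI[where f' = "\<lambda>x u. 0"]) (auto intro: Suc)
qed

lemma Ck_on_add:
  "Ck_on k f UNIV \<Longrightarrow> Ck_on k g UNIV \<Longrightarrow> Ck_on k (\<lambda>x. f x + g x) UNIV"
proof (induction k arbitrary: f g)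
  case 0 then show ?case by (simp add: continuous_on_add)
next
  case (Suc k)
  obtain f' where f: "\<And>x. (f has_derivative f' x) (at x)" "\<And>u. Ck_on k (\<lambda>x. f' x u) UNIV"
    using Suc.prems(1) by (rule Ck_on_SucE) blast
  obtain g' where g: "\<And>x. (g has_derivative g' x) (at x)" "\<And>u. Ck_on k (\<lambda>x. g' x u) UNIV"
    using Suc.prems(2) by (rule Ck_on_SucE) blast
  show ?case
    by (rule Ck_on_SucI[where f' = "\<lambda>x u. f' x u + g' x u"])
       (auto intro!: has_derivative_add f g Suc.IH)
qed

lemma Ck_on_bounded_linear:
  assumes L: "bounded_linear L" and "Ck_on k f UNIV"
  shows "Ck_on k (\<lambda>x. L (f x)) UNIV"
  using assms(2)
proof (induction k arbitrary: f)
  case 0 then show ?case using L by (simp add: bounded_linear.continuous_on)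
next
  case (Suc k)
  obtain f' where f: "\<And>x. (f has_derivative f' x) (at x)" "\<And>u. Ck_on k (\<lambda>x. f' x u) UNIV"
    using Suc.prems(1) by (rule Ck_on_SucE) blast
  show ?case
    by (rule Ck_on_SucI[where f' = "\<lambda>x u. L (f' x u)"])
       (auto intro!: bounded_linear.has_derivative[OF L] f Suc.IH)
qed

text \<open>
  The product rule expresses the derivative by products of \<open>f\<close>, \<open>g\<close> and their derivatives, so the
  induction also needs that the factors themselves are of class \<open>k\<close>.
\<close>

lemma Ck_on_bounded_bilinear:
  assumes B: "bounded_bilinear B" and "Ck_on k f UNIV" "Ck_on k g UNIV"
  shows "Ck_on k (\<lambda>x. B (f x) (g x)) UNIV"
  using assms(2,3)
proof (induction k arbitrary: f g)
  case 0 then show ?case using B by (simp add: bounded_bilinear.continuous_on)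
next
  case (Suc k)
  note fk = Ck_on_Suc_imp[OF Suc.prems(1)] and gk = Ck_on_Suc_imp[OF Suc.prems(2)]
  obtain f' where f: "\<And>x. (f has_derivative f' x) (at x)" "\<And>u. Ck_on k (\<lambda>x. f' x u) UNIV"
    using Suc.prems(1) by (rule Ck_on_SucE) blast
  obtain g' where g: "\<And>x. (g has_derivative g' x) (at x)" "\<And>u. Ck_on k (\<lambda>x. g' x u) UNIV"
    using Suc.prems(2) by (rule Ck_on_SucE) blast
  show ?case
    by (rule Ck_on_SucI[where f' = "\<lambda>x u. B (f x) (g' x u) + B (f' x u) (g x)"])
       (auto intro!: bounded_bilinear.FDERIV[OF B] f g Suc.IH Ck_on_add fk gk)
qed

lemma Ck_on_inverse:
  fixes f :: "'a::real_normed_vector \<Rightarrow> real"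
  assumes "\<And>x. f x \<noteq> 0" and "Ck_on k f UNIV"
  shows "Ck_on k (\<lambda>x. inverse (f x)) UNIV"
  using assms(2)
proof (induction k)
  case 0 then show ?case using assms(1) by (simp add: continuous_on_inverse)
next
  case (Suc k)
  note IH = Suc.IH[OF Ck_on_Suc_imp[OF Suc.prems]]
  obtain f' where f: "\<And>x. (f has_derivative f' x) (at x)" "\<And>u. Ck_on k (\<lambda>x. f' x u) UNIV"
    using Suc.prems(1) by (rule Ck_on_SucE) blast
  have "Ck_on k (\<lambda>x. - (inverse (f x) * f' x u * inverse (f x))) UNIV" for u
    by (intro Ck_on_bounded_linear[OF bounded_linear_minus[OF bounded_linear_ident]]
        Ck_on_bounded_bilinear[OF bounded_bilinear_mult] IH f)
  then show ?case
    by (intro Ck_on_SucI[where f' = "\<lambda>x u. - (inverse (f x) * f' x u * inverse (f x))"])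
       (auto intro!: Deriv.has_derivative_inverse assms f)
qed

text \<open>
  Sine and cosine are each other's derivatives up to sign, hence the simultaneous induction.
\<close>

lemma Ck_on_sin_cos:
  fixes f :: "'a::real_normed_vector \<Rightarrow> real"
  assumes "Ck_on k f UNIV"
  shows "Ck_on k (\<lambda>x. sin (f x)) UNIV \<and> Ck_on k (\<lambda>x. cos (f x)) UNIV"
  using assms
proof (induction k)
  case 0 then show ?case by (simp add: continuous_on_sin continuous_on_cos)
next
  case (Suc k)
  note IH = Suc.IH[OF Ck_on_Suc_imp[OF Suc.prems]]
  obtain f' where f: "\<And>x. (f has_derivative f' x) (at x)" "\<And>u. Ck_on k (\<lambda>x. f' x u) UNIV"
    using Suc.prems(1) by (rule Ck_on_SucE) blast
  have s: "Ck_on k (\<lambda>x. f' x u * cos (f x)) UNIV" for u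
    by (intro Ck_on_bounded_bilinear[OF bounded_bilinear_mult] f) (use IH in simp)
  have c: "Ck_on k (\<lambda>x. - (f' x u * sin (f x))) UNIV" for u
    by (intro Ck_on_bounded_linear[OF bounded_linear_minus[OF bounded_linear_ident]]
        Ck_on_bounded_bilinear[OF bounded_bilinear_mult] f) (use IH in simp)
  show ?case
  proof
    show "Ck_on (Suc k) (\<lambda>x. sin (f x)) UNIV"
      by (intro Ck_on_SucI[where f' = "\<lambda>x u. f' x u * cos (f x)"] s)
         (use has_derivative_sin[OF f(1)] in simp)
    show "Ck_on (Suc k) (\<lambda>x. cos (f x)) UNIV"
      by (intro Ck_on_SucI[where f' = "\<lambda>x u. - (f' x u * sin (f x))"] c)
         (use has_derivative_cos[OF f(1)] in simp)
  qed
qed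

lemma smooth_fun_imp_smooth_on: "smooth_fun f \<Longrightarrow> open U \<Longrightarrow> smooth_on f U"
proof -
  have "Ck_on k g UNIV \<Longrightarrow> Ck_on k g U" for k and g :: "'a \<Rightarrow> 'b"
    by (induction k arbitrary: g) (auto intro: continuous_on_subset)
  then show "smooth_fun f \<Longrightarrow> open U \<Longrightarrow> smooth_on f U"
    by (auto simp: smooth_fun_def smooth_on_def)
qed

lemma smooth_fun_has_derivative:
  "smooth_fun f \<Longrightarrow> (f has_derivative frechet_derivative f (at x)) (at x)"
  using Ck_on_SucE[of 0 f] frechet_derivative_works unfolding smooth_fun_def
  by (metis Ck_on.simps(2) UNIV_I)

lemma smooth_fun_differentiable: "smooth_fun f \<Longrightarrow> f differentiable (at x)"
  using smooth_fun_has_derivative differentiable_def by blast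

lemma smooth_fun_frechet_derivative:
  "smooth_fun f \<Longrightarrow> smooth_fun (\<lambda>x. frechet_derivative f (at x) u)"
  unfolding smooth_fun_def by (metis Ck_on.simps(2))

lemma smooth_fun_const [intro, simp]: "smooth_fun (\<lambda>x. c)"
  by (simp add: smooth_fun_def Ck_on_const)

lemma smooth_fun_add [intro]: "smooth_fun f \<Longrightarrow> smooth_fun g \<Longrightarrow> smooth_fun (\<lambda>x. f x + g x)"
  by (simp add: smooth_fun_def Ck_on_add)

lemma smooth_fun_bounded_linear:
  "bounded_linear L \<Longrightarrow> smooth_fun f \<Longrightarrow> smooth_fun (\<lambda>x. L (f x))"
  by (simp add: smooth_fun_def Ck_on_bounded_linear)

lemma smooth_fun_linear:
  fixes L :: "'a::euclidean_space \<Rightarrow> 'b::real_normed_vector"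
  assumes "linear L" shows "smooth_fun L"
proof -
  have L: "bounded_linear L" using assms by (simp add: linear_conv_bounded_linear)
  have "Ck_on k L UNIV" for k
  proof (cases k)
    case 0 then show ?thesis using L by (simp add: linear_continuous_on)
  next
    case (Suc l)
    then show ?thesis
      using Ck_on_SucI[of L "\<lambda>x. L" l] bounded_linear_imp_has_derivative[OF L] Ck_on_const by blast
  qed
  then show ?thesis by (simp add: smooth_fun_def)
qed

lemma smooth_fun_bounded_bilinear:
  "bounded_bilinear B \<Longrightarrow> smooth_fun f \<Longrightarrow> smooth_fun g \<Longrightarrow> smooth_fun (\<lambda>x. B (f x) (g x))"
  by (simp add: smooth_fun_def Ck_on_bounded_bilinear)

lemmas smooth_fun_mult [intro] = smooth_fun_bounded_bilinear[OF bounded_bilinear_mult]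
  and smooth_fun_scaleR [intro] = smooth_fun_bounded_bilinear[OF bounded_bilinear_scaleR]
  and smooth_fun_inner [intro] = smooth_fun_bounded_bilinear[OF bounded_bilinear_inner]
  and smooth_fun_minus [intro] = smooth_fun_bounded_linear[OF bounded_linear_minus[OF bounded_linear_ident]]

lemma smooth_fun_diff [intro]: "smooth_fun f \<Longrightarrow> smooth_fun g \<Longrightarrow> smooth_fun (\<lambda>x. f x - g x)"
  using smooth_fun_add[OF _ smooth_fun_minus, of f g] by simp

lemma smooth_fun_sum [intro]:
  "(\<And>i. i \<in> A \<Longrightarrow> smooth_fun (f i)) \<Longrightarrow> smooth_fun (\<lambda>x. \<Sum>i\<in>A. f i x)"
  by (induction A rule: infinite_finite_induct) auto

lemma smooth_fun_power [intro]: 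
  fixes f :: "'a::real_normed_vector \<Rightarrow> 'b::real_normed_algebra_1"
  shows "smooth_fun f \<Longrightarrow> smooth_fun (\<lambda>x. f x ^ k)"
  by (induction k) auto

lemma smooth_fun_divide [intro]:
  fixes f g :: "'a::real_normed_vector \<Rightarrow> real"
  shows "smooth_fun f \<Longrightarrow> smooth_fun g \<Longrightarrow> (\<And>x. g x \<noteq> 0) \<Longrightarrow> smooth_fun (\<lambda>x. f x / g x)"
  unfolding divide_inverse
  by (intro smooth_fun_mult) (auto simp: smooth_fun_def intro: Ck_on_inverse)

lemma smooth_fun_sin [intro]:
  fixes f :: "'a::real_normed_vector \<Rightarrow> real"
  shows "smooth_fun f \<Longrightarrow> smooth_fun (\<lambda>x. sin (f x))"
  and smooth_fun_cos [intro]: "smooth_fun f \<Longrightarrow> smooth_fun (\<lambda>x. cos (f x))"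
  by (simp_all add: smooth_fun_def Ck_on_sin_cos)

section \<open>Coordinate metrics with a translation symmetry\<close>

locale coordinate_metric =
  fixes G :: "'e::euclidean_space coord_metric" and U :: "'e set"
  assumes open_U: "open U"
    and smooth: "\<And>u v. smooth_fun (\<lambda>x. G x u v)"
    and bilin: "\<And>x. bilinear (G x)"
    and G_sym: "\<And>x u v. G x u v = G x v u"
    and pos: "\<And>x u. x \<in> U \<Longrightarrow> u \<noteq> 0 \<Longrightarrow> G x u u > 0"
begin

lemma linear_left: "linear (\<lambda>u. G x u v)" and linear_right: "linear (G x u)"
  using bilin by (auto simp: bilinear_def)

lemmas G_simps = linear_add[OF linear_left] linear_add[OF linear_right]
  linear_cmul[OF linear_left] linear_cmul[OF linear_right]
  linear_0[OF linear_left] linear_0[OF linear_right]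
  linear_diff[OF linear_left] linear_diff[OF linear_right]

definition dG :: "'e \<Rightarrow> 'e \<Rightarrow> 'e \<Rightarrow> 'e \<Rightarrow> real" where
  "dG x a u v = frechet_derivative (\<lambda>y. G y u v) (at x) a"

lemma G_has_derivative: "((\<lambda>y. G y u v) has_derivative (\<lambda>a. dG x a u v)) (at x)"
  unfolding dG_def using smooth_fun_has_derivative[OF smooth] by blast

lemma dG_unique: "((\<lambda>y. G y u v) has_derivative D) (at x) \<Longrightarrow> dG x a u v = D a"
  unfolding dG_def using frechet_derivative_at by metis

lemma linear_dG_dir: "linear (\<lambda>a. dG x a u v)"
  using G_has_derivative has_derivative_linear by blast

lemma dG_sym: "dG x a u v = dG x a v u"
  unfolding dG_def by (subst G_sym) simp

lemma linear_dG_right: "linear (dG x a u)"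
proof (rule linearI)
  show "dG x a u (v + w) = dG x a u v + dG x a u w" for v w
    by (rule dG_unique) (use has_derivative_add[OF G_has_derivative G_has_derivative] in
        \<open>simp add: G_simps\<close>)
  show "dG x a u (r *\<^sub>R v) = r *\<^sub>R dG x a u v" for r v
    by (rule dG_unique[where D = "\<lambda>a. r *\<^sub>R dG x a u v"])
       (use has_derivative_scaleR_right[OF G_has_derivative] in \<open>simp add: G_simps\<close>)
qed

lemma linear_dG_left: "linear (\<lambda>u. dG x a u v)"
  using linear_dG_right[of x a v] by (simp add: dG_sym[of x a _ v])

lemma smooth_dG: "smooth_fun (\<lambda>x. dG x a u v)"
  unfolding dG_def by (intro smooth_fun_frechet_derivative smooth)

definition koszul :: "'e \<Rightarrow> 'e \<Rightarrow> 'e \<Rightarrow> 'e \<Rightarrow> real" where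
  "koszul x u v z = (dG x u v z + dG x v u z - dG x z u v) / 2"

lemma smooth_koszul: "smooth_fun (\<lambda>x. koszul x u v z)"
  unfolding koszul_def by (intro smooth_fun_divide smooth_fun_add smooth_fun_diff smooth_dG) auto

lemma koszul_sym: "koszul x u v z = koszul x v u z"
  unfolding koszul_def using dG_sym[of x z u v] by simp

lemmas dG_simps = linear_add[OF linear_dG_dir] linear_add[OF linear_dG_right]
  linear_add[OF linear_dG_left] linear_cmul[OF linear_dG_dir] linear_cmul[OF linear_dG_right]
  linear_cmul[OF linear_dG_left]

lemma linear_koszul: "linear (koszul x u v)"
  by (rule linearI) (simp_all add: koszul_def dG_simps field_simps)

lemma koszul_right_simps:
  "koszul x u (v + w) z = koszul x u v z + koszul x u w z"
  "koszul x u (r *\<^sub>R v) z = r * koszul x u v z"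
  by (simp_all add: koszul_def dG_simps field_simps)

lemma nondegenerate:
  assumes "x \<in> U" and "\<And>z. G x w z = G x w' z" shows "w = w'"
  using pos[of x "w - w'"] assms by (force simp: G_simps)

definition flat :: "'e \<Rightarrow> 'e \<Rightarrow> 'e" where
  "flat x w = (\<Sum>b\<in>Basis. G x w b *\<^sub>R b)"

lemma linear_flat: "linear (flat x)"
  by (rule linearI)
     (simp_all add: flat_def G_simps scaleR_left_distrib sum.distrib scaleR_sum_right)

lemma inner_flat: "flat x w \<bullet> z = G x w z"
proof -
  have "G x w z = G x w (\<Sum>b\<in>Basis. (z \<bullet> b) *\<^sub>R b)" by (simp add: euclidean_representation)
  also have "\<dots> = (\<Sum>b\<in>Basis. (z \<bullet> b) * G x w b)"
    by (simp only: linear_sum[OF linear_right] linear_cmul[OF linear_right]) simp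
  finally show ?thesis by (simp add: flat_def inner_sum_right inner_commute[of _ z] mult.commute)
qed

lemma inj_flat: "x \<in> U \<Longrightarrow> inj (flat x)"
  by (rule injI) (metis inner_flat nondegenerate)

text \<open>
  This is what makes the definite description in \<open>christoffel\<close> meaningful: the Koszul expression is
  linear in its last argument and is represented by exactly one vector.
\<close>

lemma functional_representation:
  assumes "x \<in> U" and \<phi>: "linear \<phi>"
  shows "\<exists>w. \<forall>z. G x w z = \<phi> z"
proof -
  obtain w where "flat x w = (\<Sum>b\<in>Basis. \<phi> b *\<^sub>R b)"
    using linear_injective_imp_surjective[OF linear_flat inj_flat[OF assms(1)]] by (metis surjD)
  then have "G x w b = \<phi> b" if "b \<in> Basis" for b
    using that by (simp add: inner_flat[symmetric])
  then have "G x w = \<phi>" using linear_eq_stdbasis[OF linear_right \<phi>] by blast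
  then show ?thesis by auto
qed

lemma christoffel_koszul:
  assumes "x \<in> U" shows "G x (christoffel G x u v) z = koszul x u v z"
proof -
  obtain w where w: "\<forall>z. G x w z = koszul x u v z"
    using functional_representation[OF assms linear_koszul] by blast
  have "\<forall>z. G x (christoffel G x u v) z = (frechet_derivative (\<lambda>y. G y v z) (at x) u
      + frechet_derivative (\<lambda>y. G y u z) (at x) v
      - frechet_derivative (\<lambda>y. G y u v) (at x) z) / 2"
    unfolding christoffel_def
  proof (rule theI[of _ w])
    show "\<forall>z. G x w z = (frechet_derivative (\<lambda>y. G y v z) (at x) u
      + frechet_derivative (\<lambda>y. G y u z) (at x) v
      - frechet_derivative (\<lambda>y. G y u v) (at x) z) / 2"
      using w unfolding koszul_def dG_def .
    then show "w' = w" if "\<forall>z. G x w' z = (frechet_derivative (\<lambda>y. G y v z) (at x) u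
      + frechet_derivative (\<lambda>y. G y u z) (at x) v
      - frechet_derivative (\<lambda>y. G y u v) (at x) z) / 2" for w'
      using that nondegenerate[OF assms, of w' w] by presburger
  qed
  then show ?thesis by (simp add: koszul_def dG_def)
qed

lemma christoffel_sym: "x \<in> U \<Longrightarrow> christoffel G x u v = christoffel G x v u"
  by (rule nondegenerate[of x]) (simp_all add: christoffel_koszul koszul_sym[of x u v])

lemma linear_christoffel: "x \<in> U \<Longrightarrow> linear (christoffel G x u)"
  by (rule linearI; rule nondegenerate[of x])
     (simp_all add: christoffel_koszul koszul_right_simps G_simps)

text \<open>
  Curvature involves derivatives of Christoffel symbols, which are only known as solutions \<open>w\<close> of a
  linear system depending on the point.  Writing \<open>q = w - w(x\<^sub>0)\<close> and applying the inverse \<open>N\<close> of the system at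
  \<open>x\<^sub>0\<close>, the system becomes \<open>N (flat x (q x)) = d x\<close> with \<open>d\<close> smooth and \<open>d(x\<^sub>0) = 0\<close>.  Since \<open>N \<circ> flat x\<close> tends
  to the identity, \<open>q\<close> and \<open>d\<close> differ by a term of smaller order than \<open>x - x\<^sub>0\<close> and have the same derivative.
\<close>

lemma solution_differentiable:
  assumes k: "\<And>z. smooth_fun (\<lambda>x. k x z)" and w: "\<And>x z. x \<in> U \<Longrightarrow> G x (w x) z = k x z"
    and x0: "x0 \<in> U"
  shows "w differentiable (at x0)"
proof -
  obtain N where N: "linear N" "\<And>v. N (flat x0 v) = v"
    using linear_injective_left_inverse[OF linear_flat inj_flat[OF x0]] by (metis comp_apply id_apply)
  have bN: "bounded_linear N" using N(1) by (simp add: linear_conv_bounded_linear)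
  define d where "d x = N (\<Sum>b\<in>Basis. (k x b - G x (w x0) b) *\<^sub>R b)" for x
  have "smooth_fun d" unfolding d_def
    by (intro smooth_fun_bounded_linear[OF bN] smooth_fun_sum smooth_fun_scaleR smooth_fun_diff k smooth)
       simp
  then obtain d' where d': "(d has_derivative d') (at x0)"
    using smooth_fun_has_derivative by blast
  have d0: "d x0 = 0" unfolding d_def using w[OF x0] linear_0[OF N(1)] by simp
  define q where "q x = w x - w x0" for x
  have dq: "d x = N (flat x (q x))" if "x \<in> U" for x
    unfolding d_def flat_def q_def using w[OF that] by (simp add: G_simps)
  \<comment> \<open>\<open>\<epsilon> x\<close> bounds the operator norm of \<open>id - N \<circ> flat x\<close>\<close>
  define \<epsilon> where "\<epsilon> x = (\<Sum>b\<in>Basis. norm (b - N (flat x b)))" for x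
  have "smooth_fun (\<lambda>x. b - N (flat x b))" for b unfolding flat_def
    by (intro smooth_fun_bounded_linear[OF bN] smooth_fun_sum smooth_fun_scaleR smooth_fun_diff smooth)
       simp_all
  then have cont: "isCont (\<lambda>x. b - N (flat x b)) x0" for b
    using smooth_fun_differentiable differentiable_imp_continuous_within by blast
  have "isCont \<epsilon> x0" unfolding \<epsilon>_def
    by (intro continuous_sum continuous_norm cont)
  moreover have "\<epsilon> x0 = 0" unfolding \<epsilon>_def by (simp add: N)
  ultimately have \<epsilon>0: "(\<epsilon> \<longlongrightarrow> 0) (at x0)" by (simp add: isCont_def)
  have est: "norm (q x - d x) \<le> \<epsilon> x * norm (q x)" if "x \<in> U" for x
  proof -
    let ?E = "\<lambda>v. v - N (flat x v)"
    have lE: "linear ?E"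
      using linear_compose_sub[OF linear_id linear_compose[OF linear_flat N(1)]] by (simp add: o_def id_def)
    have "q x - d x = ?E (\<Sum>b\<in>Basis. (q x \<bullet> b) *\<^sub>R b)"
      by (simp add: dq[OF that] euclidean_representation)
    also have "\<dots> = (\<Sum>b\<in>Basis. (q x \<bullet> b) *\<^sub>R ?E b)"
      by (simp only: linear_sum[OF lE] linear_cmul[OF lE])
    also have "norm \<dots> \<le> (\<Sum>b\<in>Basis. norm (q x) * norm (?E b))"
      by (rule sum_norm_le) (simp add: Basis_le_norm mult_right_mono)
    finally show ?thesis by (simp add: \<epsilon>_def sum_distrib_left mult.commute)
  qed
  have near: "\<forall>\<^sub>F x in at x0. x \<in> U" using open_U x0 by (rule eventually_at_in_open')
  have half: "\<forall>\<^sub>F x in at x0. \<epsilon> x < 1/2" using \<epsilon>0 by (rule order_tendstoD) simp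
  have dlim: "((\<lambda>x. norm (d x - d x0 - d' (x - x0)) / norm (x - x0)) \<longlongrightarrow> 0) (at x0)"
    using d' by (simp add: has_derivative_iff_norm)
  have bd: "bounded_linear d'" using d' by (rule has_derivative_bounded_linear)
  obtain C where C: "\<And>v. norm (d' v) \<le> norm v * C" "C > 0" using bounded_linear.pos_bounded[OF bd] by blast
  have lim: "((\<lambda>x. (norm (d x - d x0 - d' (x - x0)) / norm (x - x0)) * (1 + 2 * \<epsilon> x) + 2 * \<epsilon> x * C)
      \<longlongrightarrow> 0 * (1 + 2 * 0) + 2 * 0 * C) (at x0)"
    by (intro tendsto_intros dlim \<epsilon>0)
  have "((\<lambda>x. norm (w x - w x0 - d' (x - x0)) / norm (x - x0)) \<longlongrightarrow> 0) (at x0)"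
  proof (rule tendsto_sandwich[OF _ _ tendsto_const])
    show "\<forall>\<^sub>F x in at x0. norm (w x - w x0 - d' (x - x0)) / norm (x - x0)
        \<le> (norm (d x - d x0 - d' (x - x0)) / norm (x - x0)) * (1 + 2 * \<epsilon> x) + 2 * \<epsilon> x * C"
      using near half
    proof eventually_elim
      case (elim x)
      let ?r = "norm (d x - d x0 - d' (x - x0))" and ?n = "norm (x - x0)"
      have e0: "0 \<le> \<epsilon> x" unfolding \<epsilon>_def by (simp add: sum_nonneg)
      have "norm (q x) \<le> norm (q x - d x) + norm (d x)" using norm_triangle_ineq[of "q x - d x" "d x"] by simp
      also have "\<dots> \<le> 1/2 * norm (q x) + norm (d x)"
        using est[OF elim(1)] mult_right_mono[of "\<epsilon> x" "1/2" "norm (q x)"] elim(2) by simp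
      finally have q2: "norm (q x) \<le> 2 * norm (d x)" by simp
      have dn: "norm (d x) \<le> ?r + ?n * C"
        using norm_triangle_ineq[of "d x - d x0 - d' (x - x0)" "d' (x - x0)"] C(1)[of "x - x0"] d0 by simp
      have "norm (w x - w x0 - d' (x - x0)) \<le> norm (q x - d x) + ?r"
        using norm_triangle_ineq[of "q x - d x" "d x - d x0 - d' (x - x0)"] d0 by (simp add: q_def)
      also have "\<dots> \<le> \<epsilon> x * (2 * (?r + ?n * C)) + ?r"
        using est[OF elim(1)] mult_left_mono[OF order_trans[OF q2 mult_left_mono[OF dn]] e0] by simp
      finally have *: "norm (w x - w x0 - d' (x - x0)) \<le> ?r * (1 + 2 * \<epsilon> x) + ?n * (2 * \<epsilon> x * C)"
        by (simp add: algebra_simps)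
      show ?case
      proof (cases "?n = 0")
        case True then show ?thesis using e0 C(2) by simp
      next
        case False
        then have "?n > 0" by simp
        then show ?thesis using * by (simp add: field_simps)
      qed
    qed
  next
    show "\<forall>\<^sub>F x in at x0. 0 \<le> norm (w x - w x0 - d' (x - x0)) / norm (x - x0)"
      by simp
  qed (use lim in simp)
  then have "(w has_derivative d') (at x0)"
    using bd by (simp add: has_derivative_iff_norm)
  then show ?thesis by (auto simp: differentiable_def)
qed

lemma christoffel_differentiable:
  "x \<in> U \<Longrightarrow> (\<lambda>x. christoffel G x u v) differentiable (at x)"
  by (rule solution_differentiable[where k = "\<lambda>x. koszul x u v"])
     (auto simp: christoffel_koszul smooth_koszul)

end

locale stationary_metric = coordinate_metric +
  fixes e
  assumes shift: "\<And>x s u v. G (x + s *\<^sub>R e) u v = G x u v"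
begin

lemma dG_shift: "dG (x + s *\<^sub>R e) a u v = dG x a u v"
proof (rule sym[OF dG_unique])
  have "((\<lambda>y. y + s *\<^sub>R e) has_derivative (\<lambda>a. a)) (at x)"
    by (auto intro!: derivative_eq_intros)
  from has_derivative_compose[OF this G_has_derivative[of u v "x + s *\<^sub>R e"]]
  show "((\<lambda>y. G y u v) has_derivative (\<lambda>a. dG (x + s *\<^sub>R e) a u v)) (at x)"
    by (simp add: shift)
qed

lemma dG_stationary: "dG x e u v = 0"
proof -
  have "((\<lambda>s::real. x + s *\<^sub>R e) has_derivative (\<lambda>s. s *\<^sub>R e)) (at 0)"
    by (auto intro!: derivative_eq_intros)
  from has_derivative_compose[OF this, of "\<lambda>y. G y u v" "\<lambda>a. dG x a u v"]
  have "((\<lambda>s::real. G x u v) has_derivative (\<lambda>s. dG x (s *\<^sub>R e) u v)) (at 0)"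
    using G_has_derivative[of u v x] by (simp add: shift)
  from has_derivative_unique[OF this has_derivative_const]
  show ?thesis by (metis scaleR_one)
qed

lemma christoffel_shift: "christoffel G (x + s *\<^sub>R e) u v = christoffel G x u v"
  using dG_shift unfolding christoffel_def dG_def shift by simp

lemma velocity_line: "velocity (\<lambda>t. t *\<^sub>R e) = (\<lambda>t. e)"
  unfolding velocity_def by (rule ext, rule vector_derivative_at) (auto intro!: derivative_eq_intros)

lemma christoffel_line: "christoffel G (s *\<^sub>R e) = christoffel G (t *\<^sub>R e)"
  using christoffel_shift[of "t *\<^sub>R e" "s - t"] by (auto simp: algebra_simps)

lemma christoffel_line_zero:
  assumes "t *\<^sub>R e \<in> U" and "\<And>z. dG (t *\<^sub>R e) z e e = 0"
  shows "christoffel G (t *\<^sub>R e) e e = 0"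
  by (rule nondegenerate[OF assms(1)])
     (simp add: christoffel_koszul assms koszul_def dG_stationary G_simps)

text \<open>
  The velocity is the constant field \<open>e\<close>, so only \<open>\<Gamma>(e,e)\<close> matters.  Its pairing with \<open>z\<close> is
  \<open>-\<partial>\<^sub>z G(e,e)/2\<close>, because derivatives along \<open>e\<close> vanish.
\<close>

lemma geodesic_line:
  assumes "t *\<^sub>R e \<in> U" and "\<And>z. dG (t *\<^sub>R e) z e e = 0"
  shows "geodesic_equation G (\<lambda>t. t *\<^sub>R e) t"
  unfolding geodesic_equation_def covariant_deriv_def velocity_line
  by (simp add: christoffel_line_zero[OF assms])

text \<open>
  With \<open>\<Gamma>\<close> constant along the line and \<open>\<Gamma>(e,e) = 0\<close> on it, the terms \<open>\<Gamma>(e,\<Gamma>(e,y))\<close> of the second covariant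
  derivative and of the curvature cancel.  What remains is the linearized geodesic equation
  \<open>y'' + 2 \<Gamma>(e,y') + D\<^sub>y(\<Gamma>(e,e)) = 0\<close>; the last hypothesis is this equation paired with \<open>z\<close>.
\<close>

lemma jacobi_line:
  assumes q: "t *\<^sub>R e \<in> U" and crit: "\<And>z. dG (t *\<^sub>R e) z e e = 0"
    and y: "\<And>s. (y has_vector_derivative y1 s) (at s)" "\<And>s. (y1 has_vector_derivative y2 s) (at s)"
    and eq: "\<And>z. G (t *\<^sub>R e) (y2 t) z + dG (t *\<^sub>R e) (y1 t) e z - dG (t *\<^sub>R e) z e (y1 t)
      - frechet_derivative (\<lambda>x. dG x z e e) (at (t *\<^sub>R e)) (y t) / 2 = 0"
  shows "jacobi_equation G (\<lambda>t. t *\<^sub>R e) y t"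
proof -
  let ?q = "t *\<^sub>R e" and ?\<Gamma> = "christoffel G (t *\<^sub>R e)"
  have lin: "linear (?\<Gamma> u)" for u by (rule linear_christoffel[OF q])
  have bl: "bounded_linear (?\<Gamma> u)" for u using lin by (simp add: linear_conv_bounded_linear)
  have \<Gamma>0: "?\<Gamma> e e = 0" by (rule christoffel_line_zero[OF q crit])
  have cov: "covariant_deriv G (\<lambda>t. t *\<^sub>R e) y = (\<lambda>s. y1 s + ?\<Gamma> e (y s))"
    unfolding covariant_deriv_def velocity_line vector_derivative_at[OF y(1)]
    by (rule ext) (metis christoffel_line)
  have "((\<lambda>s. y1 s + ?\<Gamma> e (y s)) has_vector_derivative y2 t + ?\<Gamma> e (y1 t)) (at t)"
    by (intro has_vector_derivative_add y bounded_linear.has_vector_derivative[OF bl])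
  then have covcov: "covariant_deriv G (\<lambda>t. t *\<^sub>R e) (covariant_deriv G (\<lambda>t. t *\<^sub>R e) y) t
      = y2 t + ?\<Gamma> e (y1 t) + ?\<Gamma> e (y1 t + ?\<Gamma> e (y t))"
    unfolding cov unfolding covariant_deriv_def velocity_line by (simp add: vector_derivative_at)
  have diff: "((\<lambda>p. christoffel G p u v) has_derivative
      frechet_derivative (\<lambda>p. christoffel G p u v) (at ?q)) (at ?q)" for u v
    using christoffel_differentiable[OF q] frechet_derivative_works by blast
  have along: "frechet_derivative (\<lambda>p. christoffel G p u v) (at ?q) e = 0" for u v
  proof -
    have "((\<lambda>s::real. ?q + s *\<^sub>R e) has_derivative (\<lambda>s. s *\<^sub>R e)) (at 0)"
      by (auto intro!: derivative_eq_intros)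
    from has_derivative_compose[OF this, of "\<lambda>p. christoffel G p u v"]
    have "((\<lambda>s::real. ?\<Gamma> u v) has_derivative
        (\<lambda>s. frechet_derivative (\<lambda>p. christoffel G p u v) (at ?q) (s *\<^sub>R e))) (at 0)"
      using diff[of u v] by (simp add: christoffel_shift)
    from has_derivative_unique[OF this has_derivative_const]
    show ?thesis by (metis scaleR_one)
  qed
  \<comment> \<open>\<open>\<Gamma>(e,e)\<close> vanishes at the base point, so differentiating \<open>G\<^sub>p(\<Gamma>\<^sub>p(e,e), z)\<close> leaves only \<open>G(K a, z)\<close>\<close>
  define K where "K = frechet_derivative (\<lambda>p. christoffel G p e e) (at ?q)"
  have GK: "G ?q (K a) z = - frechet_derivative (\<lambda>x. dG x z e e) (at ?q) a / 2" for a z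
  proof -
    have rep: "G p w z = (\<Sum>b\<in>Basis. (w \<bullet> b) * G p b z)" for p w
      using linear_sum[OF linear_left[of p z], of "\<lambda>b. (w \<bullet> b) *\<^sub>R b" Basis]
      by (simp add: G_simps euclidean_representation)
    have inner: "((\<lambda>p. christoffel G p e e \<bullet> b) has_derivative (\<lambda>a. K a \<bullet> b)) (at ?q)" for b
      unfolding K_def by (intro has_derivative_inner_left diff)
    have "((\<lambda>p. G p (christoffel G p e e) z) has_derivative
      (\<lambda>a. \<Sum>b\<in>Basis. (?\<Gamma> e e \<bullet> b) * dG ?q a b z + (K a \<bullet> b) * G ?q b z)) (at ?q)"
      by (subst rep) (intro has_derivative_sum has_derivative_mult inner G_has_derivative)
    moreover have "(\<Sum>b\<in>Basis. (?\<Gamma> e e \<bullet> b) * dG ?q a b z + (K a \<bullet> b) * G ?q b z) = G ?q (K a) z" for a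
      by (simp add: \<Gamma>0 rep[symmetric])
    ultimately have 1: "((\<lambda>p. G p (christoffel G p e e) z) has_derivative (\<lambda>a. G ?q (K a) z)) (at ?q)"
      by simp
    have 2: "((\<lambda>p. - dG p z e e / 2) has_derivative
        (\<lambda>a. - frechet_derivative (\<lambda>x. dG x z e e) (at ?q) a / 2)) (at ?q)"
      using has_derivative_scaleR_right[OF smooth_fun_has_derivative[OF smooth_dG[where a = z and u = e and v = e], of ?q], of "-1/2"]
      by simp
    have 3: "- dG p z e e / 2 = G p (christoffel G p e e) z" if "p \<in> U" for p
      using christoffel_koszul[OF that, of e e z] by (simp add: koszul_def dG_stationary)
    show ?thesis
      using has_derivative_unique[OF 1 has_derivative_transform_within_open[OF 2 open_U q 3]]
      by metis
  qed
  have "y2 t + (?\<Gamma> e (y1 t) + ?\<Gamma> e (y1 t)) + K (y t) = 0"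
  proof (rule nondegenerate[OF q])
    fix z
    have "2 * koszul ?q e (y1 t) z = dG ?q (y1 t) e z - dG ?q z e (y1 t)"
      by (simp add: koszul_def dG_stationary)
    then show "G ?q (y2 t + (?\<Gamma> e (y1 t) + ?\<Gamma> e (y1 t)) + K (y t)) z = G ?q 0 z"
      using eq[of z] by (simp add: G_simps GK christoffel_koszul[OF q])
  qed
  then show ?thesis
    unfolding jacobi_equation_def covcov curvature_def velocity_line
    by (simp add: along \<Gamma>0 K_def[symmetric] linear_add[OF lin] linear_0[OF lin]
        christoffel_sym[OF q, of "y t" e] algebra_simps)
qed

end

section \<open>Matrices and the Lie algebra \<open>sp(n+1)\<close>\<close>

lemma sum_index:
  fixes f :: "'n::finite index \<Rightarrow> 'b::comm_monoid_add"
  shows "(\<Sum>i\<in>UNIV. f i) = (\<Sum>i\<in>UNIV. f (Inl i) + f (Inr i))"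
proof -
  have "(\<Sum>i\<in>UNIV. f i) = (\<Sum>i\<in>range Inl. f i) + (\<Sum>i\<in>range Inr. f i)"
    unfolding UNIV_sum by (rule sum.union_disjoint) auto
  then show ?thesis by (simp add: sum.reindex sum.distrib)
qed

lemma sum_option:
  fixes f :: "'n::finite option \<Rightarrow> 'b::comm_monoid_add"
  shows "(\<Sum>i\<in>UNIV. f i) = f None + (\<Sum>i\<in>UNIV. f (Some i))"
  by (simp add: UNIV_option_conv sum.reindex)

lemma index_cases:
  obtains "i = Inl None" | "i = Inr None" | k where "i = Inl (Some k)" | k where "i = Inr (Some k)"
  by (cases i) (metis not_None_eq)+

lemma matrix_mult_nth: "(A ** B) $ i $ j = (\<Sum>k\<in>UNIV. A $ i $ k * B $ k $ j)"
  by (simp add: matrix_matrix_mult_def)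

lemma bounded_bilinear_matrix_mult:
  "bounded_bilinear ((**) :: 'n::finite cmat \<Rightarrow> 'n cmat \<Rightarrow> 'n cmat)"
proof -
  have "bilinear ((**) :: 'n cmat \<Rightarrow> 'n cmat \<Rightarrow> 'n cmat)"
    by (auto simp: bilinear_def linear_iff vec_eq_iff matrix_mult_nth scaleR_sum_right
        sum.distrib algebra_simps)
  then show ?thesis by (simp add: bilinear_conv_bounded_bilinear)
qed

interpretation mm: bounded_bilinear "(**) :: 'n::finite cmat \<Rightarrow> 'n cmat \<Rightarrow> 'n cmat"
  by (rule bounded_bilinear_matrix_mult)

lemma conj_transpose_nth: "conj_transpose X $ i $ j = cnj (X $ j $ i)"
  by (simp add: conj_transpose_def)

lemma conj_transpose_mult: "conj_transpose (A ** B) = conj_transpose B ** conj_transpose A"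
  by (simp add: vec_eq_iff conj_transpose_nth matrix_mult_nth mult.commute)

lemma conj_transpose_conj_transpose [simp]: "conj_transpose (conj_transpose A) = A"
  by (simp add: vec_eq_iff conj_transpose_nth)

lemma conj_transpose_one [simp]: "conj_transpose (mat 1) = mat 1"
  by (simp add: vec_eq_iff conj_transpose_nth mat_def)

lemma bounded_linear_conj_transpose:
  "bounded_linear (conj_transpose :: 'n::finite cmat \<Rightarrow> 'n cmat)"
proof -
  have "linear (conj_transpose :: 'n cmat \<Rightarrow> 'n cmat)"
    by (rule linearI) (simp_all add: vec_eq_iff conj_transpose_nth)
  then show ?thesis by (simp add: linear_conv_bounded_linear)
qed

lemmas conj_transpose_simps =
  linear_add[OF bounded_linear.linear[OF bounded_linear_conj_transpose]]
  linear_cmul[OF bounded_linear.linear[OF bounded_linear_conj_transpose]]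
  linear_0[OF bounded_linear.linear[OF bounded_linear_conj_transpose]]
  linear_neg[OF bounded_linear.linear[OF bounded_linear_conj_transpose]]
  linear_diff[OF bounded_linear.linear[OF bounded_linear_conj_transpose]]

lemma bounded_linear_transpose:
  "bounded_linear (transpose :: 'n::finite cmat \<Rightarrow> 'n cmat)"
proof -
  have "linear (transpose :: 'n cmat \<Rightarrow> 'n cmat)"
    by (rule linearI) (simp_all add: vec_eq_iff transpose_def)
  then show ?thesis by (simp add: linear_conv_bounded_linear)
qed

lemmas transpose_simps =
  linear_add[OF bounded_linear.linear[OF bounded_linear_transpose]]
  linear_cmul[OF bounded_linear.linear[OF bounded_linear_transpose]]
  linear_0[OF bounded_linear.linear[OF bounded_linear_transpose]]
  linear_neg[OF bounded_linear.linear[OF bounded_linear_transpose]]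
  linear_diff[OF bounded_linear.linear[OF bounded_linear_transpose]]

lemma inner_cmat: "A \<bullet> B = Re (trace (conj_transpose A ** B))" for A B :: "'n::finite cmat"
proof -
  have "A \<bullet> B = (\<Sum>i\<in>UNIV. \<Sum>j\<in>UNIV. Re (cnj (A $ i $ j) * B $ i $ j))"
    by (simp add: inner_vec_def inner_complex_def)
  also have "\<dots> = (\<Sum>j\<in>UNIV. \<Sum>i\<in>UNIV. Re (cnj (A $ i $ j) * B $ i $ j))"
    by (rule sum.swap)
  finally show ?thesis by (simp add: trace_def matrix_mult_nth conj_transpose_nth)
qed

lemma trace_mult_commute: "trace (A ** B) = trace (B ** A)" for A B :: "'n::finite cmat"
proof -
  have "trace (A ** B) = (\<Sum>i\<in>UNIV. \<Sum>j\<in>UNIV. A $ i $ j * B $ j $ i)"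
    by (simp add: trace_def matrix_mult_nth)
  also have "\<dots> = (\<Sum>j\<in>UNIV. \<Sum>i\<in>UNIV. A $ i $ j * B $ j $ i)" by (rule sum.swap)
  finally show ?thesis by (simp add: trace_def matrix_mult_nth mult.commute)
qed

lemma inner_elem_mat: "X \<bullet> elem_mat p q = Re (X $ p $ q)"
  and inner_i_elem_mat: "X \<bullet> (mat \<i> ** elem_mat p q) = Im (X $ p $ q)"
proof -
  have 1: "elem_mat p q = axis p (axis q 1)"
    by (auto simp: elem_mat_def axis_def vec_eq_iff)
  have 2: "mat \<i> ** elem_mat p q = axis p (axis q \<i>)"
    by (simp add: vec_eq_iff matrix_mult_nth mat_def elem_mat_def axis_def if_distrib if_distribR
        cong: if_cong)
  show "X \<bullet> elem_mat p q = Re (X $ p $ q)" "X \<bullet> (mat \<i> ** elem_mat p q) = Im (X $ p $ q)"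
    unfolding 2 unfolding 1 by (simp_all add: inner_axis inner_complex_def)
qed

lemma symp_form_nth [simp]:
  "symp_form $ Inl i $ Inl j = 0" "symp_form $ Inr i $ Inr j = 0"
  "symp_form $ Inl i $ Inr j = (if i = j then 1 else 0)"
  "symp_form $ Inr i $ Inl j = (if i = j then -1 else 0)"
  by (auto simp: symp_form_def elem_mat_def sum_negf intro!: sum.neutral)

lemma mult_symp_nth [simp]:
  "(A ** symp_form) $ p $ Inl j = - A $ p $ Inr j"
  "(A ** symp_form) $ p $ Inr j = A $ p $ Inl j"
  "(symp_form ** A) $ Inl i $ q = A $ Inr i $ q"
  "(symp_form ** A) $ Inr i $ q = - A $ Inl i $ q"
  by (simp_all add: matrix_mult_nth sum_index if_distrib if_distribR cong: if_cong)

lemma transpose_nth: "transpose A $ i $ j = A $ j $ i"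
  by (simp add: transpose_def)

lemma symp_form_square: "symp_form ** symp_form = - mat 1"
  unfolding vec_eq_iff
proof (intro allI)
  show "(symp_form ** symp_form :: 'a cmat) $ i $ j = (- mat 1) $ i $ j" for i j
    by (cases i; cases j) (auto simp: mat_def)
qed

lemma transpose_symp_form: "transpose symp_form = - symp_form"
  unfolding vec_eq_iff
proof (intro allI)
  show "transpose (symp_form :: 'a cmat) $ i $ j = (- symp_form) $ i $ j" for i j
    by (cases i; cases j) (auto simp: transpose_nth)
qed

text \<open>
  In block form the elements of the algebra are the skew-Hermitian matrices with rows
  \<open>(A, B)\<close> and \<open>(-cnj B, cnj A)\<close>, that is, skew-Hermitian quaternionic matrices.
\<close>

lemma sp_algebra_iff:
  "X \<in> sp_algebra \<longleftrightarrow> (\<forall>p q. X $ p $ q = - cnj (X $ q $ p)) \<and>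
     (\<forall>i j. X $ Inr i $ Inr j = cnj (X $ Inl i $ Inl j)) \<and>
     (\<forall>i j. X $ Inr i $ Inl j = - cnj (X $ Inl i $ Inr j))"
proof -
  have 1: "conj_transpose X + X = 0 \<longleftrightarrow> (\<forall>p q. X $ p $ q = - cnj (X $ q $ p))"
    by (simp add: vec_eq_iff conj_transpose_nth add_eq_0_iff)
  have 2: "transpose X ** symp_form + symp_form ** X = 0 \<longleftrightarrow>
      (\<forall>i j. X $ Inr i $ Inl j = X $ Inr j $ Inl i \<and> X $ Inr i $ Inr j = - X $ Inl j $ Inl i
        \<and> - X $ Inr j $ Inr i = X $ Inl i $ Inl j \<and> X $ Inl j $ Inr i = X $ Inl i $ Inr j)"
    (is "?l \<longleftrightarrow> ?r")
  proof -
    let ?M = "transpose X ** symp_form + symp_form ** X"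
    have e: "?M $ Inl i $ Inl j = X $ Inr i $ Inl j - X $ Inr j $ Inl i"
      "?M $ Inl i $ Inr j = X $ Inr i $ Inr j + X $ Inl j $ Inl i"
      "?M $ Inr i $ Inl j = - X $ Inr j $ Inr i - X $ Inl i $ Inl j"
      "?M $ Inr i $ Inr j = X $ Inl j $ Inr i - X $ Inl i $ Inr j" for i j
      by (simp_all add: transpose_nth)
    have "?l \<longleftrightarrow> (\<forall>i j. ?M $ Inl i $ Inl j = 0 \<and> ?M $ Inl i $ Inr j = 0
        \<and> ?M $ Inr i $ Inl j = 0 \<and> ?M $ Inr i $ Inr j = 0)"
      unfolding vec_eq_iff split_sum_all zero_index by blast
    then show ?thesis unfolding e right_minus_eq eq_neg_iff_add_eq_0 .
  qed
  show ?thesis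
  proof
    assume X: "X \<in> sp_algebra"
    then have a: "\<And>p q. X $ p $ q = - cnj (X $ q $ p)" using 1 unfolding sp_algebra_def by blast
    have b: "X $ Inr i $ Inl j = X $ Inr j $ Inl i" "X $ Inr i $ Inr j = - X $ Inl j $ Inl i" for i j
      using X 2 unfolding sp_algebra_def by blast+
    have "X $ Inr i $ Inr j = cnj (X $ Inl i $ Inl j)" for i j
      using a[of "Inl j" "Inl i"] b(2)[of i j] by simp
    moreover have "X $ Inr i $ Inl j = - cnj (X $ Inl i $ Inr j)" for i j
      using a[of "Inr j" "Inl i"] b(1)[of i j] by simp
    ultimately show "(\<forall>p q. X $ p $ q = - cnj (X $ q $ p)) \<and>
     (\<forall>i j. X $ Inr i $ Inr j = cnj (X $ Inl i $ Inl j)) \<and>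
     (\<forall>i j. X $ Inr i $ Inl j = - cnj (X $ Inl i $ Inr j))" using a by blast
  next
    assume r: "(\<forall>p q. X $ p $ q = - cnj (X $ q $ p)) \<and>
     (\<forall>i j. X $ Inr i $ Inr j = cnj (X $ Inl i $ Inl j)) \<and>
     (\<forall>i j. X $ Inr i $ Inl j = - cnj (X $ Inl i $ Inr j))"
    then have a: "\<And>p q. X $ p $ q = - cnj (X $ q $ p)"
      and b: "\<And>i j. X $ Inr i $ Inr j = cnj (X $ Inl i $ Inl j)"
      and c: "\<And>i j. X $ Inr i $ Inl j = - cnj (X $ Inl i $ Inr j)" by blast+
    have "X $ Inr i $ Inl j = X $ Inr j $ Inl i" for i j
      using a[of "Inr i" "Inl j"] c[of j i] by simp
    moreover have "X $ Inr i $ Inr j = - X $ Inl j $ Inl i" for i j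
      using a[of "Inl j" "Inl i"] b[of i j] by simp
    moreover have "- X $ Inr j $ Inr i = X $ Inl i $ Inl j" for i j
      using a[of "Inl i" "Inl j"] b[of j i] by simp
    moreover have "X $ Inl j $ Inr i = X $ Inl i $ Inr j" for i j
      using a[of "Inl j" "Inr i"] c[of i j] by simp
    ultimately show "X \<in> sp_algebra" using 1 2 a unfolding sp_algebra_def by blast
  qed
qed

lemma sp_algebraD:
  assumes "X \<in> sp_algebra"
  shows "X $ p $ q = - cnj (X $ q $ p)" "X $ Inr i $ Inr j = cnj (X $ Inl i $ Inl j)"
    "X $ Inr i $ Inl j = - cnj (X $ Inl i $ Inr j)"
  using assms unfolding sp_algebra_iff by blast+

lemma sp_algebraI:
  assumes "\<And>p q. X $ p $ q = - cnj (X $ q $ p)" "\<And>i j. X $ Inr i $ Inr j = cnj (X $ Inl i $ Inl j)"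
    "\<And>i j. X $ Inr i $ Inl j = - cnj (X $ Inl i $ Inr j)"
  shows "X \<in> sp_algebra"
  using assms unfolding sp_algebra_iff by blast

lemma subspace_sp_algebra: "subspace (sp_algebra :: 'n::finite cmat set)"
  unfolding subspace_def sp_algebra_def
  by (auto simp: conj_transpose_simps transpose_simps mm.add_left mm.add_right mm.scaleR_left
      mm.scaleR_right algebra_simps simp flip: scaleR_right_distrib)

type_synonym 'n horizontal = "(complex, 'n) vec \<times> (complex, 'n) vec"

text \<open>
  The tangent vector at the origin with prescribed first row \<open>(0, p, a, q)\<close>, where \<open>a\<close> stands in column \<open>n+2\<close>.
  The remaining entries are forced by \<open>sp_algebra_iff\<close> and by the vanishing of the isotropy blocks.
\<close>

fun tangent_entry :: "'n::finite coords \<Rightarrow> 'n index \<Rightarrow> 'n index \<Rightarrow> complex" where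
  "tangent_entry (a, p, q) (Inl None) (Inl None) = 0"
| "tangent_entry (a, p, q) (Inl None) (Inr None) = a"
| "tangent_entry (a, p, q) (Inl None) (Inl (Some k)) = p $ k"
| "tangent_entry (a, p, q) (Inl None) (Inr (Some k)) = q $ k"
| "tangent_entry (a, p, q) (Inr None) (Inl None) = - cnj a"
| "tangent_entry (a, p, q) (Inr None) (Inr None) = 0"
| "tangent_entry (a, p, q) (Inr None) (Inl (Some k)) = - cnj (q $ k)"
| "tangent_entry (a, p, q) (Inr None) (Inr (Some k)) = cnj (p $ k)"
| "tangent_entry (a, p, q) (Inl (Some k)) (Inl None) = - cnj (p $ k)"
| "tangent_entry (a, p, q) (Inl (Some k)) (Inr None) = q $ k"
| "tangent_entry (a, p, q) (Inr (Some k)) (Inl None) = - cnj (q $ k)"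
| "tangent_entry (a, p, q) (Inr (Some k)) (Inr None) = - p $ k"
| "tangent_entry (a, p, q) (Inl (Some k)) (Inl (Some l)) = 0"
| "tangent_entry (a, p, q) (Inl (Some k)) (Inr (Some l)) = 0"
| "tangent_entry (a, p, q) (Inr (Some k)) (Inl (Some l)) = 0"
| "tangent_entry (a, p, q) (Inr (Some k)) (Inr (Some l)) = 0"

definition tangent_mat :: "'n::finite coords \<Rightarrow> 'n cmat" where
  "tangent_mat z = (\<chi> i j. tangent_entry z i j)"

definition row_coords :: "'n::finite cmat \<Rightarrow> 'n coords" where
  "row_coords X = (X $ Inl None $ Inr None,
     (\<chi> k. X $ Inl None $ Inl (Some k)), (\<chi> k. X $ Inl None $ Inr (Some k)))"

lemma tangent_mat_nth: "tangent_mat z $ i $ j = tangent_entry z i j"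
  by (simp add: tangent_mat_def)

lemma row_coords_tangent_mat [simp]: "row_coords (tangent_mat z) = z"
  by (cases z) (simp add: row_coords_def tangent_mat_nth vec_eq_iff)

lemma linear_row_coords: "linear (row_coords :: 'n::finite cmat \<Rightarrow> 'n coords)"
  by (rule linearI) (simp_all add: row_coords_def vec_eq_iff)

lemma linear_tangent_mat: "linear (tangent_mat :: 'n::finite coords \<Rightarrow> 'n cmat)"
proof (rule linearI; unfold vec_eq_iff, intro allI)
  show "tangent_mat (x + y) $ i $ j = (tangent_mat x + tangent_mat y) $ i $ j"
    for x y :: "'n coords" and i j
    by (cases x; cases y; cases i rule: index_cases; cases j rule: index_cases)
       (simp_all add: tangent_mat_nth)
  show "tangent_mat (r *\<^sub>R x) $ i $ j = (r *\<^sub>R tangent_mat x) $ i $ j"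
    for r and x :: "'n coords" and i j
    by (cases x; cases i rule: index_cases; cases j rule: index_cases)
       (simp_all add: tangent_mat_nth)
qed

lemma tangent_mat_in_sp: "tangent_mat z \<in> sp_algebra"
proof (rule sp_algebraI)
  show "tangent_mat z $ i $ j = - cnj (tangent_mat z $ j $ i)" for i j
    by (cases z; cases i rule: index_cases; cases j rule: index_cases)
       (simp_all add: tangent_mat_nth)
  show "tangent_mat z $ Inr i $ Inr j = cnj (tangent_mat z $ Inl i $ Inl j)"
    "tangent_mat z $ Inr i $ Inl j = - cnj (tangent_mat z $ Inl i $ Inr j)" for i j
    by (cases z; cases i; cases j; simp add: tangent_mat_nth)+
qed

lemma sp_algebra_eqI:
  assumes "X \<in> sp_algebra" "Y \<in> sp_algebra" "row_coords X = row_coords Y"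
    and "X $ Inl None $ Inl None = Y $ Inl None $ Inl None"
    and "\<And>k l. X $ Inl (Some k) $ Inl (Some l) = Y $ Inl (Some k) $ Inl (Some l)"
    and "\<And>k l. X $ Inl (Some k) $ Inr (Some l) = Y $ Inl (Some k) $ Inr (Some l)"
  shows "X = Y"
proof -
  have row: "X $ Inl None $ j = Y $ Inl None $ j" for j
    using assms(3,4) by (cases j rule: index_cases) (auto simp: row_coords_def vec_eq_iff)
  have "X $ Inl i $ j = Y $ Inl i $ j" for i j
  proof (cases i)
    case None then show ?thesis using row by simp
  next
    case (Some k)
    have 1: "X $ Inl i $ Inl None = Y $ Inl i $ Inl None"
      using sp_algebraD(1)[OF assms(1)] sp_algebraD(1)[OF assms(2)] row by metis
    have "X $ Inr None $ Inl i = Y $ Inr None $ Inl i"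
      using sp_algebraD(3)[OF assms(1)] sp_algebraD(3)[OF assms(2)] row by metis
    then have 2: "X $ Inl i $ Inr None = Y $ Inl i $ Inr None"
      using sp_algebraD(1)[OF assms(1)] sp_algebraD(1)[OF assms(2)] by metis
    show ?thesis using 1 2 assms(5,6) Some by (cases j rule: index_cases) auto
  qed
  moreover from this have "X $ Inr i $ j = Y $ Inr i $ j" for i j
    using sp_algebraD(2,3)[OF assms(1)] sp_algebraD(2,3)[OF assms(2)] by (cases j) metis+
  ultimately show ?thesis by (simp add: vec_eq_iff split_sum_all)
qed

section \<open>The isotropy representation\<close>

lemma elem_mat_nth: "elem_mat p q $ i $ j = (if i = p \<and> j = q then 1 else 0)"
  by (simp add: elem_mat_def)

lemma mat_scalar_mult_nth: "(mat c ** A) $ p $ q = c * A $ p $ q" for A :: "'n::finite cmat"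
  by (simp add: matrix_mult_nth mat_def if_distrib if_distribR cong: if_cong)

lemmas root_mat_defs = A_mat_def S_mat_def A_plus_def S_plus_def Xp_def Xm_def Xp_plus_def Xm_plus_def

lemma elem_mat_conj_transpose: "conj_transpose (elem_mat p q) = elem_mat q p"
  and elem_mat_transpose: "transpose (elem_mat p q) = elem_mat q p"
  by (auto simp: vec_eq_iff conj_transpose_nth transpose_nth elem_mat_nth)

lemma symp_elem_mat:
  "symp_form ** elem_mat (Inl i) q = - elem_mat (Inr i) q"
  "symp_form ** elem_mat (Inr i) q = elem_mat (Inl i) q"
  "elem_mat p (Inl i) ** symp_form = elem_mat p (Inr i)"
  "elem_mat p (Inr i) ** symp_form = - elem_mat p (Inl i)"
  unfolding vec_eq_iff split_sum_all by (auto simp: elem_mat_nth)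

lemma mat_i_mult:
  fixes A :: "'n::finite cmat"
  shows "conj_transpose (mat \<i> ** A) = - (mat \<i> ** conj_transpose A)"
    and "transpose (mat \<i> ** A) = mat \<i> ** transpose A"
    and "(mat \<i> ** A) ** symp_form = mat \<i> ** (A ** symp_form)"
    and "symp_form ** (mat \<i> ** A) = mat \<i> ** (symp_form ** A)"
proof -
  show "(mat \<i> ** A) ** symp_form = mat \<i> ** (A ** symp_form)"
    by (simp add: matrix_mul_assoc)
  show "symp_form ** (mat \<i> ** A) = mat \<i> ** (symp_form ** A)"
    unfolding vec_eq_iff split_sum_all by (simp add: mat_scalar_mult_nth)
qed (simp_all add: vec_eq_iff conj_transpose_nth transpose_nth mat_scalar_mult_nth)

text \<open>
  All generators are sums of elementary matrices, so membership reduces to the rules for transposing an elementary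
  matrix and for multiplying it by the symplectic form.
\<close>

lemma root_mat_in_sp:
  "A_mat i j \<in> sp_algebra" "S_mat i j \<in> sp_algebra"
  "A_plus i j \<in> sp_algebra" "S_plus i j \<in> sp_algebra"
  by (auto simp: sp_algebra_def root_mat_defs elem_mat_conj_transpose elem_mat_transpose symp_elem_mat
      mat_i_mult conj_transpose_simps transpose_simps mm.add_left mm.add_right mm.diff_left mm.diff_right
      mm.scaleR_left mm.scaleR_right mm.minus_left mm.minus_right algebra_simps)

lemma m_const_pos: "0 < m_const k"
  by (simp add: m_const_def)

text \<open>
  Up to a factor the generators read off the real and imaginary parts of single entries.  This is the
  reason why they span: a matrix of the algebra orthogonal to them has vanishing entries.
\<close>

lemma inner_root_mat:
  fixes X :: "'n::finite cmat"
  assumes X: "X \<in> sp_algebra"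
  shows "X \<bullet> A_mat i i = 2 * m_const CARD('n) * Re (X $ Inl i $ Inr i)"
    and "X \<bullet> S_mat i i = 2 * m_const CARD('n) * Im (X $ Inl i $ Inr i)"
    and "i \<noteq> j \<Longrightarrow> X \<bullet> A_mat i j = 2 * sqrt 2 * m_const CARD('n) * Re (X $ Inl i $ Inl j)"
    and "i \<noteq> j \<Longrightarrow> X \<bullet> S_mat i j = 2 * sqrt 2 * m_const CARD('n) * Im (X $ Inl i $ Inl j)"
    and "X \<bullet> A_plus i j = 2 * sqrt 2 * m_const CARD('n) * Re (X $ Inl i $ Inr j)"
    and "X \<bullet> S_plus i j = 2 * sqrt 2 * m_const CARD('n) * Im (X $ Inl i $ Inr j)"
proof -
  have 1: "X $ Inr i $ Inr j = cnj (X $ Inl i $ Inl j)"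
    "X $ Inr i $ Inl j = - cnj (X $ Inl i $ Inr j)" for i j
    by (rule sp_algebraD[OF X])+
  have 2: "X $ Inl j $ Inl i = - cnj (X $ Inl i $ Inl j)" by (rule sp_algebraD[OF X])
  have 3: "X $ Inl j $ Inr i = X $ Inl i $ Inr j"
    using sp_algebraD(1)[OF X, of "Inl j" "Inr i"] 1(2)[of i j] by simp
  show "X \<bullet> A_mat i i = 2 * m_const CARD('n) * Re (X $ Inl i $ Inr i)"
    "X \<bullet> S_mat i i = 2 * m_const CARD('n) * Im (X $ Inl i $ Inr i)"
    "X \<bullet> A_plus i j = 2 * sqrt 2 * m_const CARD('n) * Re (X $ Inl i $ Inr j)"
    "X \<bullet> S_plus i j = 2 * sqrt 2 * m_const CARD('n) * Im (X $ Inl i $ Inr j)"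
    "i \<noteq> j \<Longrightarrow> X \<bullet> A_mat i j = 2 * sqrt 2 * m_const CARD('n) * Re (X $ Inl i $ Inl j)"
    "i \<noteq> j \<Longrightarrow> X \<bullet> S_mat i j = 2 * sqrt 2 * m_const CARD('n) * Im (X $ Inl i $ Inl j)"
    by (simp_all add: root_mat_defs mm.scaleR_right mm.add_right mm.diff_right inner_add_right
        inner_diff_right inner_elem_mat inner_i_elem_mat 1 2 3 algebra_simps)
qed

text \<open>
  Identifies a span without writing any element as a linear combination.
\<close>

lemma span_eq_if_orthogonal_zero:
  fixes S V :: "'a::euclidean_space set"
  assumes V: "subspace V" and S: "S \<subseteq> V"
    and zero: "\<And>x. x \<in> V \<Longrightarrow> (\<And>s. s \<in> S \<Longrightarrow> x \<bullet> s = 0) \<Longrightarrow> x = 0"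
  shows "span S = V"
proof
  show sub: "span S \<subseteq> V" using V S by (simp add: span_minimal)
  show "V \<subseteq> span S"
  proof
    fix x assume x: "x \<in> V"
    obtain y z where yz: "y \<in> span S" "\<And>w. w \<in> span S \<Longrightarrow> orthogonal z w" "x = y + z"
      using orthogonal_subspace_decomp_exists[of S x] by blast
    have "z = x - y" using yz by simp
    then have "z \<in> V" using subspace_diff[OF V x] yz(1) sub by blast
    moreover have "z \<bullet> s = 0" if "s \<in> S" for s
      using yz(2)[OF span_base[OF that]] by (simp add: orthogonal_def)
    ultimately have "z = 0" using zero by blast
    then show "x \<in> span S" using yz by simp
  qed
qed

lemma sp_algebra_eq_tangent_mat:
  assumes "X \<in> sp_algebra" "X $ Inl None $ Inl None = 0"
    "\<And>k l. X $ Inl (Some k) $ Inl (Some l) = 0" "\<And>k l. X $ Inl (Some k) $ Inr (Some l) = 0"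
  shows "X = tangent_mat (row_coords X)"
  by (rule sp_algebra_eqI) 
     (use assms in \<open>auto simp: tangent_mat_in_sp tangent_mat_nth row_coords_def\<close>)

lemma greaterThan_None: "{None<..} = range (Some :: 'n::linorder \<Rightarrow> 'n option)"
proof (intro set_eqI)
  show "i \<in> {None<..} \<longleftrightarrow> i \<in> range Some" for i :: "'n option"
    by (cases i) auto
qed

lemma subspace_row_kernel:
  assumes "linear L" shows "subspace {X \<in> sp_algebra. L (row_coords X) = 0}"
  using subspace_sp_algebra
  by (auto simp: subspace_def linear_add[OF assms] linear_cmul[OF assms] linear_0[OF assms]
      linear_add[OF linear_row_coords] linear_cmul[OF linear_row_coords] linear_0[OF linear_row_coords])

text \<open>
  The real direct sum decomposition of the algebra is thus read off the first row: it vanishes, outside the diagonal,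
  exactly on the isotropy algebra.
\<close>

lemma isotropy_algebra_eq:
  "isotropy_algebra = {X :: 'n::{finite,linorder} cmat. X \<in> sp_algebra \<and> row_coords X = 0}" (is "_ = ?V")
  unfolding isotropy_algebra_def
proof (rule span_eq_if_orthogonal_zero)
  show "subspace ?V" using subspace_row_kernel[OF linear_id] by simp
  have D: "D \<in> ?V" if "D \<in> sp_algebra" "diagonal D" for D :: "'n cmat"
    using that by (simp add: row_coords_def diagonal_def vec_eq_iff zero_prod_def)
  have R: "A_mat i j \<in> ?V" "S_mat i j \<in> ?V" "A_plus i j \<in> ?V" "S_plus i j \<in> ?V"
    if "None < i" "i \<le> j" for i j :: "'n option"
  proof -
    have "i \<in> {None<..}" "j \<in> {None<..}" using that by auto
    then obtain k l where "i = Some k" "j = Some l"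
      unfolding greaterThan_None by blast
    then have "row_coords (A_mat i j) = 0" "row_coords (S_mat i j) = 0"
      "row_coords (A_plus i j) = 0" "row_coords (S_plus i j) = 0"
      by (auto simp: row_coords_def root_mat_defs mat_scalar_mult_nth elem_mat_nth vec_eq_iff zero_prod_def)
    then show "A_mat i j \<in> ?V" "S_mat i j \<in> ?V" "A_plus i j \<in> ?V" "S_plus i j \<in> ?V"
      using root_mat_in_sp by blast+
  qed
  show "{D \<in> sp_algebra. diagonal D}
     \<union> (\<Union>i\<in>{None<..}. \<Union>j\<in>{i..}. {A_mat i j, S_mat i j})
     \<union> (\<Union>i\<in>{None<..}. \<Union>j\<in>{i<..}. {A_plus i j, S_plus i j}) \<subseteq> ?V" (is "?S \<subseteq> _")
  proof
    fix X assume "X \<in> ?S"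
    then consider "X \<in> sp_algebra" "diagonal X"
      | i j where "None < i" "i \<le> j" "X \<in> {A_mat i j, S_mat i j, A_plus i j, S_plus i j}"
      by (auto intro: less_imp_le)
    then show "X \<in> ?V" using D R by cases blast+
  qed
  fix X :: "'n cmat"
  assume "X \<in> ?V"
  then have X: "X \<in> sp_algebra" and row: "row_coords X = 0" by auto
  assume orth: "\<And>s. s \<in> {D \<in> sp_algebra. diagonal D}
     \<union> (\<Union>i\<in>{None<..}. \<Union>j\<in>{i..}. {A_mat i j, S_mat i j})
     \<union> (\<Union>i\<in>{None<..}. \<Union>j\<in>{i<..}. {A_plus i j, S_plus i j}) \<Longrightarrow> X \<bullet> s = 0"
  have mp: "m_const CARD('n) \<noteq> 0" using m_const_pos by (metis less_irrefl)
  define D where "D = (\<chi> i j. if i = j then X $ i $ j else 0)"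
  have Dsp: "D \<in> sp_algebra"
  proof (rule sp_algebraI)
    show "D $ p $ q = - cnj (D $ q $ p)" for p q
      using sp_algebraD(1)[OF X, of p p] by (auto simp: D_def)
    show "D $ Inr i $ Inr j = cnj (D $ Inl i $ Inl j)" for i j
      using sp_algebraD(2)[OF X, of i j] by (auto simp: D_def)
  qed (simp add: D_def)
  have "X \<bullet> D = 0" using orth Dsp by (simp add: diagonal_def D_def)
  then have "(\<Sum>i\<in>UNIV. (norm (X $ i $ i))\<^sup>2) = 0"
    by (simp add: inner_vec_def D_def if_distrib power2_norm_eq_inner cong: if_cong)
  then have diag: "X $ i $ i = 0" for i
    by (simp add: sum_nonneg_eq_0_iff)
  have AS: "X \<bullet> A_mat (Some k) (Some l) = 0" "X \<bullet> S_mat (Some k) (Some l) = 0" if "k \<le> l" for k l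
    using that by (intro orth; force)+
  have AS': "X \<bullet> A_plus (Some k) (Some l) = 0" "X \<bullet> S_plus (Some k) (Some l) = 0" if "k < l" for k l
    using that by (intro orth; force)+
  have a: "X $ Inl (Some k) $ Inl (Some l) = 0" if "k < l" for k l
    using AS[of k l] that mp inner_root_mat(3,4)[OF X, of "Some k" "Some l"]
    by (simp add: complex_eq_iff)
  have b1: "X $ Inl (Some k) $ Inr (Some l) = 0" if "k < l" for k l
    using AS'[of k l] that mp inner_root_mat(5,6)[OF X, of "Some k" "Some l"]
    by (simp add: complex_eq_iff)
  have b2: "X $ Inl (Some k) $ Inr (Some k) = 0" for k
    using AS[of k k] mp inner_root_mat(1,2)[OF X, of "Some k"]
    by (simp add: complex_eq_iff)
  have 3: "X $ Inl j $ Inr i = X $ Inl i $ Inr j" for i j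
    using sp_algebraD(1)[OF X, of "Inl j" "Inr i"] sp_algebraD(3)[OF X, of i j] by simp
  have "X = tangent_mat (row_coords X)"
  proof (rule sp_algebra_eq_tangent_mat[OF X diag])
    show "X $ Inl (Some k) $ Inl (Some l) = 0" for k l
      using a[of k l] a[of l k] diag sp_algebraD(1)[OF X, of "Inl (Some k)" "Inl (Some l)"]
      by (cases k l rule: linorder_cases) auto
    show "X $ Inl (Some k) $ Inr (Some l) = 0" for k l
      using b1[of k l] b1[of l k] b2 3[of "Some k" "Some l"]
      by (cases k l rule: linorder_cases) auto
  qed
  then show "X = 0" using row linear_0[OF linear_tangent_mat] by simp
qed

lemma component_M1_eq: "(component_space M1 :: 'n::{finite,linorder} cmat set) = range (\<lambda>v. tangent_mat (0, v))"
  unfolding component_space.simps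
proof (rule span_eq_if_orthogonal_zero)
  have "linear (\<lambda>v. tangent_mat (0, v :: 'n horizontal))"
    by (rule linearI) (simp_all flip: linear_add[OF linear_tangent_mat] linear_cmul[OF linear_tangent_mat])
  then show "subspace (range (\<lambda>v. tangent_mat (0, v :: 'n horizontal)))"
    using linear_subspace_image subspace_UNIV by blast
  have in_range: "X \<in> range (\<lambda>v. tangent_mat (0, v))"
    if "X = tangent_mat (row_coords X)" "fst (row_coords X) = 0" for X :: "'n cmat"
    using that by (metis prod.collapse rangeI)
  have "A_mat None (Some k) \<in> range (\<lambda>v. tangent_mat (0, v))"
    "S_mat None (Some k) \<in> range (\<lambda>v. tangent_mat (0, v))"
    "A_plus None (Some k) \<in> range (\<lambda>v. tangent_mat (0, v))"
    "S_plus None (Some k) \<in> range (\<lambda>v. tangent_mat (0, v))" for k :: 'n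
    by (intro in_range sp_algebra_eq_tangent_mat root_mat_in_sp;
        auto simp: root_mat_defs mat_scalar_mult_nth elem_mat_nth row_coords_def)+
  then show "(\<Union>j\<in>{None<..}. {A_mat None j, S_mat None j, A_plus None j, S_plus None j})
      \<subseteq> range (\<lambda>v. tangent_mat (0, v :: 'n horizontal))"
    unfolding greaterThan_None by auto
  fix X :: "'n cmat"
  assume "X \<in> range (\<lambda>v. tangent_mat (0, v))"
  then obtain p q where X: "X = tangent_mat (0, p, q)" by auto
  assume orth: "\<And>s. s \<in> (\<Union>j\<in>{None<..}. {A_mat None j, S_mat None j, A_plus None j, S_plus None j})
    \<Longrightarrow> X \<bullet> s = 0"
  have Xsp: "X \<in> sp_algebra" unfolding X by (rule tangent_mat_in_sp)
  have mp: "m_const CARD('n) \<noteq> 0" using m_const_pos by (metis less_irrefl)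
  have "X \<bullet> A_mat None (Some k) = 0" "X \<bullet> S_mat None (Some k) = 0"
    "X \<bullet> A_plus None (Some k) = 0" "X \<bullet> S_plus None (Some k) = 0" for k
    using orth unfolding greaterThan_None by blast+
  then have "p $ k = 0" "q $ k = 0" for k
    using mp inner_root_mat(3-6)[OF Xsp, of None "Some k"]
    by (simp_all add: complex_eq_iff X tangent_mat_nth)
  then have "p = 0" "q = 0" by (simp_all add: vec_eq_iff)
  then show "X = 0" unfolding X using linear_0[OF linear_tangent_mat] by (simp add: zero_prod_def)
qed

lemma tangent_mat_M2: "(tangent_mat (a, 0) :: 'n::{finite,linorder} cmat) = (Re a / m_const CARD('n)) *\<^sub>R A_mat None None
    + (Im a / m_const CARD('n)) *\<^sub>R S_mat None None" (is "_ = ?R") for a :: complex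
proof -
  have mp: "m_const CARD('n) \<noteq> 0" using m_const_pos by (metis less_irrefl)
  have R: "?R \<in> sp_algebra"
    by (intro subspace_add[OF subspace_sp_algebra] subspace_scale[OF subspace_sp_algebra] root_mat_in_sp)
  have "?R = tangent_mat (row_coords ?R)"
    by (rule sp_algebra_eq_tangent_mat[OF R])
       (auto simp: root_mat_defs mat_scalar_mult_nth elem_mat_nth)
  moreover have "row_coords ?R = (a, 0)"
    using mp by (auto simp: row_coords_def root_mat_defs mat_scalar_mult_nth elem_mat_nth vec_eq_iff
        complex_eq_iff zero_prod_def)
  ultimately show ?thesis by simp
qed

lemma component_M2_eq: "(component_space M2 :: 'n::{finite,linorder} cmat set) = range (\<lambda>a. tangent_mat (a, 0))"
proof -
  have "linear (\<lambda>a. tangent_mat (a, 0 :: 'n horizontal))"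
    by (rule linearI) (simp_all flip: linear_add[OF linear_tangent_mat] linear_cmul[OF linear_tangent_mat])
  then have sub: "subspace (range (\<lambda>a. tangent_mat (a, 0 :: 'n horizontal)))"
    using linear_subspace_image subspace_UNIV by blast
  have mp: "m_const CARD('n) \<noteq> 0" using m_const_pos by (metis less_irrefl)
  have "tangent_mat (of_real (m_const CARD('n)), 0) = (A_mat None None :: 'n cmat)"
    "tangent_mat (\<i> * of_real (m_const CARD('n)), 0) = (S_mat None None :: 'n cmat)"
    using mp by (simp_all add: tangent_mat_M2)
  then have "{A_mat None None, S_mat None None :: 'n cmat} \<subseteq> range (\<lambda>a. tangent_mat (a, 0))"
    by (metis empty_subsetI insert_subset rangeI)
  then have "component_space M2 \<subseteq> range (\<lambda>a. tangent_mat (a, 0 :: 'n horizontal))"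
    using span_minimal[OF _ sub] by (simp only: component_space.simps)
  moreover have "tangent_mat (a, 0) \<in> (component_space M2 :: 'n cmat set)" for a
    unfolding tangent_mat_M2 by (simp add: span_add span_scale span_base)
  ultimately show ?thesis by blast
qed

lemma tangent_mat_split: "tangent_mat (a, v) = tangent_mat (0, v) + tangent_mat (a, 0)"
  by (simp flip: linear_add[OF linear_tangent_mat])

lemma tangent_o_eq: "(tangent_o :: 'n::{finite,linorder} cmat set) = range tangent_mat"
proof
  have "subspace (range (tangent_mat :: 'n coords \<Rightarrow> _))"
    using linear_subspace_image linear_tangent_mat subspace_UNIV by blast
  then show "tangent_o \<subseteq> range (tangent_mat :: 'n coords \<Rightarrow> _)"
    unfolding tangent_o_def component_M1_eq component_M2_eq by (intro span_minimal) auto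
  have "tangent_mat (a, v) \<in> tangent_o" for a :: complex and v :: "'n horizontal"
    unfolding tangent_mat_split[of a v] tangent_o_def component_M1_eq component_M2_eq
    by (intro span_add span_base) auto
  then show "range (tangent_mat :: 'n coords \<Rightarrow> _) \<subseteq> tangent_o" by auto
qed

lemma sp_minus_tangent_part:
  "X \<in> sp_algebra \<Longrightarrow> X - tangent_mat (row_coords X) \<in> isotropy_algebra"
  unfolding isotropy_algebra_eq
  by (simp add: subspace_diff[OF subspace_sp_algebra] tangent_mat_in_sp linear_diff[OF linear_row_coords])

lemma proj_o_eq:
  assumes "X \<in> sp_algebra" shows "proj_o X = tangent_mat (row_coords X)"
  unfolding proj_o_def
proof (rule the_equality)
  show "tangent_mat (row_coords X) \<in> tangent_o \<and> X - tangent_mat (row_coords X) \<in> isotropy_algebra"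
    using sp_minus_tangent_part[OF assms] by (simp add: tangent_o_eq)
  fix Y assume "Y \<in> tangent_o \<and> X - Y \<in> isotropy_algebra"
  then show "Y = tangent_mat (row_coords X)"
    by (auto simp: tangent_o_eq isotropy_algebra_eq linear_diff[OF linear_row_coords])
qed

lemma proj_component_M1:
  fixes X :: "'n::{finite,linorder} cmat"
  assumes X: "X \<in> sp_algebra" shows "proj_component M1 X = tangent_mat (0, snd (row_coords X))"
  unfolding proj_component_def
proof (rule the_equality)
  have c: "- {M1} = {M2}" using component.exhaust by blast
  have decomp: "X - tangent_mat (0, snd (row_coords X))
      = (X - tangent_mat (row_coords X)) + tangent_mat (fst (row_coords X), 0)"
    using tangent_mat_split[of "fst (row_coords X)" "snd (row_coords X)"] by simp
  have "X - tangent_mat (0, snd (row_coords X)) \<in> span (isotropy_algebra \<union> component_space M2)"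
    unfolding decomp
    by (intro span_add span_base) (auto simp: sp_minus_tangent_part[OF X] component_M2_eq simp del: component_space.simps)
  then show "tangent_mat (0, snd (row_coords X)) \<in> component_space M1 \<and>
      X - tangent_mat (0, snd (row_coords X)) \<in> span (isotropy_algebra \<union> (\<Union>j\<in>- {M1}. component_space j))"
    unfolding c component_M1_eq by simp
  fix Y assume Y: "Y \<in> component_space M1 \<and> X - Y \<in> span (isotropy_algebra \<union> (\<Union>j\<in>- {M1}. component_space j))"
  have "span (isotropy_algebra \<union> component_space M2) \<subseteq> {X :: 'n cmat. X \<in> sp_algebra \<and> snd (row_coords X) = 0}"
    by (intro span_minimal subspace_row_kernel linear_snd)
       (auto simp: isotropy_algebra_eq component_M2_eq tangent_mat_in_sp simp del: component_space.simps)
  then show "Y = tangent_mat (0, snd (row_coords X))"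
    using Y unfolding c component_M1_eq by (auto simp: linear_diff[OF linear_row_coords])
qed

lemma proj_component_M2:
  fixes X :: "'n::{finite,linorder} cmat"
  assumes X: "X \<in> sp_algebra" shows "proj_component M2 X = tangent_mat (fst (row_coords X), 0)"
  unfolding proj_component_def
proof (rule the_equality)
  have c: "- {M2} = {M1}" using component.exhaust by blast
  have decomp: "X - tangent_mat (fst (row_coords X), 0)
      = (X - tangent_mat (row_coords X)) + tangent_mat (0, snd (row_coords X))"
    using tangent_mat_split[of "fst (row_coords X)" "snd (row_coords X)"] by simp
  have "X - tangent_mat (fst (row_coords X), 0) \<in> span (isotropy_algebra \<union> component_space M1)"
    unfolding decomp
    by (intro span_add span_base) (auto simp: sp_minus_tangent_part[OF X] component_M1_eq simp del: component_space.simps)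
  then show "tangent_mat (fst (row_coords X), 0) \<in> component_space M2 \<and>
      X - tangent_mat (fst (row_coords X), 0) \<in> span (isotropy_algebra \<union> (\<Union>j\<in>- {M2}. component_space j))"
    unfolding c component_M2_eq by simp
  fix Y assume Y: "Y \<in> component_space M2 \<and> X - Y \<in> span (isotropy_algebra \<union> (\<Union>j\<in>- {M2}. component_space j))"
  have "span (isotropy_algebra \<union> component_space M1) \<subseteq> {X :: 'n cmat. X \<in> sp_algebra \<and> fst (row_coords X) = 0}"
    by (intro span_minimal subspace_row_kernel linear_fst)
       (auto simp: isotropy_algebra_eq component_M1_eq tangent_mat_in_sp simp del: component_space.simps)
  then show "Y = tangent_mat (fst (row_coords X), 0)"
    using Y unfolding c component_M2_eq by (auto simp: linear_diff[OF linear_row_coords])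
qed

section \<open>The Killing form\<close>

text \<open>
  Replaces the trace over an unspecified basis of the subspace by a trace over the standard basis of the
  ambient space, at the price of a projection \<open>P\<close> onto the subspace.
\<close>

lemma trace_on_eq:
  fixes f P :: "'a::euclidean_space \<Rightarrow> 'a"
  assumes V: "subspace V" and f: "linear f" and P: "linear P"
    and fV: "\<And>v. v \<in> V \<Longrightarrow> f v \<in> V" and PV: "\<And>x. P x \<in> V" and PP: "\<And>v. v \<in> V \<Longrightarrow> P v = v"
  shows "trace_on V f = (\<Sum>e\<in>Basis. e \<bullet> f (P e))"
proof -
  define B where "B = (SOME B. B \<subseteq> V \<and> independent B \<and> span B = V)"
  have "\<exists>B. B \<subseteq> V \<and> independent B \<and> span B = V"
  proof -
    obtain B' where B': "B' \<subseteq> V" "independent B'" "V \<subseteq> span B'" "card B' = dim V"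
      by (rule basis_exists[of V])
    have "span B' = V" by (rule subset_antisym[OF span_minimal[OF B'(1) V] B'(3)])
    then show ?thesis using B'(1,2) by metis
  qed
  then have "B \<subseteq> V \<and> independent B \<and> span B = V" unfolding B_def by (rule someI_ex)
  then have B: "B \<subseteq> V" "independent B" "span B = V" by simp_all
  have fin: "finite B" using B(2) by (rule finiteI_independent)
  define \<phi> where "\<phi> b x = representation B (P x) b" for b x
  have Ps: "P x \<in> span B" for x using PV B(3) by simp
  have lin: "linear (\<phi> b)" for b
    by (rule linearI)
       (simp_all add: \<phi>_def linear_add[OF P] linear_cmul[OF P] representation_add[OF B(2) Ps Ps]
        representation_scale[OF B(2) Ps])
  have rep: "P x = (\<Sum>b\<in>B. \<phi> b x *\<^sub>R b)" for x
    unfolding \<phi>_def using sum_representation_eq[OF B(2) Ps fin order_refl] by simp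
  have "(\<Sum>e\<in>Basis. e \<bullet> f (P e)) = (\<Sum>e\<in>Basis. \<Sum>b\<in>B. \<phi> b e * (e \<bullet> f b))"
  proof (rule sum.cong[OF refl])
    fix e
    have "f (P e) = (\<Sum>b\<in>B. \<phi> b e *\<^sub>R f b)"
      using arg_cong[OF rep[of e], of f] by (simp only: linear_sum[OF f] linear_cmul[OF f])
    then show "e \<bullet> f (P e) = (\<Sum>b\<in>B. \<phi> b e * (e \<bullet> f b))"
      by (simp add: inner_sum_right)
  qed
  also have "\<dots> = (\<Sum>b\<in>B. \<Sum>e\<in>Basis. \<phi> b e * (e \<bullet> f b))" by (rule sum.swap)
  also have "\<dots> = (\<Sum>b\<in>B. \<phi> b (f b))"
  proof (rule sum.cong[OF refl])
    fix b
    have "\<phi> b (f b) = \<phi> b (\<Sum>e\<in>Basis. (f b \<bullet> e) *\<^sub>R e)" by (simp add: euclidean_representation)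
    also have "\<dots> = (\<Sum>e\<in>Basis. (f b \<bullet> e) * \<phi> b e)"
      by (simp only: linear_sum[OF lin] linear_cmul[OF lin]) simp
    finally show "(\<Sum>e\<in>Basis. \<phi> b e * (e \<bullet> f b)) = \<phi> b (f b)"
      by (simp add: mult.commute inner_commute[of _ "f b"])
  qed
  also have "\<dots> = (\<Sum>b\<in>B. representation B (f b) b)"
  proof (rule sum.cong[OF refl])
    fix b assume "b \<in> B"
    then have "b \<in> V" using B(1) by blast
    then have "P (f b) = f b" by (rule PP[OF fV])
    then show "\<phi> b (f b) = representation B (f b) b" by (simp add: \<phi>_def)
  qed
  finally show ?thesis by (simp only: trace_on_def Let_def B_def[symmetric])
qed

lemma sum_Basis_cmat:
  fixes g :: "'n::finite cmat \<Rightarrow> real"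
  shows "(\<Sum>b\<in>Basis. g b) = (\<Sum>i\<in>UNIV. \<Sum>j\<in>UNIV. g (elem_mat i j) + g (mat \<i> ** elem_mat i j))"
proof -
  have B: "(\<Sum>b\<in>Basis. h b) = (\<Sum>i\<in>UNIV. \<Sum>u\<in>Basis. h (axis i u))"
    for h :: "('b::euclidean_space, 'm::finite) vec \<Rightarrow> real"
  proof -
    have 1: "Basis = (\<lambda>(i, u). axis i u :: ('b, 'm) vec) ` (UNIV \<times> Basis)"
      unfolding Basis_vec_def by auto
    have 2: "inj_on (\<lambda>(i, u). axis i u :: ('b, 'm) vec) (UNIV \<times> Basis)"
      by (auto simp: inj_on_def axis_eq_axis)
    show ?thesis unfolding 1 sum.reindex[OF 2]
      by (simp add: sum.cartesian_product case_prod_unfold)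
  qed
  have 1: "elem_mat p q = axis p (axis q 1)" and 2: "mat \<i> ** elem_mat p q = axis p (axis q \<i>)"
    for p q :: "'n index"
    by (auto simp: vec_eq_iff elem_mat_nth mat_scalar_mult_nth axis_def)
  show ?thesis unfolding B unfolding 2 unfolding 1 by (simp add: Basis_complex_def)
qed

text \<open>
  The trace of an endomorphism of the real vector space of all complex matrices.
\<close>

definition real_trace :: "('n::finite cmat \<Rightarrow> 'n cmat) \<Rightarrow> real" where
  "real_trace F = (\<Sum>b\<in>Basis. b \<bullet> F b)"

text \<open>
  For a complex linear map this is its complex trace.
\<close>

definition unit_trace :: "('n::finite cmat \<Rightarrow> 'n cmat) \<Rightarrow> complex" where
  "unit_trace F = (\<Sum>i\<in>UNIV. \<Sum>j\<in>UNIV. F (elem_mat i j) $ i $ j)"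

lemma real_trace_eq:
  "real_trace F = (\<Sum>i\<in>UNIV. \<Sum>j\<in>UNIV. Re (F (elem_mat i j) $ i $ j) + Im (F (mat \<i> ** elem_mat i j) $ i $ j))"
  unfolding real_trace_def sum_Basis_cmat
  by (simp add: inner_commute[of "elem_mat _ _"] inner_commute[of "mat \<i> ** elem_mat _ _"]
      inner_elem_mat inner_i_elem_mat)

text \<open>
  The basis vectors \<open>E\<close> and \<open>\<i> E\<close> contribute opposite amounts.
\<close>

lemma real_trace_antilinear:
  assumes "\<And>Z. F (mat \<i> ** Z) = - (mat \<i> ** F Z)" shows "real_trace F = 0"
  unfolding real_trace_eq by (simp add: assms mat_scalar_mult_nth)

lemma real_trace_complex_linear:
  assumes "\<And>Z. F (mat \<i> ** Z) = mat \<i> ** F Z" shows "real_trace F = 2 * Re (unit_trace F)"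
  unfolding real_trace_eq unit_trace_def by (simp add: assms mat_scalar_mult_nth sum_distrib_left)

lemma mult_elem_mult_nth: "(M ** elem_mat i j ** N) $ k $ l = M $ k $ i * N $ j $ l"
proof -
  have h: "(M ** elem_mat i j) $ k $ r = (if r = j then M $ k $ i else 0)" for r
    unfolding matrix_mult_nth elem_mat_nth
    by (cases "r = j") (simp_all add: if_distrib cong: if_cong)
  show ?thesis
    unfolding matrix_mult_nth[of "M ** elem_mat i j"] h
    by (simp add: if_distrib if_distribR cong: if_cong)
qed

lemma unit_trace_mult: "unit_trace (\<lambda>Z. M ** Z ** N) = trace M * trace N"
  unfolding unit_trace_def mult_elem_mult_nth by (simp add: trace_def sum_product)

lemma unit_trace_mult_transpose:
  "unit_trace (\<lambda>Z. M ** transpose Z ** N) = trace (M ** transpose N)"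
  unfolding unit_trace_def elem_mat_transpose mult_elem_mult_nth
  by (simp add: trace_def matrix_mult_nth transpose_nth)

text \<open>
  The algebra is the common fixed space of the commuting involutions \<open>Z \<mapsto> -Z\<^sup>*\<close> and \<open>Z \<mapsto> J Z\<^sup>T J\<close>, where \<open>J\<close> is the
  symplectic form; averaging over the group they generate projects onto it.
\<close>

definition sp_proj :: "'n::finite cmat \<Rightarrow> 'n cmat" where
  "sp_proj Z = (1/4) *\<^sub>R (Z + symp_form ** transpose Z ** symp_form
     - (conj_transpose Z + conj_transpose (symp_form ** transpose Z ** symp_form)))"

lemma conj_transpose_symp_form: "conj_transpose symp_form = - symp_form"
  unfolding vec_eq_iff split_sum_all by (auto simp: conj_transpose_nth)

lemma conj_transpose_transpose: "conj_transpose (transpose Z) = transpose (conj_transpose Z)"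
  by (simp add: vec_eq_iff conj_transpose_nth transpose_nth)

lemma symp_symp:
  fixes A :: "'n::finite cmat"
  shows "symp_form ** (symp_form ** A) = - A" "A ** symp_form ** symp_form = - A"
proof -
  show "symp_form ** (symp_form ** A) = - A"
    by (simp add: matrix_mul_assoc symp_form_square mm.minus_left)
  show "A ** symp_form ** symp_form = - A"
    by (simp add: matrix_mul_assoc[symmetric] symp_form_square mm.minus_right)
qed

lemmas mult_simps = mm.add_left mm.add_right mm.diff_left mm.diff_right
      mm.scaleR_left mm.scaleR_right mm.minus_left mm.minus_right

lemma linear_sp_proj: "linear (sp_proj :: 'n::finite cmat \<Rightarrow> 'n cmat)"
  by (rule linearI)
     (simp_all add: sp_proj_def conj_transpose_simps transpose_simps mult_simps algebra_simps)

lemma sp_proj_in_sp: "sp_proj Z \<in> sp_algebra"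
proof -
  define W where "W = Z - conj_transpose Z"
  have P: "sp_proj Z = (1/4) *\<^sub>R (W + symp_form ** transpose W ** symp_form)"
    unfolding sp_proj_def W_def
    by (simp add: conj_transpose_mult conj_transpose_symp_form conj_transpose_transpose
        transpose_simps mult_simps matrix_mul_assoc algebra_simps)
  have "conj_transpose (sp_proj Z) + sp_proj Z = 0"
    unfolding sp_proj_def by (simp add: conj_transpose_simps algebra_simps)
  moreover have "transpose (sp_proj Z) ** symp_form + symp_form ** sp_proj Z = 0"
    unfolding P
    by (simp add: transpose_simps matrix_transpose_mul transpose_symp_form mult_simps
        matrix_mul_assoc[symmetric] symp_symp symp_form_square algebra_simps)
  ultimately show ?thesis by (simp add: sp_algebra_def)
qed

lemma sp_transpose_symp:
  assumes "X \<in> sp_algebra" 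
  shows "transpose X ** symp_form = - (symp_form ** X)" "symp_form ** transpose X ** symp_form = X"
    "conj_transpose X = - X"
proof -
  show 1: "transpose X ** symp_form = - (symp_form ** X)" "conj_transpose X = - X"
    using assms by (auto simp: sp_algebra_def eq_neg_iff_add_eq_0)
  show "symp_form ** transpose X ** symp_form = X"
    unfolding matrix_mul_assoc[symmetric] 1 by (simp add: mult_simps symp_symp)
qed

lemma sp_proj_id: "X \<in> sp_algebra \<Longrightarrow> sp_proj X = X"
  unfolding sp_proj_def by (simp add: sp_transpose_symp flip: scaleR_2)

lemma bracket_in_sp:
  assumes "X \<in> sp_algebra" "Y \<in> sp_algebra" shows "bracket X Y \<in> sp_algebra"
proof -
  note X = sp_transpose_symp[OF assms(1)] and Y = sp_transpose_symp[OF assms(2)]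
  have "conj_transpose (bracket X Y) + bracket X Y = 0"
    by (simp add: bracket_def conj_transpose_simps conj_transpose_mult X Y mult_simps)
  moreover have "transpose (X ** Y) ** symp_form = symp_form ** (Y ** X)"
    "transpose (Y ** X) ** symp_form = symp_form ** (X ** Y)"
    unfolding matrix_transpose_mul matrix_mul_assoc[symmetric] X Y
    by (simp_all add: mult_simps) (simp_all add: matrix_mul_assoc X Y mult_simps)
  then have "transpose (bracket X Y) ** symp_form + symp_form ** bracket X Y = 0"
    by (simp add: bracket_def transpose_simps mult_simps)
  ultimately show ?thesis by (simp add: sp_algebra_def)
qed

lemma trace_sp: assumes "X \<in> sp_algebra" shows "trace X = 0"
proof -
  have "X $ Inl i $ Inl i + X $ Inr i $ Inr i = 0" for i
    using sp_algebraD(1)[OF assms, of "Inl i" "Inl i"] sp_algebraD(2)[OF assms, of i i]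
    by (simp add: complex_eq_iff)
  then show ?thesis by (simp add: trace_def sum_index)
qed

lemma trace_simps:
  fixes A B :: "'n::finite cmat"
  shows "trace (A + B) = trace A + trace B" "trace (A - B) = trace A - trace B" 
    "trace (- A) = - trace A" "trace (transpose A) = trace A"
  by (simp_all add: trace_def sum.distrib sum_subtractf sum_negf transpose_nth)

lemma card_index: "CARD('n::finite index) = 2 * CARD('n) + 2"
  by (simp add: card_sum card_option)

lemma mult_mat_i: "A ** (mat \<i> ** Z) = mat \<i> ** (A ** Z)" for A Z :: "'n::finite cmat"
  unfolding vec_eq_iff
proof (intro allI)
  fix p q
  have "(A ** (mat \<i> ** Z)) $ p $ q = (\<Sum>k\<in>UNIV. \<i> * (A $ p $ k * Z $ k $ q))"
    unfolding matrix_mult_nth[of A] mat_scalar_mult_nth by (rule sum.cong) auto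
  then show "(A ** (mat \<i> ** Z)) $ p $ q = (mat \<i> ** (A ** Z)) $ p $ q"
    by (simp only: mat_scalar_mult_nth matrix_mult_nth[of A] sum_distrib_left)
qed

lemma mat_i_mult_assoc: "(mat \<i> ** A) ** B = mat \<i> ** (A ** B)" for A B :: "'n::finite cmat"
  by (simp add: matrix_mul_assoc)

text \<open>
  Let \<open>f Z = [X,[Y,Z]]\<close>.  In the trace of \<open>f \<circ> sp_proj\<close> the two antilinear summands of the projection drop out.  The identity
  summand gives \<open>(4n+4) tr(XY)\<close> because \<open>X\<close> and \<open>Y\<close> are traceless, the summand \<open>J Z\<^sup>T J\<close> gives \<open>4 tr(XY)\<close>, and passing
  from complex to real traces doubles both.  Finally \<open>Re (tr(XY)) = -(X \<bullet> Y)\<close> by skewness.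
\<close>

lemma killing_form_eq:
  fixes X Y :: "'n::finite cmat"
  assumes X: "X \<in> sp_algebra" and Y: "Y \<in> sp_algebra"
  shows "killing_form X Y = - (2 * real CARD('n) + 4) * (X \<bullet> Y)"
proof -
  let ?J = "symp_form :: 'n cmat"
  define f where "f Z = bracket X (bracket Y Z)" for Z
  have f: "f Z = (X ** Y) ** Z ** mat 1 - X ** Z ** Y - Y ** Z ** X + mat 1 ** Z ** (Y ** X)" for Z
    by (simp add: f_def bracket_def mult_simps matrix_mul_assoc)
  define \<beta> where "\<beta> Z = ?J ** transpose Z ** ?J" for Z
  have lin: "linear f" unfolding f by (rule linearI) (simp_all add: mult_simps algebra_simps)
  have fi: "f (mat \<i> ** Z) = mat \<i> ** f Z" for Z
    unfolding f by (simp add: mult_mat_i mat_i_mult_assoc mult_simps)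
  have \<beta>i: "\<beta> (mat \<i> ** Z) = mat \<i> ** \<beta> Z" for Z
    unfolding \<beta>_def by (simp add: mat_i_mult mult_mat_i mat_i_mult_assoc)
  have "killing_form X Y = real_trace (\<lambda>Z. f (sp_proj Z))"
    unfolding killing_form_def real_trace_def f_def[symmetric]
    by (rule trace_on_eq[OF subspace_sp_algebra lin linear_sp_proj])
       (auto simp: f_def bracket_in_sp X Y sp_proj_in_sp sp_proj_id)
  also have "\<dots> = (real_trace f + real_trace (\<lambda>Z. f (\<beta> Z))
      - (real_trace (\<lambda>Z. f (conj_transpose Z)) + real_trace (\<lambda>Z. f (conj_transpose (\<beta> Z))))) / 4"
    unfolding real_trace_def sp_proj_def \<beta>_def[symmetric] linear_cmul[OF lin] linear_add[OF lin]
      linear_diff[OF lin] inner_scaleR_right inner_add_right inner_diff_right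
      sum_distrib_left[symmetric] sum.distrib sum_subtractf by simp
  also have "real_trace (\<lambda>Z. f (conj_transpose Z)) = 0"
    by (rule real_trace_antilinear) (simp add: mat_i_mult linear_neg[OF lin] fi)
  also have "real_trace (\<lambda>Z. f (conj_transpose (\<beta> Z))) = 0"
    by (rule real_trace_antilinear) (simp add: mat_i_mult linear_neg[OF lin] fi \<beta>i)
  also have "real_trace f = 2 * Re (unit_trace f)"
    by (rule real_trace_complex_linear) (rule fi)
  also have "real_trace (\<lambda>Z. f (\<beta> Z)) = 2 * Re (unit_trace (\<lambda>Z. f (\<beta> Z)))"
    by (rule real_trace_complex_linear) (simp add: fi \<beta>i)
  also have "unit_trace f = of_nat (4 * CARD('n) + 4) * trace (X ** Y)"
  proof -
    have "unit_trace f = trace (X ** Y) * trace (mat 1 :: 'n cmat) - trace X * trace Y - trace Y * trace X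
        + trace (mat 1 :: 'n cmat) * trace (Y ** X)"
      unfolding f unit_trace_mult[symmetric]
      by (simp only: unit_trace_def vector_add_component vector_minus_component sum.distrib sum_subtractf)
    then show ?thesis
      by (simp add: trace_sp[OF X] trace_mult_commute[of Y X] trace_I card_index algebra_simps)
  qed
  also have "unit_trace (\<lambda>Z. f (\<beta> Z)) = 4 * trace (X ** Y)"
  proof -
    have JT: "transpose ?J = - ?J" by (rule transpose_symp_form)
    have b: "f (\<beta> Z) = (X ** Y ** ?J) ** transpose Z ** ?J - (X ** ?J) ** transpose Z ** (?J ** Y)
        - (Y ** ?J) ** transpose Z ** (?J ** X) + ?J ** transpose Z ** (?J ** Y ** X)" for Z
      unfolding f \<beta>_def by (simp add: matrix_mul_assoc)
    have "unit_trace (\<lambda>Z. f (\<beta> Z)) = trace ((X ** Y ** ?J) ** transpose ?J)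
        - trace ((X ** ?J) ** transpose (?J ** Y)) - trace ((Y ** ?J) ** transpose (?J ** X))
        + trace (?J ** transpose (?J ** Y ** X))"
      unfolding b unit_trace_mult_transpose[symmetric]
      by (simp only: unit_trace_def vector_add_component vector_minus_component sum.distrib sum_subtractf)
    moreover have "(X ** Y ** ?J) ** transpose ?J = X ** Y"
      by (simp add: JT mult_simps symp_symp)
    moreover have "(X ** ?J) ** transpose (?J ** Y) = - (X ** Y)"
      using sp_transpose_symp(2)[OF Y]
      by (simp add: JT matrix_transpose_mul mult_simps matrix_mul_assoc[symmetric])
    moreover have "(Y ** ?J) ** transpose (?J ** X) = - (Y ** X)"
      using sp_transpose_symp(2)[OF X]
      by (simp add: JT matrix_transpose_mul mult_simps matrix_mul_assoc[symmetric])
    moreover have "?J ** transpose (?J ** Y ** X) = X ** Y"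
    proof -
      have "?J ** transpose (?J ** Y ** X) = - (?J ** transpose X ** (transpose Y ** ?J))"
        by (simp add: JT matrix_transpose_mul mult_simps matrix_mul_assoc)
      also have "\<dots> = X ** Y"
        using sp_transpose_symp(2)[OF X]
        by (simp add: sp_transpose_symp(1)[OF Y] mult_simps matrix_mul_assoc)
      finally show ?thesis .
    qed
    ultimately show ?thesis by (simp add: trace_simps trace_mult_commute[of Y X])
  qed
  finally have "killing_form X Y = (2 * real CARD('n) + 4) * Re (trace (X ** Y))"
    by (simp add: field_simps)
  moreover have "X \<bullet> Y = - Re (trace (X ** Y))"
    by (simp add: inner_cmat sp_transpose_symp(3)[OF X] mult_simps trace_simps)
  ultimately show ?thesis by (simp add: algebra_simps)
qed

section \<open>The group \<open>Sp(n+1)\<close> and its invariant metrics\<close>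

lemma inner_tangent_mat:
  "tangent_mat (a, p, q) \<bullet> tangent_mat (a', p', q') = 2 * (a \<bullet> a') + 4 * (p \<bullet> p' + q \<bullet> q')"
proof -
  have c: "cnj x \<bullet> cnj y = x \<bullet> y" for x y :: complex by (simp add: inner_complex_def)
  show ?thesis
    by (simp add: inner_vec_def sum_index sum_option tangent_mat_nth sum.distrib c algebra_simps)
qed

lemma metric_o_eq:
  fixes X Y :: "'n::{finite,linorder} cmat"
  assumes "X \<in> sp_algebra" "Y \<in> sp_algebra"
  shows "metric_o lam X Y = (2 * real CARD('n) + 4) *
    (lam M1 * (tangent_mat (0, snd (row_coords X)) \<bullet> tangent_mat (0, snd (row_coords Y)))
     + lam M2 * ((tangent_mat (fst (row_coords X), 0) :: 'n cmat) \<bullet> tangent_mat (fst (row_coords Y), 0)))"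
  unfolding metric_o_def
  by (simp add: proj_component_M1 proj_component_M2 assms killing_form_eq tangent_mat_in_sp algebra_simps)

lemma SpD:
  assumes "g \<in> Sp"
  shows "conj_transpose g ** g = mat 1" "g ** conj_transpose g = mat 1"
    "transpose g ** symp_form ** g = symp_form" "matrix_inv g = conj_transpose g"
    "transpose g ** symp_form = symp_form ** conj_transpose g"
proof -
  show 1: "conj_transpose g ** g = mat 1" and 3: "transpose g ** symp_form ** g = symp_form"
    using assms by (auto simp: Sp_def)
  show 2: "g ** conj_transpose g = mat 1"
    using 1 matrix_left_right_inverse by blast
  have "g ** matrix_inv g = mat 1 \<and> matrix_inv g ** g = mat 1"
    unfolding matrix_inv_def by (rule someI[of _ "conj_transpose g"]) (use 1 2 in blast)
  then have "conj_transpose g = conj_transpose g ** (g ** matrix_inv g)" by simp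
  also have "\<dots> = matrix_inv g" by (simp add: matrix_mul_assoc 1)
  finally show "matrix_inv g = conj_transpose g" ..
  show "transpose g ** symp_form = symp_form ** conj_transpose g"
  proof -
    have "transpose g ** symp_form = transpose g ** symp_form ** (g ** conj_transpose g)" by (simp add: 2)
    also have "\<dots> = symp_form ** conj_transpose g" by (simp only: matrix_mul_assoc 3)
    finally show ?thesis .
  qed
qed

lemma SpI:
  assumes "conj_transpose g ** g = mat 1" "transpose g ** symp_form = symp_form ** conj_transpose g"
  shows "g \<in> Sp"
proof -
  have "transpose g ** symp_form ** g = symp_form ** (conj_transpose g ** g)"
    by (simp only: assms(2) matrix_mul_assoc)
  then show ?thesis using assms(1) by (simp add: Sp_def)
qed

lemma Sp_one: "mat 1 \<in> Sp"
  by (simp add: Sp_def)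

lemma Sp_mult:
  assumes "g \<in> Sp" "h \<in> Sp" shows "g ** h \<in> Sp"
proof (rule SpI)
  have "conj_transpose (g ** h) ** (g ** h) = conj_transpose h ** (conj_transpose g ** g) ** h"
    by (simp only: conj_transpose_mult matrix_mul_assoc)
  then show "conj_transpose (g ** h) ** (g ** h) = mat 1"
    by (simp add: SpD(1)[OF assms(1)] SpD(1)[OF assms(2)])
  have "transpose (g ** h) ** symp_form = transpose h ** (transpose g ** symp_form)"
    by (simp only: matrix_transpose_mul matrix_mul_assoc)
  also have "\<dots> = (transpose h ** symp_form) ** conj_transpose g"
    by (simp only: SpD(5)[OF assms(1)] matrix_mul_assoc)
  also have "\<dots> = symp_form ** conj_transpose (g ** h)"
    by (simp only: SpD(5)[OF assms(2)] conj_transpose_mult matrix_mul_assoc)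
  finally show "transpose (g ** h) ** symp_form = symp_form ** conj_transpose (g ** h)" .
qed

lemma Sp_conj_transpose:
  assumes "g \<in> Sp" shows "conj_transpose g \<in> Sp"
proof (rule SpI)
  show "conj_transpose (conj_transpose g) ** conj_transpose g = mat 1"
    using SpD(2)[OF assms] by simp
  have "conj_transpose (transpose g ** symp_form) = conj_transpose (symp_form ** conj_transpose g)"
    using SpD(5)[OF assms] by simp
  then have "symp_form ** (symp_form ** transpose (conj_transpose g)) ** symp_form
      = symp_form ** (g ** symp_form) ** symp_form"
    by (simp add: conj_transpose_mult conj_transpose_symp_form mult_simps conj_transpose_transpose)
  then show "transpose (conj_transpose g) ** symp_form = symp_form ** conj_transpose (conj_transpose g)"
    by (simp add: symp_symp mult_simps) (simp add: matrix_mul_assoc symp_symp)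
qed

lemma Ad_Sp: "g \<in> Sp \<Longrightarrow> Ad g X = g ** X ** conj_transpose g"
  by (simp add: Ad_def SpD)

lemma Ad_in_sp:
  assumes g: "g \<in> Sp" and X: "X \<in> sp_algebra" shows "Ad g X \<in> sp_algebra"
proof -
  note sx = sp_transpose_symp[OF X]
  let ?h = "conj_transpose g"
  have gg: "transpose ?h ** symp_form = symp_form ** g"
    using SpD(5)[OF Sp_conj_transpose[OF g]] by simp
  have "conj_transpose (Ad g X) = - Ad g X"
    by (simp add: Ad_Sp[OF g] conj_transpose_mult sx mult_simps matrix_mul_assoc)
  moreover have "transpose (Ad g X) ** symp_form = - (symp_form ** Ad g X)"
  proof -
    have "transpose (Ad g X) ** symp_form = transpose ?h ** (transpose X ** (transpose g ** symp_form))"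
      by (simp add: Ad_Sp[OF g] matrix_transpose_mul matrix_mul_assoc)
    also have "\<dots> = transpose ?h ** ((transpose X ** symp_form) ** ?h)"
      by (simp add: SpD(5)[OF g] matrix_mul_assoc)
    also have "\<dots> = - ((transpose ?h ** symp_form) ** X ** ?h)"
      by (simp add: sx mult_simps matrix_mul_assoc)
    finally show ?thesis by (simp add: gg Ad_Sp[OF g] matrix_mul_assoc)
  qed
  ultimately show ?thesis by (simp add: sp_algebra_def)
qed

lemma linear_Ad: "linear (Ad g)"
  unfolding Ad_def by (rule linearI) (simp_all add: mult_simps)

lemma Ad_mult: "g \<in> Sp \<Longrightarrow> h \<in> Sp \<Longrightarrow> Ad (g ** h) X = Ad g (Ad h X)"
  by (simp add: Ad_Sp Sp_mult conj_transpose_mult matrix_mul_assoc)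

lemma Ad_inverse:
  assumes "g \<in> Sp" shows "Ad (conj_transpose g) (Ad g X) = X" "Ad g (Ad (conj_transpose g) X) = X"
proof -
  have "Ad (mat 1) X = X" using Ad_Sp[OF Sp_one] by simp
  then show "Ad (conj_transpose g) (Ad g X) = X" "Ad g (Ad (conj_transpose g) X) = X"
    by (simp_all add: assms Sp_conj_transpose SpD(1,2)[OF assms] flip: Ad_mult)
qed

lemma inner_mult_left: "(A ** B) \<bullet> C = B \<bullet> (conj_transpose A ** C)" for A B C :: "'n::finite cmat"
  by (simp add: inner_cmat conj_transpose_mult matrix_mul_assoc)

lemma inner_mult_right: "(A ** B) \<bullet> C = A \<bullet> (C ** conj_transpose B)" for A B C :: "'n::finite cmat"
  using trace_mult_commute[of "conj_transpose B" "conj_transpose A ** C"]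
  by (simp add: inner_cmat conj_transpose_mult matrix_mul_assoc)

lemma inner_Ad:
  assumes "g \<in> Sp" shows "Ad g X \<bullet> Ad g Y = X \<bullet> Y"
proof -
  have "Ad g X \<bullet> Ad g Y = (g ** (X ** conj_transpose g)) \<bullet> (g ** (Y ** conj_transpose g))"
    by (simp add: Ad_Sp[OF assms] matrix_mul_assoc)
  also have "\<dots> = (X ** conj_transpose g) \<bullet> (Y ** conj_transpose g)"
    unfolding inner_mult_left by (simp add: matrix_mul_assoc SpD[OF assms])
  also have "\<dots> = X \<bullet> Y"
    unfolding inner_mult_right by (simp add: matrix_mul_assoc[symmetric] SpD[OF assms])
  finally show ?thesis .
qed

text \<open>
  An element of \<open>Sp\<close> lies in the isotropy group if and only if it is block diagonal for these blocks.
\<close>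

fun index_block :: "'n index \<Rightarrow> nat" where
  "index_block (Inl None) = 0"
| "index_block (Inr None) = 1"
| "index_block (Inl (Some k)) = 2"
| "index_block (Inr (Some k)) = 2"

lemma isotropy_group_eq:
  "isotropy_group = {g \<in> Sp. \<forall>i j. index_block i \<noteq> index_block j \<longrightarrow> g $ i $ j = 0}" (is "?l = ?r")
proof (intro set_eqI iffI)
  fix g assume g: "g \<in> ?l"
  have "g $ i $ j = 0" if "index_block i \<noteq> index_block j" for i j
  proof -
    have "i \<noteq> j" "i \<in> {Inl None, Inr None} \<or> j \<in> {Inl None, Inr None}"
      using that by (cases i rule: index_cases; cases j rule: index_cases; simp)+
    then show ?thesis using g unfolding isotropy_group_def by blast
  qed
  then show "g \<in> ?r" using g by (simp add: isotropy_group_def)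
next
  fix g assume g: "g \<in> ?r"
  have "index_block i \<noteq> index_block j \<and> index_block j \<noteq> index_block i"
    if "i \<in> {Inl None, Inr None}" "j \<noteq> i" for i j :: "'a index"
    using that by (cases j rule: index_cases) auto
  then show "g \<in> ?l" using g unfolding isotropy_group_def by blast
qed

lemma isotropy_group_conj_transpose: "h \<in> isotropy_group \<Longrightarrow> conj_transpose h \<in> isotropy_group"
  by (auto simp: isotropy_group_eq Sp_conj_transpose conj_transpose_nth)

lemma isotropy_group_one: "mat 1 \<in> isotropy_group"
  using Sp_one by (auto simp: isotropy_group_eq mat_def)

lemma Ad_block_zero:
  assumes h: "h \<in> isotropy_group"
    and X: "\<And>k l. index_block k = index_block p \<Longrightarrow> index_block l = index_block q \<Longrightarrow> X $ k $ l = 0"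
  shows "Ad h X $ p $ q = 0"
proof -
  have hs: "h \<in> Sp" and z: "\<And>i j. index_block i \<noteq> index_block j \<Longrightarrow> h $ i $ j = 0"
    using h by (auto simp: isotropy_group_eq)
  have "h $ p $ k * X $ k $ l * cnj (h $ q $ l) = 0" for k l
    using z[of p k] z[of q l] X[of k l] by (metis mult_eq_0_iff complex_cnj_zero)
  then show ?thesis
    unfolding Ad_Sp[OF hs] matrix_mult_nth conj_transpose_nth sum_distrib_right
    by (intro sum.neutral ballI)
qed

lemma tangent_mat_block_zero:
  "index_block i = index_block j \<Longrightarrow> tangent_mat z $ i $ j = 0"
  by (cases z; cases i rule: index_cases; cases j rule: index_cases) (simp_all add: tangent_mat_nth)

lemma Ad_tangent_mat:
  assumes h: "h \<in> isotropy_group"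
  shows "Ad h (tangent_mat z) = tangent_mat (row_coords (Ad h (tangent_mat z)))"
proof (rule sp_algebra_eq_tangent_mat)
  show "Ad h (tangent_mat z) \<in> sp_algebra"
    using h by (intro Ad_in_sp tangent_mat_in_sp) (simp add: isotropy_group_def)
qed (auto intro!: Ad_block_zero[OF h] tangent_mat_block_zero)

text \<open>
  Conjugation by a block diagonal matrix maps each block into itself, hence preserves the decomposition
  of a matrix of the algebra into its isotropy part and its two tangent components.
\<close>

lemma Ad_isotropy_decomp:
  fixes X :: "'n::{finite,linorder} cmat"
  assumes h: "h \<in> isotropy_group" and X: "X \<in> sp_algebra"
  shows "tangent_mat (0, snd (row_coords (Ad h X))) = Ad h (tangent_mat (0, snd (row_coords X)))"
    and "tangent_mat (fst (row_coords (Ad h X)), 0) = Ad h (tangent_mat (fst (row_coords X), 0))"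
proof -
  define K where "K = X - tangent_mat (row_coords X)"
  have hs: "h \<in> Sp" using h by (simp add: isotropy_group_def)
  have Kr: "row_coords K = 0" by (simp add: K_def linear_diff[OF linear_row_coords])
  have K0: "K $ Inl None $ l = 0" if "l \<noteq> Inl None" for l
    using Kr that by (cases l rule: index_cases) (auto simp: row_coords_def vec_eq_iff zero_prod_def)
  have K1: "K $ k $ l = 0" if "index_block k = 0" "index_block l \<noteq> 0" for k l
    using that K0[of l] by (cases k rule: index_cases; cases l rule: index_cases) auto
  have rK: "row_coords (Ad h K) = 0"
    by (auto simp: row_coords_def vec_eq_iff zero_prod_def intro!: Ad_block_zero[OF h] K1)
  let ?U = "Ad h (tangent_mat (0, snd (row_coords X)))" and ?W = "Ad h (tangent_mat (fst (row_coords X), 0))"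
  have "X = K + (tangent_mat (0, snd (row_coords X)) + tangent_mat (fst (row_coords X), 0))"
    unfolding K_def tangent_mat_split[symmetric] by simp
  then have "Ad h X = Ad h K + (?U + ?W)"
    by (metis linear_add[OF linear_Ad])
  then have row: "row_coords (Ad h X) = row_coords ?U + row_coords ?W"
    by (simp add: linear_add[OF linear_row_coords] rK)
  have U0: "tangent_mat (0, v :: 'n horizontal) $ k $ l = 0"
    if "index_block k = 0" "index_block l = 1" for k l v
    using that by (cases v; cases k rule: index_cases; cases l rule: index_cases) (simp_all add: tangent_mat_nth)
  have W0: "tangent_mat (a :: complex, 0 :: 'n horizontal) $ k $ l = 0"
    if "index_block k = 0" "index_block l = 2" for k l a
    using that by (cases k rule: index_cases; cases l rule: index_cases) (simp_all add: tangent_mat_nth zero_prod_def)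
  have U: "fst (row_coords ?U) = 0"
    by (auto simp: row_coords_def intro!: Ad_block_zero[OF h] U0)
  have W: "snd (row_coords ?W) = 0"
    by (auto simp: row_coords_def vec_eq_iff zero_prod_def intro!: Ad_block_zero[OF h] W0[unfolded zero_prod_def])
  have "row_coords ?U = (0, snd (row_coords (Ad h X)))" "row_coords ?W = (fst (row_coords (Ad h X)), 0)"
    unfolding row by (rule prod_eqI; simp add: U W)+
  then show "tangent_mat (0, snd (row_coords (Ad h X))) = ?U"
    "tangent_mat (fst (row_coords (Ad h X)), 0) = ?W"
    using Ad_tangent_mat[OF h] by metis+
qed

lemma metric_o_Ad:
  fixes X Y :: "'n::{finite,linorder} cmat"
  assumes h: "h \<in> isotropy_group" and X: "X \<in> sp_algebra" and Y: "Y \<in> sp_algebra"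
  shows "metric_o lam (Ad h X) (Ad h Y) = metric_o lam X Y"
proof -
  have hs: "h \<in> Sp" using h by (simp add: isotropy_group_def)
  show ?thesis
    by (simp add: metric_o_eq Ad_in_sp hs X Y Ad_isotropy_decomp[OF h] inner_Ad)
qed

lemma in_coset: "g' \<in> coset g \<longleftrightarrow> (\<exists>h\<in>isotropy_group. g' = g ** h)"
  by (auto simp: coset_def)

text \<open>
  Any representative of the coset differs from \<open>g\<close> by an element of the isotropy group, under which the
  metric at the origin is invariant; so every choice in \<open>metric_at\<close> gives the same value.
\<close>

lemma metric_at_eq:
  fixes X Y :: "'n::{finite,linorder} cmat"
  assumes g: "g \<in> Sp" and X: "X \<in> sp_algebra" and Y: "Y \<in> sp_algebra"
  shows "metric_at lam (coset g) (Ad g X) (Ad g Y) = metric_o lam X Y"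
proof -
  have "g \<in> coset g" unfolding in_coset using isotropy_group_one matrix_mul_rid by metis
  then have "(SOME g'. g' \<in> coset g) \<in> coset g" by (rule someI)
  then obtain h where h: "h \<in> isotropy_group" and s: "(SOME g'. g' \<in> coset g) = g ** h"
    unfolding in_coset by blast
  have hs: "h \<in> Sp" using h by (simp add: isotropy_group_def)
  have "Ad (matrix_inv (g ** h)) (Ad g Z) = Ad (conj_transpose h) Z" for Z
    by (simp add: SpD(4)[OF Sp_mult[OF g hs]] conj_transpose_mult Ad_mult Sp_conj_transpose g hs Ad_inverse)
  then show ?thesis
    unfolding metric_at_def s Let_def using metric_o_Ad[OF isotropy_group_conj_transpose[OF h] X Y] by simp
qed

lemma tangent_coset:
  assumes g: "g \<in> Sp" shows "tangent (coset g) = Ad g ` tangent_o"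
proof (intro set_eqI iffI)
  fix Z assume "Z \<in> tangent (coset g)"
  then obtain h X where h: "h \<in> isotropy_group" and X: "X \<in> tangent_o" and Z: "Z = Ad (g ** h) X"
    unfolding tangent_def in_coset by blast
  have hs: "h \<in> Sp" using h by (simp add: isotropy_group_def)
  have "Ad h X \<in> tangent_o" using X Ad_tangent_mat[OF h] unfolding tangent_o_eq by (metis rangeE rangeI)
  then show "Z \<in> Ad g ` tangent_o" unfolding Z Ad_mult[OF g hs] by blast
next
  fix Z assume "Z \<in> Ad g ` tangent_o"
  moreover have "g \<in> coset g" unfolding in_coset using isotropy_group_one matrix_mul_rid by metis
  ultimately show "Z \<in> tangent (coset g)" unfolding tangent_def by blast
qed

section \<open>Exponentials and a smooth lift to the group\<close>

text \<open>
  For skew-Hermitian \<open>X\<close> such that \<open>X\<^sup>3\<close> is a multiple of \<open>X\<close>, both the exponential of \<open>X\<close> and its Cayley transform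
  \<open>(1 + X) (1 - X)\<^sup>-\<^sup>1\<close> have this form.
\<close>

definition rodrigues :: "real \<Rightarrow> real \<Rightarrow> 'n::finite cmat \<Rightarrow> 'n cmat" where
  "rodrigues s c X = mat 1 + s *\<^sub>R X + c *\<^sub>R (X ** X)"

text \<open>
  With \<open>X\<^sup>4 = -\<rho> X\<^sup>2\<close> the product \<open>(1 - s X + c X\<^sup>2) (1 + s X + c X\<^sup>2)\<close> is \<open>1 + (2 c - s\<^sup>2 - c\<^sup>2 \<rho>) X\<^sup>2\<close>.
\<close>

lemma rodrigues_in_Sp:
  assumes X: "X \<in> sp_algebra" and cube: "X ** (X ** X) = - (\<rho> *\<^sub>R X)" and c: "2 * c = s\<^sup>2 + c\<^sup>2 * \<rho>"
  shows "rodrigues s c X \<in> Sp"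
proof (rule SpI)
  note sx = sp_transpose_symp[OF X]
  have ct: "conj_transpose (rodrigues s c X) = mat 1 - s *\<^sub>R X + c *\<^sub>R (X ** X)"
    by (simp add: rodrigues_def conj_transpose_simps conj_transpose_mult sx mult_simps)
  have four: "(X ** X) ** (X ** X) = - (\<rho> *\<^sub>R (X ** X))"
    using cube by (metis matrix_mul_assoc mm.minus_right mm.scaleR_right)
  have three: "(X ** X) ** X = X ** (X ** X)" by (simp add: matrix_mul_assoc)
  have double: "X ** X * 2 = 2 *\<^sub>R (X ** X)" by (simp only: scaleR_2 mult_2_right)
  have "conj_transpose (rodrigues s c X) ** rodrigues s c X
      = mat 1 + (c + c - s\<^sup>2 - c\<^sup>2 * \<rho>) *\<^sub>R (X ** X)"
    unfolding ct unfolding rodrigues_def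
    by (simp add: mult_simps three four) (simp add: double algebra_simps power2_eq_square)
  then show "conj_transpose (rodrigues s c X) ** rodrigues s c X = mat 1" using c by simp
  have "transpose (X ** X) ** symp_form = transpose X ** (transpose X ** symp_form)"
    by (simp add: matrix_transpose_mul matrix_mul_assoc)
  also have "\<dots> = symp_form ** (X ** X)"
    unfolding sx by (simp add: mult_simps matrix_mul_assoc sx)
  finally have "transpose (X ** X) ** symp_form = symp_form ** (X ** X)" .
  then show "transpose (rodrigues s c X) ** symp_form = symp_form ** conj_transpose (rodrigues s c X)"
    unfolding ct by (simp add: rodrigues_def transpose_simps mult_simps sx)
qed

lemma vertical_mult_nth:
  "(tangent_mat (a, 0) ** M) $ Inl None $ j = a * M $ Inr None $ j"
  "(tangent_mat (a, 0) ** M) $ Inr None $ j = - cnj a * M $ Inl None $ j"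
  "(tangent_mat (a, 0) ** M) $ Inl (Some k) $ j = 0"
  "(tangent_mat (a, 0) ** M) $ Inr (Some k) $ j = 0"
  by (simp_all add: matrix_mult_nth sum_index sum_option tangent_mat_nth zero_prod_def)

lemma neg_scaleR_nth: "(- (r *\<^sub>R A)) $ i $ j = - of_real r * A $ i $ j" for A :: "'n::finite cmat"
  unfolding vector_scaleR_component vector_uminus_component scaleR_conv_of_real[where 'a = complex]
  by simp

lemma vertical_cube:
  "tangent_mat (a, 0) ** (tangent_mat (a, 0) ** tangent_mat (a, 0))
    = - ((norm a)\<^sup>2 *\<^sub>R (tangent_mat (a, 0) :: 'n::finite cmat))" (is "?l = ?r")
proof -
  have n: "a * cnj a = complex_of_real ((norm a)\<^sup>2)" by (rule complex_norm_square[symmetric])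
  have "?l $ i $ j = ?r $ i $ j" for i j
  proof (cases i rule: index_cases)
    case 1
    have "?l $ i $ j = - ((a * cnj a) * tangent_mat (a, 0) $ Inl None $ j)"
      unfolding 1 by (simp add: vertical_mult_nth)
    then show ?thesis
      unfolding neg_scaleR_nth n 1 by simp
  next
    case 2
    have "?l $ i $ j = - ((a * cnj a) * tangent_mat (a, 0) $ Inr None $ j)"
      unfolding 2 by (simp add: vertical_mult_nth)
    then show ?thesis
      unfolding neg_scaleR_nth n 2 by simp
  qed (cases j rule: index_cases; simp add: vertical_mult_nth; simp add: tangent_mat_nth zero_prod_def)+
  then show ?thesis by (simp add: vec_eq_iff)
qed

lemma horizontal_square_nth:
  "(tangent_mat (0, h) ** tangent_mat (0, h)) $ Inl None $ j = (if j = Inl None then - of_real ((norm h)\<^sup>2) else 0)"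
  "(tangent_mat (0, h) ** tangent_mat (0, h)) $ Inr None $ j = (if j = Inr None then - of_real ((norm h)\<^sup>2) else 0)"
proof -
  obtain p q where h: "h = (p, q)" by (cases h)
  have "(norm h)\<^sup>2 = (\<Sum>k\<in>UNIV. (norm (p $ k))\<^sup>2 + (norm (q $ k))\<^sup>2)"
    unfolding h norm_Pair norm_vec_def L2_set_def 
    by (simp add: sum_nonneg sum.distrib)
  then have n: "complex_of_real ((norm h)\<^sup>2) = (\<Sum>k\<in>UNIV. p $ k * cnj (p $ k) + q $ k * cnj (q $ k))"
    by (simp only: of_real_sum of_real_add complex_norm_square)
  show "(tangent_mat (0, h) ** tangent_mat (0, h)) $ Inl None $ j = (if j = Inl None then - of_real ((norm h)\<^sup>2) else 0)"
    unfolding n unfolding h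
    by (cases j rule: index_cases)
       (simp_all add: matrix_mult_nth sum_index sum_option tangent_mat_nth sum_negf[symmetric] algebra_simps)
  show "(tangent_mat (0, h) ** tangent_mat (0, h)) $ Inr None $ j = (if j = Inr None then - of_real ((norm h)\<^sup>2) else 0)"
    unfolding n unfolding h
    by (cases j rule: index_cases)
       (simp_all add: matrix_mult_nth sum_index sum_option tangent_mat_nth sum_negf[symmetric] algebra_simps)
qed

lemma horizontal_cube:
  "tangent_mat (0, h) ** (tangent_mat (0, h) ** tangent_mat (0, h)) = - ((norm h)\<^sup>2 *\<^sub>R tangent_mat (0, h))"
  (is "?X ** (?X ** ?X) = _")
proof -
  have low: "(?X ** (?X ** ?X)) $ i $ j = - of_real ((norm h)\<^sup>2) * ?X $ i $ j" if "index_block i = 2" for i j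
  proof -
    have "(?X ** (?X ** ?X)) $ i $ j = ?X $ i $ Inl None * (?X ** ?X) $ Inl None $ j
        + ?X $ i $ Inr None * (?X ** ?X) $ Inr None $ j"
      using that unfolding matrix_mult_nth[of ?X "?X ** ?X"]
      by (simp add: sum_index sum_option tangent_mat_block_zero)
    also have "\<dots> = - of_real ((norm h)\<^sup>2) * ?X $ i $ j"
      using that by (cases j rule: index_cases) (simp_all add: horizontal_square_nth tangent_mat_block_zero)
    finally show ?thesis .
  qed
  have up: "((?X ** ?X) ** ?X) $ i $ j = - of_real ((norm h)\<^sup>2) * ?X $ i $ j" if "i = Inl None \<or> i = Inr None" for i j
    using that unfolding matrix_mult_nth[of "?X ** ?X" ?X]
    by (auto simp: horizontal_square_nth if_distrib if_distribR cong: if_cong)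
  have "(?X ** (?X ** ?X)) $ i $ j = - of_real ((norm h)\<^sup>2) * ?X $ i $ j" for i j
    using low[of i j] up[of i j] by (cases i rule: index_cases) (simp_all add: matrix_mul_assoc)
  then show ?thesis
    unfolding vec_eq_iff neg_scaleR_nth by blast
qed

text \<open>
  The positive powers of \<open>X\<close> are up to sign \<open>X\<close> and \<open>X\<^sup>2\<close> alternately, so the exponential series splits into the
  series of sine and cosine.
\<close>

lemma mexp_rodrigues:
  fixes X :: "'n::finite cmat"
  assumes cube: "X ** (X ** X) = - X"
  shows "mexp (t *\<^sub>R X) = rodrigues (sin t) (1 - cos t) X"
proof -
  have pow: "((**) (t *\<^sub>R X) ^^ k) (mat 1) = t ^ k *\<^sub>R ((if k = 0 then mat 1 + X ** X else 0)
      + (fact k * sin_coeff k) *\<^sub>R X - (fact k * cos_coeff k) *\<^sub>R (X ** X))" for k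
  proof (induction k)
    case 0 show ?case by (simp add: sin_coeff_def cos_coeff_def)
  next
    case (Suc k)
    have "X ** (if k = 0 then mat 1 + X ** X else 0) = 0"
      by (simp add: mult_simps cube)
    moreover have "fact (Suc k) * sin_coeff (Suc k) = fact k * cos_coeff k"
      "fact (Suc k) * cos_coeff (Suc k) = - (fact k * sin_coeff k)"
      by (simp_all add: sin_coeff_Suc cos_coeff_Suc field_simps del: of_nat_Suc)
    moreover have step: "((**) (t *\<^sub>R X) ^^ Suc k) (mat 1) = (t *\<^sub>R X) ** (((**) (t *\<^sub>R X) ^^ k) (mat 1))"
      by (simp only: funpow.simps comp_apply)
    ultimately show ?case
      unfolding step Suc by (simp add: mult_simps cube del: fact_Suc funpow.simps) (simp add: algebra_simps)
  qed
  have coeffs: "(1 / fact k) *\<^sub>R ((**) (t *\<^sub>R X) ^^ k) (mat 1) = (if k = 0 then mat 1 + X ** X else 0)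
      + (sin_coeff k *\<^sub>R t ^ k) *\<^sub>R X - (cos_coeff k *\<^sub>R t ^ k) *\<^sub>R (X ** X)" for k
    unfolding pow by (simp add: algebra_simps)
  have "(\<lambda>k. (if k = 0 then mat 1 + X ** X else 0)
      + (sin_coeff k *\<^sub>R t ^ k) *\<^sub>R X - (cos_coeff k *\<^sub>R t ^ k) *\<^sub>R (X ** X))
    sums ((mat 1 + X ** X) + sin t *\<^sub>R X - cos t *\<^sub>R (X ** X))"
    by (intro sums_add sums_diff sums_scaleR_left sin_converges cos_converges sums_single)
  then show ?thesis
    unfolding mexp_def coeffs rodrigues_def by (simp add: sums_iff algebra_simps)
qed

definition rot :: "complex \<Rightarrow> real \<Rightarrow> 'n::finite cmat" where
  "rot a s = rodrigues (sin s) (1 - cos s) (tangent_mat (a, 0))"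

text \<open>
  The conformal factor of the stereographic projection.  For \<open>c = s = stereo z\<close> the matrix
  \<open>rodrigues s c X\<close> is the Cayley transform of a horizontal \<open>X\<close> with \<open>X\<^sup>3 = -|snd z|\<^sup>2 X\<close>.
\<close>

definition stereo :: "'n::finite coords \<Rightarrow> real" where
  "stereo z = 2 / (1 + (norm (snd z))\<^sup>2)"

text \<open>
  The conjugations make the lower part of the first column equal to \<open>stereo z *\<^sub>R snd z\<close>, see \<open>first_col_boost\<close>.
\<close>

definition boost :: "'n::finite coords \<Rightarrow> 'n cmat" where
  "boost z = rodrigues (stereo z) (stereo z)
     (tangent_mat (0, - (\<chi> k. cnj (fst (snd z) $ k)), - (\<chi> k. cnj (snd (snd z) $ k))))"

text \<open>
  The first rotation is the one-parameter group that generates the curve.  It stands on the left, where it acts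
  by isometries; this is why the metric does not depend on the coordinate \<open>Re (fst z)\<close>.
\<close>

definition lift :: "'n::finite coords \<Rightarrow> 'n cmat" where
  "lift z = rot 1 (Re (fst z)) ** (rot \<i> (Im (fst z)) ** boost z)"

lemma one_minus_cos: "2 * (1 - cos s) = (sin s)\<^sup>2 + (1 - cos s)\<^sup>2 * 1" for s :: real
  using sin_cos_squared_add[of s] by (simp add: power2_eq_square algebra_simps)

lemma rot_in_Sp: "norm a = 1 \<Longrightarrow> rot a s \<in> Sp"
  unfolding rot_def
  by (rule rodrigues_in_Sp[where \<rho> = 1, OF tangent_mat_in_sp])
     (simp_all only: vertical_cube one_minus_cos power_one)

lemma stereo_eq: "stereo z * (1 + (norm (snd z))\<^sup>2) = 2" "stereo z > 0"
proof -
  have "1 + (norm (snd z))\<^sup>2 > 0" by (simp add: add_pos_nonneg)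
  moreover have "2 / a * a = 2" if "a > 0" for a :: real using that by simp
  ultimately show "stereo z * (1 + (norm (snd z))\<^sup>2) = 2" "stereo z > 0"
    unfolding stereo_def by (blast, simp)
qed

lemma norm_conj_pair: "norm (- (\<chi> k. cnj (p $ k)), - (\<chi> k. cnj (q $ k))) = norm (p, q)"
  for p q :: "(complex, 'n::finite) vec"
  by (simp add: norm_Pair norm_vec_def)

lemma boost_in_Sp: "boost z \<in> Sp"
  unfolding boost_def
proof (rule rodrigues_in_Sp[OF tangent_mat_in_sp horizontal_cube])
  have "2 * stereo z = stereo z * (stereo z * (1 + (norm (snd z))\<^sup>2))" by (simp add: stereo_eq)
  then show "2 * stereo z = (stereo z)\<^sup>2 + (stereo z)\<^sup>2 * (norm (- (\<chi> k. cnj (fst (snd z) $ k)), - (\<chi> k. cnj (snd (snd z) $ k))))\<^sup>2"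
    unfolding norm_conj_pair by (simp add: power2_eq_square algebra_simps)
qed

lemma lift_in_Sp: "lift z \<in> Sp"
  unfolding lift_def by (intro Sp_mult rot_in_Sp boost_in_Sp) simp_all

lemma smooth_rodrigues:
  assumes "smooth_fun s" "smooth_fun c" "smooth_fun X"
  shows "smooth_fun (\<lambda>z. rodrigues (s z) (c z) (X z))"
  unfolding rodrigues_def
  by (intro smooth_fun_add smooth_fun_scaleR smooth_fun_const assms
      smooth_fun_bounded_bilinear[OF bounded_bilinear_matrix_mult])

lemma smooth_fun_norm_square:
  fixes f :: "'a::real_normed_vector \<Rightarrow> 'b::real_inner"
  assumes "smooth_fun f" shows "smooth_fun (\<lambda>z. (norm (f z))\<^sup>2)"
  unfolding power2_norm_eq_inner using assms by auto

lemma smooth_stereo: "smooth_fun (stereo :: 'n::finite coords \<Rightarrow> real)"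
proof -
  have "1 + (norm (snd z))\<^sup>2 \<noteq> 0" for z :: "'n coords"
    by (metis add_pos_nonneg less_numeral_extra(3) zero_le_power2 zero_less_one)
  then have "smooth_fun (\<lambda>z :: 'n coords. 2 / (1 + (norm (snd z))\<^sup>2))"
    by (intro smooth_fun_divide smooth_fun_add smooth_fun_const smooth_fun_norm_square
        smooth_fun_linear linear_snd)
  then show ?thesis unfolding stereo_def[abs_def] .
qed

lemma smooth_lift: "smooth_fun (lift :: 'n::finite coords \<Rightarrow> 'n cmat)"
proof -
  have "linear (\<lambda>z :: 'n coords. Re (fst z))" "linear (\<lambda>z :: 'n coords. Im (fst z))"
    by (auto intro!: linearI)
  then have 1: "smooth_fun (\<lambda>z :: 'n coords. Re (fst z))" "smooth_fun (\<lambda>z :: 'n coords. Im (fst z))"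
    by (auto intro: smooth_fun_linear)
  have "linear (\<lambda>z :: 'n coords. tangent_mat (0, - (\<chi> k. cnj (fst (snd z) $ k)), - (\<chi> k. cnj (snd (snd z) $ k))))"
    by (rule linear_compose[OF _ linear_tangent_mat, unfolded o_def], rule linearI)
       (simp_all add: vec_eq_iff)
  then have 2: "smooth_fun (\<lambda>z :: 'n coords. tangent_mat (0, - (\<chi> k. cnj (fst (snd z) $ k)), - (\<chi> k. cnj (snd (snd z) $ k))))"
    by (rule smooth_fun_linear)
  show ?thesis
    unfolding lift_def[abs_def] rot_def boost_def
    by (intro smooth_fun_bounded_bilinear[OF bounded_bilinear_matrix_mult] smooth_rodrigues
        smooth_fun_sin smooth_fun_cos smooth_fun_diff smooth_fun_const smooth_stereo 1 2)
qed

section \<open>The metric in terms of the first column\<close>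

text \<open>
  The first column of a group element, with the pair of entries in rows \<open>1\<close> and \<open>n+2\<close> split off: as a quaternion
  it is the coordinate that varies along the fibre.
\<close>

type_synonym 'n column = "(complex \<times> complex) \<times> 'n horizontal"

definition first_col :: "'n::finite cmat \<Rightarrow> 'n column" where
  "first_col M = ((M $ Inl None $ Inl None, M $ Inr None $ Inl None),
     (\<chi> k. M $ Inl (Some k) $ Inl None), (\<chi> k. M $ Inr (Some k) $ Inl None))"

definition herm :: "'n::finite column \<Rightarrow> 'n column \<Rightarrow> complex" where
  "herm v w = cnj (fst (fst v)) * fst (fst w) + cnj (snd (fst v)) * snd (fst w)
     + (\<Sum>k\<in>UNIV. cnj (fst (snd v) $ k) * fst (snd w) $ k + cnj (snd (snd v) $ k) * snd (snd w) $ k)"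

definition sympl :: "'n::finite column \<Rightarrow> 'n column \<Rightarrow> complex" where
  "sympl v w = fst (fst v) * snd (fst w) - snd (fst v) * fst (fst w)
     + (\<Sum>k\<in>UNIV. fst (snd v) $ k * snd (snd w) $ k - snd (snd v) $ k * fst (snd w) $ k)"

lemma linear_first_col: "linear (first_col :: 'n::finite cmat \<Rightarrow> 'n column)"
  by (rule linearI) (simp_all add: first_col_def vec_eq_iff)

lemma Re_herm: "Re (herm v w) = v \<bullet> w"
  by (cases v; cases w) (auto simp: herm_def inner_complex_def inner_vec_def sum.distrib)

text \<open>
  The second equation uses that \<open>g\<close> is symplectic: its column \<open>n+2\<close> is determined by the first one, and
  the Hermitian product with it is the symplectic product with the first column.
\<close>

lemma herm_sympl_first_col:
  fixes g M :: "'n::{finite,linorder} cmat"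
  assumes g: "g \<in> Sp" and sp: "conj_transpose g ** M \<in> sp_algebra"
  shows "(conj_transpose g ** M) $ Inl None $ Inl None = herm (first_col g) (first_col M)"
    and "fst (row_coords (conj_transpose g ** M)) = - cnj (sympl (first_col g) (first_col M))"
proof -
  show "(conj_transpose g ** M) $ Inl None $ Inl None = herm (first_col g) (first_col M)"
    by (simp add: matrix_mult_nth sum_index sum_option conj_transpose_nth herm_def first_col_def algebra_simps)
  have r: "conj_transpose g $ Inr None $ q = (transpose g ** symp_form) $ Inl None $ q" for q
    using SpD(5)[OF g] by simp
  have "(conj_transpose g ** M) $ Inr None $ Inl None = sympl (first_col g) (first_col M)"
    unfolding matrix_mult_nth[of "conj_transpose g"] r
    by (simp add: sum_index sum_option transpose_nth sympl_def first_col_def algebra_simps)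
  then show "fst (row_coords (conj_transpose g ** M)) = - cnj (sympl (first_col g) (first_col M))"
    using sp_algebraD(1)[OF sp, of "Inl None" "Inr None"] by (simp add: row_coords_def)
qed

text \<open>
  By unitarity of \<open>g\<close> the first column of \<open>g\<^sup>* M\<close> has the same norm as that of \<open>M\<close>, and by skewness it is the
  first row up to conjugation.  Removing the first two coordinates leaves the horizontal part.
\<close>

lemma inner_row_coords:
  fixes g M N :: "'n::{finite,linorder} cmat"
  assumes g: "g \<in> Sp" and M: "conj_transpose g ** M \<in> sp_algebra" and N: "conj_transpose g ** N \<in> sp_algebra"
  shows "snd (row_coords (conj_transpose g ** M)) \<bullet> snd (row_coords (conj_transpose g ** N))
    = first_col M \<bullet> first_col N - herm (first_col g) (first_col M) \<bullet> herm (first_col g) (first_col N)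
      - sympl (first_col g) (first_col M) \<bullet> sympl (first_col g) (first_col N)"
proof -
  let ?A = "conj_transpose g ** M" and ?B = "conj_transpose g ** N"
  have nn: "cnj x \<bullet> cnj y = x \<bullet> y" for x y :: complex by (simp add: inner_complex_def)
  have col: "first_col ?A \<bullet> first_col ?B = first_col M \<bullet> first_col N"
  proof -
    have "conj_transpose ?A ** ?B = conj_transpose M ** (g ** conj_transpose g) ** N"
      by (simp only: conj_transpose_mult conj_transpose_conj_transpose matrix_mul_assoc)
    then have e: "conj_transpose ?A ** ?B = conj_transpose M ** N" using SpD(2)[OF g] by simp
    have "first_col P \<bullet> first_col Q = Re ((conj_transpose P ** Q) $ Inl None $ Inl None)" for P Q :: "'n cmat"
      by (simp add: matrix_mult_nth sum_index sum_option conj_transpose_nth first_col_def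
          inner_complex_def inner_vec_def sum.distrib algebra_simps)
    then show ?thesis using e by metis
  qed
  have a: "?A $ i $ Inl None = - cnj (?A $ Inl None $ i)" and b: "?B $ i $ Inl None = - cnj (?B $ Inl None $ i)" for i
    by (rule sp_algebraD(1)[OF M], rule sp_algebraD(1)[OF N])
  have "first_col ?A \<bullet> first_col ?B = ?A $ Inl None $ Inl None \<bullet> ?B $ Inl None $ Inl None
      + fst (row_coords ?A) \<bullet> fst (row_coords ?B) + snd (row_coords ?A) \<bullet> snd (row_coords ?B)"
    unfolding first_col_def row_coords_def a[of "Inr _"] b[of "Inr _"] a[of "Inl (Some _)"] b[of "Inl (Some _)"]
    by (simp add: inner_vec_def nn)
  then show ?thesis
    unfolding col herm_sympl_first_col[OF g M] herm_sympl_first_col[OF g N] by (simp add: nn)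
qed

text \<open>
  The pullback of the Maurer-Cartan form under \<open>\<sigma>\<close>.
\<close>

definition maurer_cartan :: "('n coords \<Rightarrow> 'n cmat) \<Rightarrow> 'n coords \<Rightarrow> 'n coords \<Rightarrow> 'n::finite cmat" where
  "maurer_cartan \<sigma> z u = conj_transpose (\<sigma> z) ** frechet_derivative \<sigma> (at z) u"

lemma smooth_fun_linear_derivative: "smooth_fun f \<Longrightarrow> linear (frechet_derivative f (at x))"
  using smooth_fun_has_derivative has_derivative_linear by blast

lemma linear_maurer_cartan:
  "smooth_fun \<sigma> \<Longrightarrow> linear (maurer_cartan \<sigma> z)"
  unfolding maurer_cartan_def
  by (rule linearI) (simp_all add: linear_add[OF smooth_fun_linear_derivative]
      linear_cmul[OF smooth_fun_linear_derivative] mult_simps)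

lemma maurer_cartan_in_sp:
  fixes \<sigma> :: "'n::finite coords \<Rightarrow> 'n cmat"
  assumes s: "smooth_fun \<sigma>" and Sp: "\<And>z. \<sigma> z \<in> Sp"
  shows "maurer_cartan \<sigma> z u \<in> sp_algebra"
proof -
  let ?D = "frechet_derivative \<sigma> (at z)" and ?W = "maurer_cartan \<sigma> z u"
  have D: "(\<sigma> has_derivative ?D) (at z)" by (rule smooth_fun_has_derivative[OF s])
  note ctD = bounded_linear.has_derivative[OF bounded_linear_conj_transpose D]
    and trD = bounded_linear.has_derivative[OF bounded_linear_transpose D]
  have "((\<lambda>z. mat 1) has_derivative
      (\<lambda>u. conj_transpose (\<sigma> z) ** ?D u + conj_transpose (?D u) ** \<sigma> z)) (at z)"
    using mm.FDERIV[OF ctD D] unfolding SpD(1)[OF Sp] .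
  from fun_cong[OF has_derivative_unique[OF this has_derivative_const], of u]
  have 1: "conj_transpose (\<sigma> z) ** ?D u + conj_transpose (?D u) ** \<sigma> z = 0" .
  have "((\<lambda>z. symp_form) has_derivative (\<lambda>u. (transpose (\<sigma> z) ** symp_form) ** ?D u
      + (transpose (\<sigma> z) ** 0 + transpose (?D u) ** symp_form) ** \<sigma> z)) (at z)"
    using mm.FDERIV[OF mm.FDERIV[OF trD has_derivative_const, of symp_form] D] unfolding SpD(3)[OF Sp] .
  from fun_cong[OF has_derivative_unique[OF this has_derivative_const], of u]
  have 2: "transpose (\<sigma> z) ** symp_form ** ?D u + transpose (?D u) ** symp_form ** \<sigma> z = 0"
    by (simp add: mm.zero_right)
  have Du: "?D u = \<sigma> z ** ?W"
    unfolding maurer_cartan_def by (simp add: matrix_mul_assoc SpD(2)[OF Sp])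
  have "conj_transpose ?W + ?W = 0"
    using 1 by (simp add: maurer_cartan_def conj_transpose_mult add.commute)
  moreover have "transpose ?W ** symp_form + symp_form ** ?W = 0"
  proof -
    have "transpose (\<sigma> z) ** symp_form ** ?D u = symp_form ** ?W"
      unfolding Du by (simp only: matrix_mul_assoc SpD(3)[OF Sp])
    moreover have "transpose (?D u) ** symp_form ** \<sigma> z = transpose ?W ** (transpose (\<sigma> z) ** symp_form ** \<sigma> z)"
      unfolding Du by (simp only: matrix_mul_assoc matrix_transpose_mul)
    ultimately show ?thesis using 2 SpD(3)[OF Sp, of z] by (simp add: add.commute)
  qed
  ultimately show ?thesis by (simp add: sp_algebra_def)
qed

lemma chart_deriv_eq:
  fixes \<sigma> :: "'n::{finite,linorder} coords \<Rightarrow> 'n cmat"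
  assumes s: "smooth_fun \<sigma>" and Sp: "\<And>z. \<sigma> z \<in> Sp"
  shows "chart_deriv \<sigma> z u = Ad (\<sigma> z) (tangent_mat (row_coords (maurer_cartan \<sigma> z u)))"
  unfolding chart_deriv_def SpD(4)[OF Sp] maurer_cartan_def[symmetric]
  by (simp only: proj_o_eq[OF maurer_cartan_in_sp[OF assms]])

lemma chart_metric_eq_row:
  fixes \<sigma> :: "'n::{finite,linorder} coords \<Rightarrow> 'n cmat"
  assumes s: "smooth_fun \<sigma>" and Sp: "\<And>z. \<sigma> z \<in> Sp"
  shows "chart_metric lam \<sigma> z u v = (2 * real CARD('n) + 4) *
    (4 * lam M1 * (snd (row_coords (maurer_cartan \<sigma> z u)) \<bullet> snd (row_coords (maurer_cartan \<sigma> z v)))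
     + 2 * lam M2 * (fst (row_coords (maurer_cartan \<sigma> z u)) \<bullet> fst (row_coords (maurer_cartan \<sigma> z v))))"
proof -
  have T0: "tangent_mat (0, h) \<bullet> tangent_mat (0, h') = 4 * (h \<bullet> h')" 
    for h h' :: "'n horizontal"
    using inner_tangent_mat[of 0 "fst h" "snd h" 0 "fst h'" "snd h'"] by (simp add: inner_prod_def)
  have T1: "(tangent_mat (a, 0) :: 'n cmat) \<bullet> tangent_mat (a', 0) = 2 * (a \<bullet> a')" for a a'
    using inner_tangent_mat[of a "0 :: (complex, 'n) vec" 0 a' 0 0] by (simp add: zero_prod_def)
  show ?thesis
    unfolding chart_metric_def chart_deriv_eq[OF assms]
    by (simp add: metric_at_eq Sp tangent_mat_in_sp metric_o_eq T0 T1)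
qed

lemma chart_metric_eq_column:
  fixes \<sigma> :: "'n::{finite,linorder} coords \<Rightarrow> 'n cmat"
  assumes s: "smooth_fun \<sigma>" and Sp: "\<And>z. \<sigma> z \<in> Sp"
    and V: "((\<lambda>z. first_col (\<sigma> z)) has_derivative V') (at z)"
  shows "chart_metric lam \<sigma> z u v = (2 * real CARD('n) + 4) *
    (4 * lam M1 * (V' u \<bullet> V' v - herm (first_col (\<sigma> z)) (V' u) \<bullet> herm (first_col (\<sigma> z)) (V' v))
     + (2 * lam M2 - 4 * lam M1) * (sympl (first_col (\<sigma> z)) (V' u) \<bullet> sympl (first_col (\<sigma> z)) (V' v)))"
proof -
  have nn: "cnj x \<bullet> cnj y = x \<bullet> y" for x y :: complex by (simp add: inner_complex_def)
  have "((\<lambda>z. first_col (\<sigma> z)) has_derivative (\<lambda>u. first_col (frechet_derivative \<sigma> (at z) u))) (at z)"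
    by (rule bounded_linear.has_derivative[OF _ smooth_fun_has_derivative[OF s]])
       (use linear_first_col in \<open>simp add: linear_conv_bounded_linear\<close>)
  from has_derivative_unique[OF V this]
  have V': "V' u = first_col (frechet_derivative \<sigma> (at z) u)" for u by (rule fun_cong)
  note sp = maurer_cartan_in_sp[OF s Sp, of z, unfolded maurer_cartan_def]
  show ?thesis
    unfolding chart_metric_eq_row[OF s Sp] maurer_cartan_def inner_row_coords[OF Sp sp sp]
      herm_sympl_first_col(2)[OF Sp sp] V'[symmetric]
    by (simp add: nn algebra_simps)
qed

section \<open>The metric in the coordinates of the lift\<close>

lemma rot_mult_nth:
  fixes M :: "'n::finite cmat"
  assumes "norm a = 1"
  shows "(rot a s ** M) $ Inl None $ j = of_real (cos s) * M $ Inl None $ j + of_real (sin s) * (a * M $ Inr None $ j)"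
    and "(rot a s ** M) $ Inr None $ j = of_real (cos s) * M $ Inr None $ j - of_real (sin s) * (cnj a * M $ Inl None $ j)"
    and "(rot a s ** M) $ Inl (Some k) $ j = M $ Inl (Some k) $ j"
    and "(rot a s ** M) $ Inr (Some k) $ j = M $ Inr (Some k) $ j"
proof -
  have "a * cnj a = 1" using complex_norm_square[of a] assms by simp
  then have aa: "a * (cnj a * x) = x" "cnj a * (a * x) = x" for x
    by (metis mult.assoc mult.commute mult_1)+
  have "rot a s ** M = M + sin s *\<^sub>R (tangent_mat (a, 0) ** M)
      + (1 - cos s) *\<^sub>R (tangent_mat (a, 0) ** (tangent_mat (a, 0) ** M))"
    unfolding rot_def rodrigues_def mult_simps by (simp only: matrix_mul_lid matrix_mul_assoc)
  then have e: "(rot a s ** M) $ i $ j = M $ i $ j + of_real (sin s) * (tangent_mat (a, 0) ** M) $ i $ j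
      + (1 - of_real (cos s)) * (tangent_mat (a, 0) ** (tangent_mat (a, 0) ** M)) $ i $ j" for i
    by (simp only: vector_add_component vector_scaleR_component scaleR_conv_of_real[where 'a = complex])
       (simp add: scaleR_conv_of_real[where 'a = complex])
  show "(rot a s ** M) $ Inl None $ j = of_real (cos s) * M $ Inl None $ j + of_real (sin s) * (a * M $ Inr None $ j)"
    "(rot a s ** M) $ Inr None $ j = of_real (cos s) * M $ Inr None $ j - of_real (sin s) * (cnj a * M $ Inl None $ j)"
    "(rot a s ** M) $ Inl (Some k) $ j = M $ Inl (Some k) $ j"
    "(rot a s ** M) $ Inr (Some k) $ j = M $ Inr (Some k) $ j"
    unfolding e by (simp_all add: vertical_mult_nth aa algebra_simps)
qed

lemma first_col_boost: "first_col (boost z) = ((of_real (stereo z - 1), 0), stereo z *\<^sub>R snd z)"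
proof -
  let ?h = "(- (\<chi> k. cnj (fst (snd z) $ k)), - (\<chi> k. cnj (snd (snd z) $ k)))"
  let ?X = "tangent_mat (0, ?h)"
  have e: "boost z $ i $ j = mat 1 $ i $ j + of_real (stereo z) * ?X $ i $ j + of_real (stereo z) * (?X ** ?X) $ i $ j" for i j
    unfolding boost_def rodrigues_def vector_add_component vector_scaleR_component
      scaleR_conv_of_real[where 'a = complex] by simp
  have low: "(?X ** ?X) $ i $ Inl None = 0" if "index_block i = 2" for i
    using that by (simp add: matrix_mult_nth sum_index sum_option tangent_mat_block_zero tangent_mat_nth[of "(0, ?h)" "Inr None" "Inl None"]
       tangent_mat_nth[of "(0, ?h)" "Inl None" "Inl None"])
  have "stereo z * (norm (snd z))\<^sup>2 = 2 - stereo z" using stereo_eq(1)[of z] by (simp add: algebra_simps)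
  then have n: "complex_of_real (stereo z) * of_real ((norm (snd z))\<^sup>2) = 2 - of_real (stereo z)"
    by (metis of_real_diff of_real_mult of_real_numeral)
  have 1: "boost z $ Inl None $ Inl None = of_real (stereo z - 1)"
    unfolding e horizontal_square_nth norm_conj_pair prod.collapse
    using n by (simp add: mat_def tangent_mat_nth del: of_real_power)
  have 2: "boost z $ Inr None $ Inl None = 0"
    unfolding e horizontal_square_nth by (simp add: mat_def tangent_mat_nth)
  have 3: "boost z $ Inl (Some k) $ Inl None = stereo z *\<^sub>R (fst (snd z) $ k)"
    "boost z $ Inr (Some k) $ Inl None = stereo z *\<^sub>R (snd (snd z) $ k)" for k
    unfolding e by (simp_all add: low mat_def tangent_mat_nth scaleR_conv_of_real)
  show ?thesis
    unfolding first_col_def 1 2 3 by (simp add: prod_eq_iff vec_eq_iff)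
qed

text \<open>
  The two distinguished entries of the first column at horizontal coordinate \<open>0\<close>; \<open>fibre_x\<close> and \<open>fibre_y\<close> are
  its partial derivatives.
\<close>

definition fibre :: "complex \<Rightarrow> complex \<times> complex" where
  "fibre w = (Complex (cos (Re w) * cos (Im w)) (sin (Re w) * sin (Im w)),
              Complex (- (sin (Re w) * cos (Im w))) (cos (Re w) * sin (Im w)))"

definition fibre_x :: "complex \<Rightarrow> complex \<times> complex" where
  "fibre_x w = (Complex (- (sin (Re w) * cos (Im w))) (cos (Re w) * sin (Im w)),
              Complex (- (cos (Re w) * cos (Im w))) (- (sin (Re w) * sin (Im w))))"

definition fibre_y :: "complex \<Rightarrow> complex \<times> complex" where
  "fibre_y w = (Complex (- (cos (Re w) * sin (Im w))) (sin (Re w) * cos (Im w)),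
              Complex (sin (Re w) * sin (Im w)) (cos (Re w) * cos (Im w)))"

lemma first_col_lift: "first_col (lift z) = ((stereo z - 1) *\<^sub>R fibre (fst z), stereo z *\<^sub>R snd z)"
proof -
  have b: "boost z $ Inl None $ Inl None = of_real (stereo z - 1)" "boost z $ Inr None $ Inl None = 0"
    "(\<chi> k. boost z $ Inl (Some k) $ Inl None) = stereo z *\<^sub>R fst (snd z)"
    "(\<chi> k. boost z $ Inr (Some k) $ Inl None) = stereo z *\<^sub>R snd (snd z)"
    using first_col_boost[of z] by (simp_all add: first_col_def prod_eq_iff)
  have n: "norm (1 :: complex) = 1" "norm \<i> = 1" by simp_all
  show ?thesis
    unfolding first_col_def lift_def rot_mult_nth[OF n(1)] rot_mult_nth[OF n(2)] b
    by (simp add: prod_eq_iff fibre_def complex_eq_iff)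
qed

lemma fibre_has_derivative:
  "(fibre has_derivative (\<lambda>u. Re u *\<^sub>R fibre_x w + Im u *\<^sub>R fibre_y w)) (at w)"
proof -
  have f: "fibre = (\<lambda>w. (of_real (cos (Re w) * cos (Im w)) + \<i> * of_real (sin (Re w) * sin (Im w)),
      of_real (- (sin (Re w) * cos (Im w))) + \<i> * of_real (cos (Re w) * sin (Im w))))"
    by (rule ext) (simp add: fibre_def Complex_eq)
  show ?thesis unfolding f
    by (rule derivative_eq_intros refl)+
       (auto simp: fibre_x_def fibre_y_def complex_eq_iff fun_eq_iff prod_eq_iff algebra_simps)
qed

definition stereo_deriv :: "'n::finite coords \<Rightarrow> 'n coords \<Rightarrow> real" where
  "stereo_deriv z u = - ((stereo z)\<^sup>2 * (snd z \<bullet> snd u))"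

lemma stereo_has_derivative: "(stereo has_derivative stereo_deriv z) (at z)"
proof -
  have p: "1 + snd z \<bullet> snd z > 0" by (simp add: add_pos_nonneg)
  have c: "stereo = (\<lambda>z :: 'a coords. 2 / (1 + snd z \<bullet> snd z))"
    by (rule ext) (simp add: stereo_def power2_norm_eq_inner)
  have d: "stereo_deriv z = (\<lambda>u. - (4 * (snd z \<bullet> snd u)) / (1 + snd z \<bullet> snd z)\<^sup>2)"
    by (rule ext) (simp add: stereo_deriv_def stereo_def power2_norm_eq_inner power_divide)
  show ?thesis unfolding d unfolding c
    using p by (auto intro!: derivative_eq_intros simp: fun_eq_iff inner_commute power2_eq_square divide_simps)
qed

definition col_deriv :: "'n::finite coords \<Rightarrow> 'n coords \<Rightarrow> 'n column" where
  "col_deriv z u = (stereo_deriv z u *\<^sub>R fibre (fst z)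
       + (stereo z - 1) *\<^sub>R (Re (fst u) *\<^sub>R fibre_x (fst z) + Im (fst u) *\<^sub>R fibre_y (fst z)),
     stereo_deriv z u *\<^sub>R snd z + stereo z *\<^sub>R snd u)"

lemma first_col_lift_has_derivative:
  "((\<lambda>z. first_col (lift z)) has_derivative col_deriv z) (at z)"
proof -
  have "((\<lambda>z. fibre (fst z)) has_derivative
      (\<lambda>u. Re (fst u) *\<^sub>R fibre_x (fst z) + Im (fst u) *\<^sub>R fibre_y (fst z))) (at z)"
    by (rule has_derivative_compose[OF has_derivative_fst[OF has_derivative_ident] fibre_has_derivative])
  note F = has_derivative_scaleR[OF has_derivative_diff[OF stereo_has_derivative has_derivative_const] this]
    and H = has_derivative_scaleR[OF stereo_has_derivative has_derivative_snd[OF has_derivative_ident]]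
  show ?thesis unfolding first_col_lift
    using has_derivative_Pair[OF F[of 1] H] by (simp add: col_deriv_def[abs_def] add.commute)
qed

definition base_herm :: "'n::finite horizontal \<Rightarrow> 'n horizontal \<Rightarrow> complex" where
  "base_herm h k = (\<Sum>i\<in>UNIV. cnj (fst h $ i) * fst k $ i + cnj (snd h $ i) * snd k $ i)"

definition base_sympl :: "'n::finite horizontal \<Rightarrow> 'n horizontal \<Rightarrow> complex" where
  "base_sympl h k = (\<Sum>i\<in>UNIV. fst h $ i * snd k $ i - snd h $ i * fst k $ i)"

lemma bilinear_base_herm: "bilinear base_herm"
  by (auto simp: bilinear_def base_herm_def intro!: linearI)
     (simp_all add: algebra_simps sum.distrib scaleR_sum_right)

lemma bilinear_base_sympl: "bilinear base_sympl"
  by (auto simp: bilinear_def base_sympl_def intro!: linearI)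
     (simp_all add: algebra_simps sum.distrib sum_subtractf scaleR_sum_right scaleR_diff_right)

lemma base_sympl_commute: "base_sympl h k = - base_sympl k h"
  by (simp add: base_sympl_def sum_negf[symmetric] algebra_simps)

lemma Im_base_herm_self: "Im (base_herm h h) = 0"
  by (simp add: base_herm_def)

lemma fibre_inner:
  "fibre w \<bullet> fibre w = 1" "fibre w \<bullet> fibre_x w = 0" "fibre w \<bullet> fibre_y w = 0"
  "fibre_x w \<bullet> fibre_x w = 1" "fibre_x w \<bullet> fibre_y w = 0" "fibre_y w \<bullet> fibre_y w = 1"
  unfolding fibre_def fibre_x_def fibre_y_def inner_prod_def inner_complex_def fst_conv snd_conv complex.sel
  using sin_cos_squared_add2[of "Re w"] sin_cos_squared_add2[of "Im w"]
  by (algebra | simp add: algebra_simps; fail)+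

definition fibre_herm :: "complex \<times> complex \<Rightarrow> complex \<times> complex \<Rightarrow> complex" where
  "fibre_herm x y = cnj (fst x) * fst y + cnj (snd x) * snd y"

definition fibre_sympl :: "complex \<times> complex \<Rightarrow> complex \<times> complex \<Rightarrow> complex" where
  "fibre_sympl x y = fst x * snd y - snd x * fst y"

lemma bilinear_fibre_herm: "bilinear fibre_herm"
  by (auto simp: bilinear_def fibre_herm_def intro!: linearI)
     (simp_all add: algebra_simps)

lemma bilinear_fibre_sympl: "bilinear fibre_sympl"
  by (auto simp: bilinear_def fibre_sympl_def intro!: linearI)
     (simp_all add: algebra_simps)

lemma herm_fibre:
  "Im (fibre_herm (fibre w) (fibre w)) = 0" "Im (fibre_herm (fibre w) (fibre_x w)) = sin (2 * Im w)"
  "Im (fibre_herm (fibre w) (fibre_y w)) = 0"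
  and sympl_fibre:
  "fibre_sympl (fibre w) (fibre w) = 0" "fibre_sympl (fibre w) (fibre_x w) = - of_real (cos (2 * Im w))"
  "fibre_sympl (fibre w) (fibre_y w) = \<i>"
  unfolding fibre_herm_def fibre_sympl_def fibre_def fibre_x_def fibre_y_def sin_double cos_double complex_eq_iff
  using sin_cos_squared_add2[of "Re w"] sin_cos_squared_add2[of "Im w"]
  by (simp_all, algebra+)

lemma herm_eq: "herm v w = fibre_herm (fst v) (fst w) + base_herm (snd v) (snd w)"
  by (simp add: herm_def fibre_herm_def base_herm_def)

lemma sympl_eq: "sympl v w = fibre_sympl (fst v) (fst w) + base_sympl (snd v) (snd w)"
  by (simp add: sympl_def fibre_sympl_def base_sympl_def)

lemmas bilinear_expand = bilinear_ladd bilinear_radd bilinear_lmul bilinear_rmul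

text \<open>
  Up to the factor \<open>\<i>\<close> the \<open>U(1)\<close>-component of the Maurer-Cartan form.  It measures the motion along the
  complex line spanned by the first column, which is lost in the quotient.
\<close>

definition phase_form :: "'n::finite coords \<Rightarrow> 'n coords \<Rightarrow> real" where
  "phase_form z u = (stereo z - 1)\<^sup>2 * (Re (fst u) * sin (2 * Im (fst z)))
     + (stereo z)\<^sup>2 * Im (base_herm (snd z) (snd u))"

text \<open>
  The pullback of the holomorphic contact form \<open>sympl V dV\<close>, whose kernel is the horizontal distribution.
\<close>

definition contact_form :: "'n::finite coords \<Rightarrow> 'n coords \<Rightarrow> complex" where
  "contact_form z u = (stereo z - 1)\<^sup>2 *\<^sub>R Complex (- (Re (fst u) * cos (2 * Im (fst z)))) (Im (fst u))
     + (stereo z)\<^sup>2 *\<^sub>R base_sympl (snd z) (snd u)"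

text \<open>
  The column is a unit vector, and its stereographic part is conformal: after using
  \<open>stereo z * (1 + |snd z|\<^sup>2) = 2\<close> the mixed terms disappear.
\<close>

lemma inner_col_deriv:
  "first_col (lift z) \<bullet> col_deriv z u = 0"
  "col_deriv z u \<bullet> col_deriv z v = (stereo z - 1)\<^sup>2 * (fst u \<bullet> fst v) + (stereo z)\<^sup>2 * (snd u \<bullet> snd v)"
proof -
  let ?d = "stereo z" and ?r = "snd z \<bullet> snd z"
  have dr: "?d * (1 + ?r) = 2" using stereo_eq(1)[of z] by (simp add: power2_norm_eq_inner)
  note simps = inner_prod_def[of "(_, _)" "(_, _)"] inner_add_left inner_add_right fibre_inner
    inner_commute[of "fibre_x _" "fibre _"] inner_commute[of "fibre_y _" "fibre _"]
    inner_commute[of "fibre_y _" "fibre_x _"] inner_commute[of "snd u" "snd z"] inner_commute[of "snd v" "snd z"]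
  have "first_col (lift z) \<bullet> col_deriv z u
      = (?d - 1) * stereo_deriv z u + ?d * (stereo_deriv z u * ?r + ?d * (snd z \<bullet> snd u))"
    unfolding first_col_lift col_deriv_def by (simp add: simps distrib_left)
  also have "\<dots> = (2 - ?d * (1 + ?r)) * (?d\<^sup>2 * (snd z \<bullet> snd u))"
    unfolding stereo_deriv_def by (simp add: power2_eq_square algebra_simps)
  also have "\<dots> = 0" by (simp add: dr)
  finally show "first_col (lift z) \<bullet> col_deriv z u = 0" .
  have "col_deriv z u \<bullet> col_deriv z v = stereo_deriv z u * stereo_deriv z v
      + (?d - 1)\<^sup>2 * (Re (fst u) * Re (fst v) + Im (fst u) * Im (fst v))
      + stereo_deriv z u * stereo_deriv z v * ?r + stereo_deriv z u * ?d * (snd z \<bullet> snd v)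
      + stereo_deriv z v * ?d * (snd z \<bullet> snd u) + ?d\<^sup>2 * (snd u \<bullet> snd v)"
    unfolding col_deriv_def by (simp add: simps power2_eq_square algebra_simps)
  also have "\<dots> = (?d - 1)\<^sup>2 * (Re (fst u) * Re (fst v) + Im (fst u) * Im (fst v)) + ?d\<^sup>2 * (snd u \<bullet> snd v)
      + (?d * (1 + ?r) - 2) * (?d ^ 3 * ((snd z \<bullet> snd u) * (snd z \<bullet> snd v)))"
    unfolding stereo_deriv_def by (simp add: power2_eq_square power3_eq_cube algebra_simps)
  also have "\<dots> = (?d - 1)\<^sup>2 * (Re (fst u) * Re (fst v) + Im (fst u) * Im (fst v)) + ?d\<^sup>2 * (snd u \<bullet> snd v)"
    by (simp add: dr)
  finally show "col_deriv z u \<bullet> col_deriv z v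
      = (stereo z - 1)\<^sup>2 * (fst u \<bullet> fst v) + (stereo z)\<^sup>2 * (snd u \<bullet> snd v)"
    by (simp add: inner_complex_def)
qed

lemma herm_col_deriv: "herm (first_col (lift z)) (col_deriv z u) = \<i> * of_real (phase_form z u)"
proof -
  have "Re (herm (first_col (lift z)) (col_deriv z u)) = 0"
    by (simp add: Re_herm inner_col_deriv)
  moreover define c where "c = stereo z - 1"
  have "Im (herm (first_col (lift z)) (col_deriv z u)) = phase_form z u"
    unfolding phase_form_def c_def[symmetric] herm_eq first_col_lift col_deriv_def fst_conv snd_conv c_def[symmetric]
    by (simp add: bilinear_expand[OF bilinear_fibre_herm] bilinear_expand[OF bilinear_base_herm]
        herm_fibre Im_base_herm_self power2_eq_square algebra_simps)
  ultimately show ?thesis by (simp add: complex_eq_iff)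
qed

lemma sympl_col_deriv: "sympl (first_col (lift z)) (col_deriv z u) = contact_form z u"
proof -
  have "base_sympl h h = 0" for h :: "'a horizontal"
    using base_sympl_commute[of h h] by simp
  moreover define c where "c = stereo z - 1"
  ultimately show ?thesis
    unfolding contact_form_def sympl_eq first_col_lift col_deriv_def fst_conv snd_conv c_def[symmetric]
    by (simp add: bilinear_expand[OF bilinear_fibre_sympl] bilinear_expand[OF bilinear_base_sympl]
        sympl_fibre power2_eq_square complex_eq_iff algebra_simps)
qed

definition lift_metric :: "(component \<Rightarrow> real) \<Rightarrow> 'n::finite coords coord_metric" where
  "lift_metric lam z u v = (2 * real CARD('n) + 4) *
    (4 * lam M1 * ((stereo z - 1)\<^sup>2 * (fst u \<bullet> fst v) + (stereo z)\<^sup>2 * (snd u \<bullet> snd v) - phase_form z u * phase_form z v)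
     + (2 * lam M2 - 4 * lam M1) * (contact_form z u \<bullet> contact_form z v))"

lemma chart_metric_lift:
  "chart_metric lam (lift :: 'n coords \<Rightarrow> 'n::{finite,linorder} cmat) = lift_metric lam"
proof (intro ext)
  fix z u v :: "'n coords"
  have i: "(\<i> * of_real a) \<bullet> (\<i> * of_real b) = a * b" for a b :: real
    by (simp add: inner_complex_def)
  show "chart_metric lam lift z u v = lift_metric lam z u v"
    unfolding chart_metric_eq_column[OF smooth_lift lift_in_Sp first_col_lift_has_derivative]
      inner_col_deriv herm_col_deriv sympl_col_deriv i lift_metric_def ..
qed

section \<open>Charts around the points of the curve\<close>

lemma linear_phase_form: "linear (phase_form z)"
  by (rule linearI)
     (simp_all add: phase_form_def bilinear_expand[OF bilinear_base_herm] algebra_simps)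

lemma linear_contact_form: "linear (contact_form z)"
  by (rule linearI)
     (simp_all add: contact_form_def bilinear_expand[OF bilinear_base_sympl] complex_eq_iff algebra_simps)

lemma lift_metric_commute: "lift_metric lam z u v = lift_metric lam z v u"
  by (simp add: lift_metric_def inner_commute mult.commute)

lemma bilinear_lift_metric: "bilinear (lift_metric lam z)"
proof -
  have "linear (lift_metric lam z u)" for u :: "'a coords"
    unfolding lift_metric_def
    by (rule linearI)
       (simp_all add: linear_add[OF linear_phase_form] linear_cmul[OF linear_phase_form]
        linear_add[OF linear_contact_form] linear_cmul[OF linear_contact_form] inner_add_right algebra_simps)
  moreover have "(\<lambda>u. lift_metric lam z u v) = lift_metric lam z v" for v :: "'a coords"
    by (rule ext) (rule lift_metric_commute)
  ultimately show ?thesis by (simp add: bilinear_def)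
qed

lemma lift_metric_shift: "lift_metric lam (z + s *\<^sub>R (of_real m, 0)) u v = lift_metric lam z u v"
  by (simp add: lift_metric_def phase_form_def contact_form_def stereo_def)

lemma smooth_lift_metric: "smooth_fun (\<lambda>z. lift_metric lam z u v)"
proof -
  have "linear (\<lambda>z :: 'a coords. Im (fst z))" by (rule linearI) auto
  note Imz = smooth_fun_linear[OF this]
  have "linear (\<lambda>z :: 'a coords. Im (base_herm (snd z) k))" "linear (\<lambda>z :: 'a coords. base_sympl (snd z) k)" for k
    by (rule linearI; simp add: bilinear_expand[OF bilinear_base_herm] bilinear_expand[OF bilinear_base_sympl])+
  note base = this[THEN smooth_fun_linear]
  have phase_form: "smooth_fun (\<lambda>z. phase_form z u)" for u :: "'a coords" unfolding phase_form_def
    by (intro smooth_fun_add smooth_fun_mult smooth_fun_power smooth_fun_diff smooth_fun_sin smooth_fun_const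
        smooth_stereo Imz base)
  have Cplx: "Complex a b = a *\<^sub>R 1 + Complex 0 b" for a b
    by (simp add: complex_eq_iff)
  have contact_form: "smooth_fun (\<lambda>z. contact_form z u)" for u :: "'a coords" unfolding contact_form_def
    by (subst Cplx) (intro smooth_fun_add smooth_fun_mult smooth_fun_power smooth_fun_diff smooth_fun_cos smooth_fun_const
        smooth_fun_scaleR smooth_fun_minus smooth_stereo Imz base)
  show ?thesis unfolding lift_metric_def
    by (intro smooth_fun_add smooth_fun_mult smooth_fun_power smooth_fun_diff smooth_fun_const
        smooth_fun_inner smooth_stereo phase_form contact_form)
qed

text \<open>
  A quantitative form of the inverse function theorem: if \<open>g\<close> is a left inverse of the derivative at \<open>a\<close>, the nearby
  derivatives stay injective as long as their distance to the one at \<open>a\<close> is less than \<open>1 / |g|\<close>.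
\<close>

lemma smooth_fun_locally_immersive:
  fixes f :: "'a::euclidean_space \<Rightarrow> 'b::euclidean_space"
  assumes f: "smooth_fun f" and inj: "\<And>u. frechet_derivative f (at a) u = 0 \<Longrightarrow> u = 0"
  obtains r where "r > 0" "inj_on f (ball a r)"
    "\<And>x u. x \<in> ball a r \<Longrightarrow> frechet_derivative f (at x) u = 0 \<Longrightarrow> u = 0"
proof -
  let ?D = "\<lambda>x. frechet_derivative f (at x)"
  have lin: "linear (?D x)" for x by (rule smooth_fun_linear_derivative[OF f])
  have "inj (?D a)" using inj linear_injective_0[OF lin] by blast
  then obtain g where g: "linear g" "g \<circ> ?D a = id"
    using linear_injective_left_inverse[OF lin] by blast
  have bg: "bounded_linear g" using g(1) by (simp add: linear_conv_bounded_linear)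
  define \<epsilon> where "\<epsilon> x = (\<Sum>b\<in>Basis. norm (?D x b - ?D a b))" for x
  have est: "norm (?D x v - ?D a v) \<le> \<epsilon> x * norm v" for x v
  proof -
    have l: "linear (\<lambda>v. ?D x v - ?D a v)" by (rule linear_compose_sub[OF lin lin])
    have "?D x v - ?D a v = (\<Sum>b\<in>Basis. (v \<bullet> b) *\<^sub>R (?D x b - ?D a b))"
    proof -
      have "?D x v - ?D a v = (\<lambda>v. ?D x v - ?D a v) (\<Sum>b\<in>Basis. (v \<bullet> b) *\<^sub>R b)"
        by (simp add: euclidean_representation)
      also have "\<dots> = (\<Sum>b\<in>Basis. (v \<bullet> b) *\<^sub>R (?D x b - ?D a b))"
        by (simp only: linear_sum[OF l] linear_cmul[OF l])
      finally show ?thesis .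
    qed
    also have "norm \<dots> \<le> (\<Sum>b\<in>Basis. norm v * norm (?D x b - ?D a b))"
      by (rule sum_norm_le) (simp add: Basis_le_norm mult_right_mono)
    finally show ?thesis by (simp add: \<epsilon>_def sum_distrib_left mult.commute)
  qed
  have "isCont \<epsilon> a" unfolding \<epsilon>_def
    by (intro continuous_sum continuous_norm differentiable_imp_continuous_within
        smooth_fun_differentiable smooth_fun_diff smooth_fun_frechet_derivative f smooth_fun_const)
  then have near: "\<exists>d>0. \<forall>x. dist a x < d \<longrightarrow> \<epsilon> x < e" if "e > 0" for e
    using that unfolding continuous_at_eps_delta
    by (simp add: \<epsilon>_def dist_norm norm_minus_commute sum_nonneg)
  have on: "onorm (\<lambda>v. ?D x v - ?D a v) \<le> \<epsilon> x" for x
    by (rule onorm_bound[OF _ est]) (simp add: \<epsilon>_def sum_nonneg)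
  obtain r1 where r1: "r1 > 0" "inj_on f (ball a r1)"
  proof (rule has_derivative_locally_injective[of a UNIV g ?D f])
    show "\<exists>d>0. \<forall>x. dist a x < d \<longrightarrow> onorm (\<lambda>v. ?D x v - ?D a v) < e" if "e > 0" for e
      using near[OF that] on by (meson le_less_trans)
  qed (use g bg smooth_fun_has_derivative[OF f] in auto)
  obtain K where K: "K > 0" "\<And>v. norm (g v) \<le> norm v * K"
    using bounded_linear.pos_bounded[OF bg] by blast
  obtain r2 where r2: "r2 > 0" "\<And>x. dist a x < r2 \<Longrightarrow> \<epsilon> x < 1 / K"
    using near[of "1 / K"] K(1) by auto
  show thesis
  proof (rule that[of "min r1 r2"])
    show "min r1 r2 > 0" "inj_on f (ball a (min r1 r2))"
      using r1 r2 by (auto intro: inj_on_subset)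
    fix x u assume x: "x \<in> ball a (min r1 r2)" and z: "?D x u = 0"
    show "u = 0"
    proof (rule ccontr)
      assume "u \<noteq> 0"
      have "u = - g (?D x u - ?D a u)"
        using g z by (simp add: linear_neg[OF g(1)] fun_eq_iff)
      then have "norm u = norm (g (?D x u - ?D a u))" by (metis norm_minus_cancel)
      also have "\<dots> \<le> (\<epsilon> x * norm u) * K"
        using K(2)[of "?D x u - ?D a u"] mult_right_mono[OF est[of x u], of K] K(1) by linarith
      also have "\<dots> < (1 / K * norm u) * K"
        using r2(2)[of x] x \<open>u \<noteq> 0\<close> K(1) by (intro mult_strict_right_mono) auto
      finally show False using K(1) by simp
    qed
  qed
qed

text \<open>
  The orthogonal projector onto the complex line spanned by the first column.  It depends only on the coset, so
  its injectivity on a set of parameters gives that of the parametrization of the quotient.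
\<close>

definition line_proj :: "('n coords \<Rightarrow> 'n cmat) \<Rightarrow> 'n coords \<Rightarrow> 'n::finite cmat" where
  "line_proj \<sigma> z = (\<sigma> z ** elem_mat (Inl None) (Inl None)) ** conj_transpose (\<sigma> z)"

lemma smooth_line_proj:
  "smooth_fun \<sigma> \<Longrightarrow> smooth_fun (line_proj \<sigma>)"
  unfolding line_proj_def[abs_def]
  by (intro smooth_fun_bounded_bilinear[OF bounded_bilinear_matrix_mult] smooth_fun_const
      smooth_fun_bounded_linear[OF bounded_linear_conj_transpose])

lemma line_proj_coset:
  assumes "coset (\<sigma> z) = coset (\<sigma> z')"
  shows "line_proj \<sigma> z = line_proj \<sigma> z'"
proof -
  let ?E = "elem_mat (Inl None) (Inl None)"
  have "\<sigma> z \<in> coset (\<sigma> z)" unfolding in_coset using isotropy_group_one matrix_mul_rid by metis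
  then obtain h where h: "h \<in> isotropy_group" and s: "\<sigma> z = \<sigma> z' ** h"
    unfolding assms in_coset by blast
  have hs: "h \<in> Sp" and h0: "\<And>p. p \<noteq> Inl None \<Longrightarrow> h $ p $ Inl None = 0"
    using h by (auto simp: isotropy_group_def)
  have "(conj_transpose h ** h) $ Inl None $ Inl None = cnj (h $ Inl None $ Inl None) * h $ Inl None $ Inl None"
    by (simp add: matrix_mult_nth conj_transpose_nth sum_index sum_option h0)
  then have one: "h $ Inl None $ Inl None * cnj (h $ Inl None $ Inl None) = 1"
    unfolding SpD(1)[OF hs] by (simp add: mat_def mult.commute)
  have "h ** ?E ** conj_transpose h = ?E"
    unfolding vec_eq_iff
  proof (intro allI)
    fix i j
    show "(h ** ?E ** conj_transpose h) $ i $ j = ?E $ i $ j"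
      using one h0[of i] h0[of j]
      by (cases "i = Inl None"; cases "j = Inl None") (simp_all add: mult_elem_mult_nth conj_transpose_nth elem_mat_nth)
  qed
  moreover have "line_proj \<sigma> z = \<sigma> z' ** (h ** ?E ** conj_transpose h) ** conj_transpose (\<sigma> z')"
    unfolding line_proj_def s by (simp only: conj_transpose_mult matrix_mul_assoc)
  ultimately show ?thesis by (simp add: line_proj_def)
qed

text \<open>
  The derivative is the conjugate by \<open>\<sigma> z\<close> of the commutator of the Maurer-Cartan form \<open>W\<close> with the elementary matrix
  \<open>E\<close> at position \<open>(1,1)\<close>, and \<open>[W, E] = 0\<close> says that the first row of \<open>W\<close> vanishes off the diagonal.
\<close>

lemma line_proj_derivative_zero_iff:
  fixes \<sigma> :: "'n::finite coords \<Rightarrow> 'n cmat"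
  assumes s: "smooth_fun \<sigma>" and Sp: "\<And>z. \<sigma> z \<in> Sp"
  shows "frechet_derivative (line_proj \<sigma>) (at z) u = 0 \<longleftrightarrow> row_coords (maurer_cartan \<sigma> z u) = 0"
proof -
  let ?E = "elem_mat (Inl None) (Inl None) :: 'n cmat" and ?W = "maurer_cartan \<sigma> z u" and ?D = "frechet_derivative \<sigma> (at z)"
  have D: "(\<sigma> has_derivative ?D) (at z)" by (rule smooth_fun_has_derivative[OF s])
  note W = maurer_cartan_in_sp[OF s Sp, of z u]
  have Du: "?D u = \<sigma> z ** ?W"
    unfolding maurer_cartan_def by (simp add: matrix_mul_assoc SpD(2)[OF Sp])
  have "(line_proj \<sigma> has_derivative (\<lambda>u. (\<sigma> z ** ?E) ** conj_transpose (?D u)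
      + (\<sigma> z ** 0 + ?D u ** ?E) ** conj_transpose (\<sigma> z))) (at z)"
    unfolding line_proj_def[abs_def]
    by (intro mm.FDERIV D has_derivative_const bounded_linear.has_derivative[OF bounded_linear_conj_transpose])
  from fun_cong[OF frechet_derivative_at[OF this], of u]
  have "frechet_derivative (line_proj \<sigma>) (at z) u = (\<sigma> z ** ?E) ** conj_transpose (?D u)
      + (?D u ** ?E) ** conj_transpose (\<sigma> z)" by (simp add: mm.zero_right)
  also have "\<dots> = \<sigma> z ** (?W ** ?E - ?E ** ?W) ** conj_transpose (\<sigma> z)"
    unfolding Du conj_transpose_mult sp_transpose_symp(3)[OF W] mult_simps matrix_mul_assoc by simp
  finally have 1: "frechet_derivative (line_proj \<sigma>) (at z) u = \<sigma> z ** (?W ** ?E - ?E ** ?W) ** conj_transpose (\<sigma> z)" .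
  have canc: "\<sigma> z ** M ** conj_transpose (\<sigma> z) = 0 \<longleftrightarrow> M = 0" for M
  proof
    assume "\<sigma> z ** M ** conj_transpose (\<sigma> z) = 0"
    then have "conj_transpose (\<sigma> z) ** (\<sigma> z ** M ** conj_transpose (\<sigma> z)) ** \<sigma> z = 0"
      by (simp add: mm.zero_left mm.zero_right)
    moreover have "conj_transpose (\<sigma> z) ** (\<sigma> z ** M ** conj_transpose (\<sigma> z)) ** \<sigma> z
       = (conj_transpose (\<sigma> z) ** \<sigma> z) ** M ** (conj_transpose (\<sigma> z) ** \<sigma> z)"
      by (simp only: matrix_mul_assoc)
    ultimately show "M = 0" by (simp add: SpD(1)[OF Sp])
  qed (simp add: mm.zero_left mm.zero_right)
  have ent: "(?W ** ?E - ?E ** ?W) $ i $ j = (if j = Inl None then ?W $ i $ Inl None else 0)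
      - (if i = Inl None then ?W $ Inl None $ j else 0)" for i j
  proof -
    have "(?W ** ?E) $ i $ j = ?W $ i $ Inl None * (mat 1 :: 'n cmat) $ Inl None $ j"
      using mult_elem_mult_nth[of ?W "Inl None" "Inl None" "mat 1" i j] by (simp only: matrix_mul_rid)
    moreover have "(?E ** ?W) $ i $ j = (mat 1 :: 'n cmat) $ i $ Inl None * ?W $ Inl None $ j"
      using mult_elem_mult_nth[of "mat 1" "Inl None" "Inl None" ?W i j] by (simp only: matrix_mul_lid)
    ultimately show ?thesis by (auto simp: mat_def)
  qed
  have row: "row_coords ?W = 0 \<longleftrightarrow> (\<forall>j. j \<noteq> Inl None \<longrightarrow> ?W $ Inl None $ j = 0)"
  proof
    assume r: "row_coords ?W = 0"
    show "\<forall>j. j \<noteq> Inl None \<longrightarrow> ?W $ Inl None $ j = 0"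
    proof (intro allI impI)
      fix j :: "'n index" assume "j \<noteq> Inl None"
      then show "?W $ Inl None $ j = 0"
        using r by (cases j rule: index_cases) (simp_all add: row_coords_def vec_eq_iff zero_prod_def)
    qed
  qed (simp add: row_coords_def vec_eq_iff zero_prod_def)
  have "?W ** ?E - ?E ** ?W = 0 \<longleftrightarrow> row_coords ?W = 0"
  proof
    assume z: "?W ** ?E - ?E ** ?W = 0"
    show "row_coords ?W = 0" unfolding row
    proof (intro allI impI)
      fix j :: "'n index" assume "j \<noteq> Inl None"
      then show "?W $ Inl None $ j = 0" using ent[of "Inl None" j] unfolding z by simp
    qed
  next
    assume r: "row_coords ?W = 0"
    have "(?W ** ?E - ?E ** ?W) $ i $ j = 0" for i j
      unfolding ent using r[unfolded row] sp_algebraD(1)[OF W, of i "Inl None"] by auto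
    then show "?W ** ?E - ?E ** ?W = 0" by (simp add: vec_eq_iff)
  qed
  then show ?thesis unfolding 1 canc .
qed

lemma lift_metric_axis:
  fixes u v :: "'n::finite coords"
  shows "lift_metric lam (of_real s, 0) u v = (2 * real CARD('n) + 4) * (2 * lam M2 * (fst u \<bullet> fst v) + 16 * lam M1 * (snd u \<bullet> snd v))"
proof -
  have 0: "base_herm 0 h = 0" "base_sympl 0 h = 0" for h :: "'n horizontal"
    by (simp_all add: base_herm_def base_sympl_def)
  show ?thesis
    by (simp add: lift_metric_def phase_form_def contact_form_def stereo_def 0 inner_complex_def algebra_simps)
qed

text \<open>
  On the axis the metric is visibly definite, so the derivative of \<open>line_proj\<close> is injective there.  This property is open,
  and on a small ball it gives at once the injectivity of the parametrization, the bijectivity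
  of its differential and the definiteness of all invariant metrics.
\<close>

lemma chart_lift:
  obtains r where "r > 0" "chart (ball (of_real s, 0) r) (lift :: 'n coords \<Rightarrow> 'n::{finite,linorder} cmat)"
    "\<And>lam z (u :: 'n coords). invariant_metric lam \<Longrightarrow> z \<in> ball (of_real s, 0) r \<Longrightarrow> u \<noteq> 0 \<Longrightarrow> lift_metric lam z u u > 0"
proof -
  let ?L = "lift :: 'n coords \<Rightarrow> 'n cmat"
  have row0: "frechet_derivative (line_proj ?L) (at z) u = 0 \<longleftrightarrow> row_coords (maurer_cartan ?L z u) = 0" for z u
    by (rule line_proj_derivative_zero_iff[OF smooth_lift lift_in_Sp])
  have met: "lift_metric lam z u v = (2 * real CARD('n) + 4) *
    (4 * lam M1 * (snd (row_coords (maurer_cartan ?L z u)) \<bullet> snd (row_coords (maurer_cartan ?L z v)))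
     + 2 * lam M2 * (fst (row_coords (maurer_cartan ?L z u)) \<bullet> fst (row_coords (maurer_cartan ?L z v))))" for lam z u v
    unfolding chart_metric_lift[symmetric] by (rule chart_metric_eq_row[OF smooth_lift lift_in_Sp])
  have n: "2 * real CARD('n) + 4 > 0" by (simp add: add_nonneg_pos)
  have "u = 0" if "frechet_derivative (line_proj ?L) (at (of_real s, 0)) u = 0" for u
  proof -
    have "lift_metric normal_metric (of_real s, 0) u u = 0"
      unfolding met using that unfolding row0 by simp
    then have "2 * (norm (fst u))\<^sup>2 + 16 * (norm (snd u))\<^sup>2 = 0"
      using n unfolding lift_metric_axis by (simp add: normal_metric_def power2_norm_eq_inner)
    moreover have "0 \<le> (norm (fst u))\<^sup>2" "0 \<le> (norm (snd u))\<^sup>2" by simp_all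
    ultimately have "(norm (fst u))\<^sup>2 = 0" "(norm (snd u))\<^sup>2 = 0" by linarith+
    then show ?thesis by (simp add: prod_eq_iff)
  qed
  then obtain r where r: "r > 0" "inj_on (line_proj ?L) (ball (of_real s, 0) r)"
    "\<And>x u. x \<in> ball (of_real s, 0) r \<Longrightarrow> frechet_derivative (line_proj ?L) (at x) u = 0 \<Longrightarrow> u = 0"
    using smooth_fun_locally_immersive[OF smooth_line_proj[OF smooth_lift], of "(of_real s, 0)"] by blast
  show thesis
  proof (rule that[OF r(1)])
    show "lift_metric lam z u u > 0" if lam: "invariant_metric lam" and z: "z \<in> ball (of_real s, 0) r" and u: "u \<noteq> 0"
      for lam z and u :: "'n coords"
    proof -
      have pos: "lam M1 > 0" "lam M2 > 0" using lam by (auto simp: invariant_metric_def)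
      let ?R = "row_coords (maurer_cartan ?L z u)"
      have "?R \<noteq> 0" using r(3)[OF z, of u] u row0 by blast
      then have "fst ?R \<noteq> 0 \<or> snd ?R \<noteq> 0" by (simp add: prod_eq_iff)
      then have "0 < snd ?R \<bullet> snd ?R \<or> 0 < fst ?R \<bullet> fst ?R" by (simp only: inner_gt_zero_iff) blast
      moreover have "0 \<le> snd ?R \<bullet> snd ?R" "0 \<le> fst ?R \<bullet> fst ?R" by simp_all
      moreover have "4 * lam M1 * x + 2 * lam M2 * y > 0" if "0 < x \<or> 0 < y" "0 \<le> x" "0 \<le> y" for x y :: real
      proof -
        have "0 \<le> 4 * lam M1 * x" "0 \<le> 2 * lam M2 * y" using that(2,3) pos by simp_all
        moreover have "0 < 4 * lam M1 * x \<or> 0 < 2 * lam M2 * y" using that(1) pos by auto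
        ultimately show ?thesis by linarith
      qed
      ultimately have "4 * lam M1 * (snd ?R \<bullet> snd ?R) + 2 * lam M2 * (fst ?R \<bullet> fst ?R) > 0"
        by blast
      then show ?thesis unfolding met using n by (simp only: mult_pos_pos)
    qed
    show "chart (ball (of_real s, 0) r) ?L"
      unfolding chart_def
    proof (intro conjI ballI)
      show "smooth_on ?L (ball (of_real s, 0) r)"
        by (rule smooth_fun_imp_smooth_on[OF smooth_lift open_ball])
      show "?L ` ball (of_real s, 0) r \<subseteq> Sp" using lift_in_Sp by blast
      show "inj_on (\<lambda>z. coset (?L z)) (ball (of_real s, 0) r)"
        using r(2) line_proj_coset unfolding inj_on_def by blast
      fix z :: "'n coords" assume z: "z \<in> ball (of_real s, 0) r"
      define R where "R u = row_coords (maurer_cartan ?L z u)" for u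
      have lR: "linear R" unfolding R_def
        using linear_compose[OF linear_maurer_cartan[OF smooth_lift] linear_row_coords] by (simp add: o_def)
      have "inj R" using r(3)[OF z] row0 unfolding linear_injective_0[OF lR] R_def by blast
      then have bR: "bij R" using linear_injective_imp_surjective[OF lR] by (simp add: bij_def)
      have iT: "inj (tangent_mat :: 'n coords \<Rightarrow> 'n cmat)"
        by (metis injI row_coords_tangent_mat)
      have iA: "inj (Ad (?L z))"
        by (metis injI Ad_inverse(1) lift_in_Sp)
      have cd: "chart_deriv ?L z = (\<lambda>u. Ad (?L z) (tangent_mat (R u)))"
        unfolding R_def using chart_deriv_eq[OF smooth_lift lift_in_Sp] by blast
      show "bij_betw (chart_deriv ?L z) UNIV (tangent (coset (?L z)))"
        unfolding bij_betw_def cd tangent_coset[OF lift_in_Sp] tangent_o_eq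
      proof
        show "inj (\<lambda>u. Ad (?L z) (tangent_mat (R u)))"
          using inj_compose[OF iA inj_compose[OF iT bij_is_inj[OF bR]]] by (simp only: o_def)
        show "range (\<lambda>u. Ad (?L z) (tangent_mat (R u))) = Ad (?L z) ` range tangent_mat"
        proof -
          have "Ad (?L z) ` range tangent_mat = Ad (?L z) ` tangent_mat ` range R"
            using bij_is_surj[OF bR] by simp
          then show ?thesis by (simp only: image_image)
        qed
      qed
    qed
  qed
qed

section \<open>Derivatives of the metric along the curve\<close>

lemma smooth_fun_directional_derivative:
  fixes f :: "'a::euclidean_space \<Rightarrow> real"
  assumes "smooth_fun f"
  shows "((\<lambda>s. f (x + s *\<^sub>R a)) has_real_derivative frechet_derivative f (at x) a) (at 0)"
proof -
  have "((\<lambda>s::real. x + s *\<^sub>R a) has_derivative (\<lambda>s. s *\<^sub>R a)) (at 0)"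
    by (auto intro!: derivative_eq_intros)
  from has_derivative_compose[OF this, of f "frechet_derivative f (at x)"]
  have "((\<lambda>s. f (x + s *\<^sub>R a)) has_derivative (\<lambda>s. frechet_derivative f (at x) (s *\<^sub>R a))) (at 0)"
    using smooth_fun_has_derivative[OF assms, of x] by simp
  then show ?thesis
    by (simp add: has_field_derivative_def linear_cmul[OF smooth_fun_linear_derivative[OF assms]]
        mult_commute_abs)
qed

lemma even_derivative_zero:
  fixes F :: "real \<Rightarrow> real"
  assumes "(F has_real_derivative d) (at 0)" and "\<And>s. F (- s) = F s" shows "d = 0"
proof -
  have "(F has_real_derivative d) (at (- 0))" using assms(1) by simp
  then have "((\<lambda>s. F (- s)) has_real_derivative - d) (at 0)"
    by (simp only: DERIV_mirror)
  moreover have "(\<lambda>s. F (- s)) = F" using assms(2) by (rule ext)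
  ultimately have "(F has_real_derivative - d) (at 0)" by simp
  then have "d = - d" by (rule DERIV_unique[OF assms(1)])
  then show ?thesis by simp
qed

text \<open>
  The coefficient \<open>G\<^sub>z(e,e)\<close> is even in \<open>(Im (fst z), snd z)\<close>.
\<close>

lemma lift_metric_critical:
  fixes a :: "'n::finite coords"
  shows "frechet_derivative (\<lambda>z. lift_metric lam z (of_real m, 0) (of_real m, 0)) (at (of_real \<tau>, 0)) a = 0"
proof (rule even_derivative_zero[OF smooth_fun_directional_derivative[OF smooth_lift_metric]])
  fix s :: real
  have c: "stereo ((of_real \<tau>, 0) + - s *\<^sub>R a) = stereo ((of_real \<tau>, 0) + s *\<^sub>R a)"
    by (simp add: stereo_def)
  show "lift_metric lam ((of_real \<tau>, 0) + - s *\<^sub>R a) (of_real m, 0) (of_real m, 0)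
    = lift_metric lam ((of_real \<tau>, 0) + s *\<^sub>R a) (of_real m, 0) (of_real m, 0)"
    unfolding lift_metric_def phase_form_def contact_form_def c
    by (simp add: bilinear_rzero[OF bilinear_base_herm] bilinear_rzero[OF bilinear_base_sympl])
qed

lemma even_stereo_derivative:
  "((\<lambda>s. 2 / (1 + s\<^sup>2 * A) :: real) has_real_derivative 0) (at 0)"
  by (auto intro!: derivative_eq_intros)

lemma stereo_line: "stereo ((of_real \<tau>, 0) + s *\<^sub>R z) = 2 / (1 + s\<^sup>2 * (norm (snd z))\<^sup>2)"
  by (simp add: stereo_def power_mult_distrib)

text \<open>
  Along a horizontal line the function \<open>stereo\<close> is even, so the only contribution comes from the term of
  the contact form that is linear in the parameter.
\<close>

lemma lift_metric_derivative_horizontal: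
  fixes z :: "'n::finite coords"
  shows "frechet_derivative (\<lambda>x. lift_metric lam x (of_real m, 0) z) (at (of_real \<tau>, 0)) (0, k)
    = (2 * real CARD('n) + 4) * (4 * m * (4 * lam M1 - 2 * lam M2) * Re (base_sympl k (snd z)))"
proof -
  define D :: "real \<Rightarrow> real" where "D s = 2 / (1 + s\<^sup>2 * (norm k)\<^sup>2)" for s
  have D: "(D has_real_derivative 0) (at 0)" and D0: "D 0 = 2"
    unfolding D_def using even_stereo_derivative by auto
  have eq: "lift_metric lam ((of_real \<tau>, 0) + s *\<^sub>R (0, k)) (of_real m, 0) z = (2 * real CARD('n) + 4) *
      (4 * lam M1 * ((D s - 1)\<^sup>2 * (m * Re (fst z)))
       + (2 * lam M2 - 4 * lam M1) * ((D s - 1)\<^sup>2 * (- m) *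
           ((D s - 1)\<^sup>2 * (- Re (fst z)) + (D s)\<^sup>2 * (s * Re (base_sympl k (snd z))))))" for s
    unfolding lift_metric_def phase_form_def contact_form_def stereo_line
    by (simp add: D_def[symmetric] bilinear_expand[OF bilinear_base_herm] bilinear_expand[OF bilinear_base_sympl]
        bilinear_rzero[OF bilinear_base_herm] bilinear_rzero[OF bilinear_base_sympl] inner_complex_def)
  have "((\<lambda>s. (2 * real CARD('n) + 4) *
      (4 * lam M1 * ((D s - 1)\<^sup>2 * (m * Re (fst z)))
       + (2 * lam M2 - 4 * lam M1) * ((D s - 1)\<^sup>2 * (- m) *
           ((D s - 1)\<^sup>2 * (- Re (fst z)) + (D s)\<^sup>2 * (s * Re (base_sympl k (snd z)))))))
      has_real_derivative frechet_derivative (\<lambda>x. lift_metric lam x (of_real m, 0) z) (at (of_real \<tau>, 0)) (0, k)) (at 0)"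
    using smooth_fun_directional_derivative[OF smooth_lift_metric[where lam = lam and u = "(of_real m, 0)" and v = z],
        of "(of_real \<tau>, 0)" "(0, k)"] unfolding eq .
  moreover have "((\<lambda>s. (2 * real CARD('n) + 4) *
      (4 * lam M1 * ((D s - 1)\<^sup>2 * (m * Re (fst z)))
       + (2 * lam M2 - 4 * lam M1) * ((D s - 1)\<^sup>2 * (- m) *
           ((D s - 1)\<^sup>2 * (- Re (fst z)) + (D s)\<^sup>2 * (s * Re (base_sympl k (snd z)))))))
      has_real_derivative (2 * real CARD('n) + 4) * (4 * m * (4 * lam M1 - 2 * lam M2) * Re (base_sympl k (snd z)))) (at 0)"
    by (rule derivative_eq_intros D refl)+ (simp add: D0 algebra_simps)
  ultimately show ?thesis by (rule DERIV_unique)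
qed

lemma lift_metric_derivative_mixed:
  fixes z :: "'n::finite coords"
  shows "frechet_derivative (\<lambda>x. lift_metric lam x (of_real m, 0) (0, k)) (at (of_real \<tau>, 0)) z
    = (2 * real CARD('n) + 4) * (4 * m * (4 * lam M1 - 2 * lam M2) * Re (base_sympl (snd z) k))"
proof -
  define D :: "real \<Rightarrow> real" where "D s = 2 / (1 + s\<^sup>2 * (norm (snd z))\<^sup>2)" for s
  have D: "(D has_real_derivative 0) (at 0)" and D0: "D 0 = 2"
    unfolding D_def using even_stereo_derivative by auto
  define F where "F s = (2 * real CARD('n) + 4) *
      (4 * lam M1 * (- ((D s - 1)\<^sup>2 * (m * sin (2 * (s * Im (fst z)))) * ((D s)\<^sup>2 * (s * Im (base_herm (snd z) k)))))
       + (2 * lam M2 - 4 * lam M1) * ((D s - 1)\<^sup>2 * (- (m * cos (2 * (s * Im (fst z))))) *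
           ((D s)\<^sup>2 * (s * Re (base_sympl (snd z) k)))))" for s
  have eq: "lift_metric lam ((of_real \<tau>, 0) + s *\<^sub>R z) (of_real m, 0) (0, k) = F s" for s
    unfolding lift_metric_def phase_form_def contact_form_def stereo_line F_def
    by (simp add: D_def[symmetric] bilinear_expand[OF bilinear_base_herm] bilinear_expand[OF bilinear_base_sympl]
        bilinear_rzero[OF bilinear_base_herm] bilinear_rzero[OF bilinear_base_sympl] inner_complex_def)
  have "(F has_real_derivative frechet_derivative (\<lambda>x. lift_metric lam x (of_real m, 0) (0, k)) (at (of_real \<tau>, 0)) z) (at 0)"
    using smooth_fun_directional_derivative[OF smooth_lift_metric[where lam = lam and u = "(of_real m, 0)" and v = "(0, k)"],
        of "(of_real \<tau>, 0)" z] unfolding eq .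
  moreover have "(F has_real_derivative (2 * real CARD('n) + 4) * (4 * m * (4 * lam M1 - 2 * lam M2) * Re (base_sympl (snd z) k))) (at 0)"
    unfolding F_def by (rule derivative_eq_intros D refl)+ (simp add: D0 algebra_simps)
  ultimately show ?thesis by (rule DERIV_unique)
qed

text \<open>
  The inner derivative is taken at the points \<open>p = (\<tau>, s k)\<close>, where the fibre coordinate \<open>Im (fst z)\<close> is \<open>0\<close>; there only the
  derivative of \<open>stereo\<close> enters.  It is a multiple of \<open>s\<close>, which makes the outer derivative at \<open>s = 0\<close> easy.
\<close>

lemma lift_metric_second_derivative:
  fixes z :: "'n::finite coords"
  shows "frechet_derivative (\<lambda>x. frechet_derivative (\<lambda>x. lift_metric lam x (of_real m, 0) (of_real m, 0)) (at x) z)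
      (at (of_real \<tau>, 0)) (0, k)
    = (2 * real CARD('n) + 4) * (32 * m\<^sup>2 * (lam M1 - lam M2) * (k \<bullet> snd z))"
proof -
  define D :: "real \<Rightarrow> real" where "D s = 2 / (1 + s\<^sup>2 * (norm k)\<^sup>2)" for s
  have D: "(D has_real_derivative 0) (at 0)" and D0: "D 0 = 2"
    unfolding D_def using even_stereo_derivative by auto
  define F where "F s = (2 * real CARD('n) + 4) * (m\<^sup>2 * (- ((D s)\<^sup>2 * (s * (k \<bullet> snd z)))) *
     (8 * lam M1 * (D s - 1) + (8 * lam M2 - 16 * lam M1) * (D s - 1) ^ 3))" for s
  have eq: "frechet_derivative (\<lambda>x. lift_metric lam x (of_real m, 0) (of_real m, 0)) (at ((of_real \<tau>, 0) + s *\<^sub>R (0, k))) z = F s" for s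
  proof -
    let ?p = "((of_real \<tau>, 0) + s *\<^sub>R (0, k)) :: 'n coords"
    define E where "E \<sigma> = stereo (?p + \<sigma> *\<^sub>R z)" for \<sigma>
    have E0: "E 0 = D s" unfolding E_def D_def using stereo_line[where s = s and z = "(0, k)" and \<tau> = \<tau>] by simp
    have E: "(E has_real_derivative - ((D s)\<^sup>2 * (s * (k \<bullet> snd z)))) (at 0)"
      using smooth_fun_directional_derivative[OF smooth_stereo, of ?p z]
        frechet_derivative_at[OF stereo_has_derivative[of ?p], symmetric] E0
      by (simp add: E_def[abs_def] stereo_deriv_def)
    define H where "H \<sigma> = (2 * real CARD('n) + 4) * m\<^sup>2 *
       (4 * lam M1 * ((E \<sigma> - 1)\<^sup>2 - (E \<sigma> - 1) ^ 4 * (sin (2 * (\<sigma> * Im (fst z))))\<^sup>2)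
        + (2 * lam M2 - 4 * lam M1) * ((E \<sigma> - 1) ^ 4 * (cos (2 * (\<sigma> * Im (fst z))))\<^sup>2))" for \<sigma>
    have eq: "lift_metric lam (?p + \<sigma> *\<^sub>R z) (of_real m, 0) (of_real m, 0) = H \<sigma>" for \<sigma>
      unfolding lift_metric_def phase_form_def contact_form_def E_def[symmetric] H_def
      by (simp add: bilinear_rzero[OF bilinear_base_herm] bilinear_rzero[OF bilinear_base_sympl] inner_complex_def)
         (simp add: algebra_simps power2_eq_square eval_nat_numeral)
    have "(H has_real_derivative frechet_derivative (\<lambda>x. lift_metric lam x (of_real m, 0) (of_real m, 0)) (at ?p) z) (at 0)"
      using smooth_fun_directional_derivative[OF smooth_lift_metric[where lam = lam and u = "(of_real m, 0)" and v = "(of_real m, 0)"],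
          of ?p z] unfolding eq .
    moreover have "(H has_real_derivative F s) (at 0)"
      unfolding H_def F_def
      by (rule derivative_eq_intros E refl)+ (simp add: E0, simp add: algebra_simps power2_eq_square eval_nat_numeral)
    ultimately show ?thesis by (rule DERIV_unique)
  qed
  have "(F has_real_derivative frechet_derivative (\<lambda>x. frechet_derivative (\<lambda>x. lift_metric lam x (of_real m, 0) (of_real m, 0)) (at x) z)
      (at (of_real \<tau>, 0)) (0, k)) (at 0)"
    using smooth_fun_directional_derivative[OF smooth_fun_frechet_derivative[OF
          smooth_lift_metric[where lam = lam and u = "(of_real m, 0)" and v = "(of_real m, 0)"], of z],
        of "(of_real \<tau>, 0)" "(0, k)"] unfolding eq .
  moreover have "(F has_real_derivative (2 * real CARD('n) + 4) * (32 * m\<^sup>2 * (lam M1 - lam M2) * (k \<bullet> snd z))) (at 0)"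
    unfolding F_def by (rule derivative_eq_intros D refl)+ (simp add: D0 algebra_simps)
  ultimately show ?thesis by (rule DERIV_unique)
qed

section \<open>Jacobi fields along the equigeodesic\<close>

lemma lift_axis: "lift (of_real s, 0) = (rot 1 s :: 'n::finite cmat)"
proof -
  have T0: "tangent_mat 0 = (0 :: 'n cmat)" by (rule linear_0[OF linear_tangent_mat])
  have "rot \<i> 0 = (mat 1 :: 'n cmat)" by (simp add: rot_def rodrigues_def)
  moreover have "boost (of_real s, 0 :: 'n horizontal) = mat 1"
  proof -
    have "(0 :: complex, - (\<chi> k. cnj (fst (0 :: 'n horizontal) $ k)),
        - (\<chi> k. cnj (snd (0 :: 'n horizontal) $ k))) = 0"
      by (simp add: zero_prod_def vec_eq_iff)
    then show ?thesis unfolding boost_def rodrigues_def by (simp add: T0 mm.zero_left)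
  qed
  ultimately show ?thesis by (simp add: lift_def)
qed

lemma mexp_A_mat: "mexp (t *\<^sub>R A_mat None None) = (lift (of_real (m_const CARD('n) * t), 0) :: 'n::{finite,linorder} cmat)"
proof -
  have "A_mat None None = (tangent_mat (of_real (m_const CARD('n)), 0) :: 'n cmat)"
    unfolding tangent_mat_M2 using m_const_pos[of "CARD('n)"] by simp
  also have "\<dots> = m_const CARD('n) *\<^sub>R tangent_mat (1, 0)"
    by (simp add: linear_cmul[OF linear_tangent_mat, symmetric] scaleR_conv_of_real[where 'a = complex])
  finally have A: "t *\<^sub>R A_mat None None = (m_const CARD('n) * t) *\<^sub>R (tangent_mat (1, 0) :: 'n cmat)"
    by (simp add: mult.commute)
  have "tangent_mat (1, 0) ** (tangent_mat (1, 0) ** tangent_mat (1, 0)) = - (tangent_mat (1, 0) :: 'n cmat)"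
    by (simp add: vertical_cube)
  from mexp_rodrigues[OF this] show ?thesis unfolding A lift_axis rot_def .
qed

lemma act_origin: "act g origin = coset g"
  by (simp add: act_def origin_def coset_def image_image)

text \<open>
  These vectors form a real plane that is invariant under \<open>(p, q) \<mapsto> (-cnj q, cnj p)\<close>; the Jacobi field
  stays in this plane.
\<close>

definition const_pair :: "real \<Rightarrow> real \<Rightarrow> 'n::finite horizontal" where
  "const_pair a b = (\<chi> k. of_real a, \<chi> k. of_real b)"

lemma const_pair_zero_iff: "const_pair a b = (0 :: 'n::finite horizontal) \<longleftrightarrow> a = 0 \<and> b = 0"
  by (simp add: const_pair_def vec_eq_iff zero_prod_def)

lemma const_pair_inner:
  "const_pair a b \<bullet> (z :: 'n::finite horizontal) = a * (\<Sum>k\<in>UNIV. Re (fst z $ k)) + b * (\<Sum>k\<in>UNIV. Re (snd z $ k))"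
  by (simp add: const_pair_def inner_prod_def inner_vec_def inner_complex_def sum_distrib_left)

lemma Re_base_sympl_const_pair:
  "Re (base_sympl (const_pair a b) z) = a * (\<Sum>k\<in>UNIV. Re (snd z $ k)) - b * (\<Sum>k\<in>UNIV. Re (fst z $ k))"
  by (simp add: const_pair_def base_sympl_def sum_distrib_left sum_subtractf)

lemma const_pair_derivative:
  assumes "(a has_real_derivative a') (at t)" "(b has_real_derivative b') (at t)"
  shows "((\<lambda>t. (0 :: complex, const_pair (a t) (b t)) :: 'n::finite coords) has_vector_derivative (0, const_pair a' b')) (at t)"
proof -
  have e: "(0 :: complex, const_pair x y) = x *\<^sub>R (0, const_pair 1 0) + y *\<^sub>R (0, const_pair 0 1 :: 'n horizontal)" for x y
    by (simp add: const_pair_def vec_eq_iff prod_eq_iff scaleR_conv_of_real[where 'a = complex])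
  have "((\<lambda>t. a t *\<^sub>R (0 :: complex, const_pair 1 0) + b t *\<^sub>R (0, const_pair 0 1 :: 'n horizontal))
     has_vector_derivative (a t *\<^sub>R 0 + a' *\<^sub>R (0, const_pair 1 0)) + (b t *\<^sub>R 0 + b' *\<^sub>R (0, const_pair 0 1))) (at t)"
    by (intro has_vector_derivative_add has_vector_derivative_scaleR has_vector_derivative_const assms)
  then show ?thesis unfolding e[of "a _" "b _"] e[of a' b'] by simp
qed

lemma smooth_const_pair:
  assumes "smooth_fun a" "smooth_fun b"
  shows "smooth_fun (\<lambda>t. (0 :: complex, const_pair (a t) (b t)) :: 'n::finite coords)"
proof -
  have e: "(0 :: complex, const_pair x y) = x *\<^sub>R (0, const_pair 1 0) + y *\<^sub>R (0, const_pair 0 1 :: 'n horizontal)" for x y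
    by (simp add: const_pair_def vec_eq_iff prod_eq_iff scaleR_conv_of_real[where 'a = complex])
  show ?thesis unfolding e[of "a _" "b _"]
    by (intro smooth_fun_add smooth_fun_scaleR smooth_fun_const assms)
qed

text \<open>
  All charts use the same lift on different balls, so the coordinate expressions of curves and vector fields
  need not be changed from one chart to the next.
\<close>

lemma coord_curve_through:
  fixes m :: real and t0 :: real
  defines "e \<equiv> (of_real m, 0) :: 'n::{finite,linorder} coords"
  assumes \<gamma>: "\<And>t. \<gamma> t = coset (lift (of_real (m * t), 0 :: 'n horizontal))"
  obtains U I where "t0 \<in> I" "coord_curve U (lift :: 'n coords \<Rightarrow> 'n cmat) \<gamma> I (\<lambda>t. t *\<^sub>R e)" "open I"
    "\<And>lam. invariant_metric lam \<Longrightarrow> stationary_metric (lift_metric lam) U e"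
    "\<And>t. t \<in> I \<Longrightarrow> t *\<^sub>R e \<in> U"
proof -
  obtain r where r: "r > 0" and ch: "chart (ball (of_real (m * t0), 0) r) (lift :: 'n coords \<Rightarrow> 'n cmat)"
    and pos: "\<And>lam z (u :: 'n coords). invariant_metric lam \<Longrightarrow> z \<in> ball (of_real (m * t0), 0) r \<Longrightarrow> u \<noteq> 0
      \<Longrightarrow> lift_metric lam z u u > 0"
    using chart_lift by blast
  define U where "U = (ball (of_real (m * t0), 0) r :: 'n coords set)"
  define I where "I = (\<lambda>t. t *\<^sub>R e) -` U"
  have chU: "chart U (lift :: 'n coords \<Rightarrow> 'n cmat)" using ch unfolding U_def .
  have x: "t *\<^sub>R e = (of_real (m * t), 0)" for t
    by (simp add: e_def scaleR_conv_of_real mult.commute)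
  have oI: "open I" unfolding I_def U_def
    by (intro continuous_open_vimage open_ball continuous_intros)
  have sx: "smooth_fun (\<lambda>t :: real. t *\<^sub>R e)"
    by (rule smooth_fun_linear) (auto intro!: linearI simp: scaleR_left_distrib)
  show thesis
  proof (rule that[of I U])
    show "t0 \<in> I" unfolding I_def U_def vimage_eq x using r by simp
    show "coord_curve U lift \<gamma> I (\<lambda>t. t *\<^sub>R e)"
      unfolding coord_curve_def
      using chU smooth_fun_imp_smooth_on[OF sx oI] by (auto simp: I_def \<gamma> x)
    show "stationary_metric (lift_metric lam) U e" if "invariant_metric lam" for lam
    proof
      show "lift_metric lam z u v = lift_metric lam z v u" for z u v :: "'n coords" by (rule lift_metric_commute)
      show "lift_metric lam (z + s *\<^sub>R e) u v = lift_metric lam z u v" for z s u v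
        unfolding e_def by (rule lift_metric_shift)
    qed (use pos that in \<open>auto simp: U_def smooth_lift_metric bilinear_lift_metric\<close>)
    show "open I" by (rule oI)
    show "t *\<^sub>R e \<in> U" if "t \<in> I" for t using that by (simp add: I_def)
  qed
qed

theorem theoremB:
  fixes n :: nat and m b :: real and \<gamma> :: "real \<Rightarrow> 'n::{finite,linorder} point"
  assumes "n = CARD('n)" and "n \<ge> 1"
    and "m = sqrt (2 * real n + 4) / (2 * real n + 4)"
    and "\<gamma> = (\<lambda>t. act (mexp (t *\<^sub>R A_mat None None)) origin)"
    and "0 < b" and "b < pi / (2 * m)"
  shows "equigeodesic \<gamma> \<and>
    (\<exists>g c. invariant_metric g \<and> perturbation {M2} normal_metric g \<and> 0 < c \<and> c \<le> b \<and>
       conjugate_along g \<gamma> 0 c)"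
proof -
  have m: "m = m_const CARD('n)" using assms(1,3) by (simp add: m_const_def)
  have mpos: "m > 0" unfolding m by (rule m_const_pos)
  have \<gamma>: "\<gamma> t = coset (lift (of_real (m * t), 0 :: 'n horizontal))" for t
    unfolding assms(4) mexp_A_mat act_origin m ..
  define e where "e = ((of_real m, 0) :: 'n coords)"
  have x: "t *\<^sub>R e = (of_real (m * t), 0)" for t
    by (simp add: e_def scaleR_conv_of_real mult.commute)
  have crit: "coordinate_metric.dG (lift_metric lam) (t *\<^sub>R e) z e e = 0"
    if "stationary_metric (lift_metric lam) U e" for lam U t z
  proof -
    interpret stationary_metric "lift_metric lam" U e by (rule that)
    show ?thesis unfolding dG_def x unfolding e_def by (rule lift_metric_critical)
  qed
  have geo: "geodesic lam \<gamma>" if lam: "invariant_metric lam" for lam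
    unfolding geodesic_def
  proof
    fix t0
    obtain U I where UI: "t0 \<in> I" "coord_curve U (lift :: 'n coords \<Rightarrow> 'n cmat) \<gamma> I (\<lambda>t. t *\<^sub>R e)" "open I"
      "\<And>lam. invariant_metric lam \<Longrightarrow> stationary_metric (lift_metric lam) U e"
      "\<And>t. t \<in> I \<Longrightarrow> t *\<^sub>R e \<in> U"
      by (rule coord_curve_through[of \<gamma> m t0, folded e_def, OF \<gamma>]) blast
    note st = UI(4)[OF lam]
    have "\<forall>t\<in>I. geodesic_equation (chart_metric lam (lift :: 'n coords \<Rightarrow> 'n cmat)) (\<lambda>t. t *\<^sub>R e) t"
      unfolding chart_metric_lift using stationary_metric.geodesic_line[OF st UI(5) crit[OF st]] by blast
    then show "\<exists>U \<sigma> I x. t0 \<in> I \<and> coord_curve U \<sigma> \<gamma> I x \<and> (\<forall>t\<in>I. geodesic_equation (chart_metric lam \<sigma>) x t)"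
      using UI(1,2) by blast
  qed
  \<comment> \<open>the value of \<open>\<lambda>\<^sub>1\<close> for which \<open>2 \<pi> \<lambda>\<^sub>1 / m = b\<close>\<close>
  define l where "l = b * m / (2 * pi)"
  define g where "g i = (case i of M1 \<Rightarrow> l | M2 \<Rightarrow> 1)" for i
  have lpos: "l > 0" unfolding l_def using assms(5) mpos by simp
  have gM: "g M1 = l" "g M2 = 1" by (simp_all add: g_def)
  have inv: "invariant_metric g" unfolding invariant_metric_def
    by (intro allI) (simp add: g_def lpos split: component.split)
  have pert: "perturbation {M2} normal_metric g"
    unfolding perturbation_def normal_metric_def
    by (rule exI[of _ "\<lambda>i. g i - 1"]) (use inv gM in \<open>auto simp: invariant_metric_def\<close>)
  \<comment> \<open>the two frequencies \<open>\<theta>\<close> of the solutions \<open>exp(\<theta> t I) B\<close>\<close>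
  define p where "p = - m"
  define q where "q = m * (1 / l - 1)"
  have root: "l * \<theta>\<^sup>2 + m * (2 * l - 1) * \<theta> + m\<^sup>2 * (l - 1) = 0" if "\<theta> = p \<or> \<theta> = q" for \<theta>
  proof -
    have "l * \<theta>\<^sup>2 + m * (2 * l - 1) * \<theta> + m\<^sup>2 * (l - 1) = (\<theta> + m) * (l * \<theta> + m * (l - 1))"
      by (simp add: power2_eq_square algebra_simps)
    moreover have "l * q + m * (l - 1) = 0" using lpos by (simp add: q_def field_simps)
    ultimately show ?thesis using that by (auto simp: p_def)
  qed
  \<comment> \<open>components of \<open>exp(q t I) B - exp(p t I) B\<close> with respect to \<open>B\<close> and \<open>I B\<close>, followed by their derivatives\<close>
  define a where "a t = cos (q * t) - cos (p * t)" for t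
  define c where "c t = sin (q * t) - sin (p * t)" for t
  define a1 where "a1 t = p * sin (p * t) - q * sin (q * t)" for t
  define c1 where "c1 t = q * cos (q * t) - p * cos (p * t)" for t
  define a2 where "a2 t = p\<^sup>2 * cos (p * t) - q\<^sup>2 * cos (q * t)" for t
  define c2 where "c2 t = p\<^sup>2 * sin (p * t) - q\<^sup>2 * sin (q * t)" for t
  have d: "(a has_real_derivative a1 t) (at t)" "(c has_real_derivative c1 t) (at t)"
    "(a1 has_real_derivative a2 t) (at t)" "(c1 has_real_derivative c2 t) (at t)" for t
    unfolding a_def c_def a1_def c1_def a2_def c2_def
    by (auto intro!: derivative_eq_intros simp: power2_eq_square)
  have ode: "l * a2 t - m * (2 * l - 1) * c1 t - m\<^sup>2 * (l - 1) * a t = 0"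
    "l * c2 t + m * (2 * l - 1) * a1 t - m\<^sup>2 * (l - 1) * c t = 0" for t
  proof -
    have "l * a2 t - m * (2 * l - 1) * c1 t - m\<^sup>2 * (l - 1) * a t
        = (l * p\<^sup>2 + m * (2 * l - 1) * p + m\<^sup>2 * (l - 1)) * cos (p * t)
          - (l * q\<^sup>2 + m * (2 * l - 1) * q + m\<^sup>2 * (l - 1)) * cos (q * t)"
      by (simp add: a2_def c1_def a_def algebra_simps)
    then show "l * a2 t - m * (2 * l - 1) * c1 t - m\<^sup>2 * (l - 1) * a t = 0" by (simp add: root)
    have "l * c2 t + m * (2 * l - 1) * a1 t - m\<^sup>2 * (l - 1) * c t
        = (l * p\<^sup>2 + m * (2 * l - 1) * p + m\<^sup>2 * (l - 1)) * sin (p * t)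
          - (l * q\<^sup>2 + m * (2 * l - 1) * q + m\<^sup>2 * (l - 1)) * sin (q * t)"
      by (simp add: c2_def a1_def c_def algebra_simps)
    then show "l * c2 t + m * (2 * l - 1) * a1 t - m\<^sup>2 * (l - 1) * c t = 0" by (simp add: root)
  qed
  define y where "y t = ((0, const_pair (a t) (c t)) :: 'n coords)" for t
  have lin: "smooth_fun (\<lambda>t::real. r * t)" for r by (rule smooth_fun_linear) (auto intro!: linearI simp: algebra_simps)
  have sy: "smooth_fun y" unfolding y_def[abs_def] a_def c_def
    by (intro smooth_const_pair smooth_fun_diff smooth_fun_sin smooth_fun_cos lin)
  define J where "J t = chart_deriv (lift :: 'n coords \<Rightarrow> 'n cmat) (t *\<^sub>R e) (y t)" for t
  have jac: "jacobi_field g \<gamma> J"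
    unfolding jacobi_field_def
  proof
    fix t0
    obtain U I where UI: "t0 \<in> I" "coord_curve U (lift :: 'n coords \<Rightarrow> 'n cmat) \<gamma> I (\<lambda>t. t *\<^sub>R e)" "open I"
      "\<And>lam. invariant_metric lam \<Longrightarrow> stationary_metric (lift_metric lam) U e"
      "\<And>t. t \<in> I \<Longrightarrow> t *\<^sub>R e \<in> U"
      by (rule coord_curve_through[of \<gamma> m t0, folded e_def, OF \<gamma>]) blast
    note st = UI(4)[OF inv]
    interpret stationary_metric "lift_metric g" U e by (rule st)
    have "jacobi_equation (lift_metric g) (\<lambda>t. t *\<^sub>R e) y t" if t: "t \<in> I" for t
    proof (rule jacobi_line[OF UI(5)[OF t] crit[OF st]])
      show "(y has_vector_derivative (0, const_pair (a1 s) (c1 s))) (at s)"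
        "((\<lambda>s. (0, const_pair (a1 s) (c1 s)) :: 'n coords) has_vector_derivative (0, const_pair (a2 s) (c2 s))) (at s)" for s
        unfolding y_def[abs_def]
        by (rule const_pair_derivative[OF d(1,2)] const_pair_derivative[OF d(3,4)])+
      fix z :: "'n coords"
      let ?P = "\<Sum>k\<in>UNIV. Re (fst (snd z) $ k)" and ?Q = "\<Sum>k\<in>UNIV. Re (snd (snd z) $ k)"
      have "lift_metric g (t *\<^sub>R e) (0, const_pair (a2 t) (c2 t)) z
          + dG (t *\<^sub>R e) (0, const_pair (a1 t) (c1 t)) e z
          - dG (t *\<^sub>R e) z e (0, const_pair (a1 t) (c1 t))
          - frechet_derivative (\<lambda>x. dG x z e e) (at (t *\<^sub>R e)) (y t) / 2
        = 16 * (2 * real CARD('n) + 4) *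
          ((l * a2 t - m * (2 * l - 1) * c1 t - m\<^sup>2 * (l - 1) * a t) * ?P
           + (l * c2 t + m * (2 * l - 1) * a1 t - m\<^sup>2 * (l - 1) * c t) * ?Q)"
        unfolding dG_def x y_def unfolding e_def lift_metric_axis lift_metric_derivative_horizontal
          lift_metric_derivative_mixed lift_metric_second_derivative gM
        unfolding base_sympl_commute[of "snd z"] uminus_complex.sel Re_base_sympl_const_pair const_pair_inner snd_conv fst_conv
        by (simp add: field_simps)
      then show "lift_metric g (t *\<^sub>R e) (0, const_pair (a2 t) (c2 t)) z
          + dG (t *\<^sub>R e) (0, const_pair (a1 t) (c1 t)) e z
          - dG (t *\<^sub>R e) z e (0, const_pair (a1 t) (c1 t))
          - frechet_derivative (\<lambda>x. dG x z e e) (at (t *\<^sub>R e)) (y t) / 2 = 0"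
        unfolding ode by simp
    qed
    then have "\<forall>t\<in>I. J t = chart_deriv (lift :: 'n coords \<Rightarrow> 'n cmat) (t *\<^sub>R e) (y t) \<and>
        jacobi_equation (chart_metric g (lift :: 'n coords \<Rightarrow> 'n cmat)) (\<lambda>t. t *\<^sub>R e) y t"
      unfolding chart_metric_lift J_def by blast
    moreover have "smooth_on y I" by (rule smooth_fun_imp_smooth_on[OF sy UI(3)])
    ultimately show "\<exists>U \<sigma> I x y. t0 \<in> I \<and> coord_curve U \<sigma> \<gamma> I x \<and> smooth_on y I \<and>
       (\<forall>t\<in>I. J t = chart_deriv \<sigma> (x t) (y t) \<and> jacobi_equation (chart_metric g \<sigma>) x y t)"
      using UI(1,2) by blast
  qed
  have cd0: "chart_deriv (lift :: 'n coords \<Rightarrow> 'n cmat) z 0 = 0" for z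
    unfolding chart_deriv_eq[OF smooth_lift lift_in_Sp] linear_0[OF linear_maurer_cartan[OF smooth_lift]]
      linear_0[OF linear_row_coords] linear_0[OF linear_tangent_mat] by (rule linear_0[OF linear_Ad])
  have qp: "q * t = p * t + (m / l) * t" for t unfolding q_def p_def by (simp add: algebra_simps)
  have ml: "m / l * b = 2 * pi" unfolding l_def using mpos assms(5) by (simp add: field_simps)
  have y0: "y 0 = 0" "y b = 0"
    unfolding y_def a_def c_def qp[of b] ml by (simp_all add: const_pair_def vec_eq_iff zero_prod_def)
  \<comment> \<open>halfway to the conjugate point the two phases differ by \<open>\<pi>\<close>, so the two solutions add up\<close>
  have yn: "y (b / 2) \<noteq> 0"
  proof
    assume "y (b / 2) = 0"
    then have "a (b / 2) = 0 \<and> c (b / 2) = 0"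
      unfolding y_def by (simp add: zero_prod_def const_pair_zero_iff[unfolded zero_prod_def])
    moreover have "m / l * (b / 2) = pi" using ml by simp
    ultimately have "cos (p * (b / 2)) = 0 \<and> sin (p * (b / 2)) = 0"
      unfolding a_def c_def qp[of "b / 2"] by simp
    then show False using sin_cos_squared_add[of "p * (b / 2)"] by simp
  qed
  obtain U I where UI: "b / 2 \<in> I" "coord_curve U (lift :: 'n coords \<Rightarrow> 'n cmat) \<gamma> I (\<lambda>t. t *\<^sub>R e)" "open I"
    "\<And>lam. invariant_metric lam \<Longrightarrow> stationary_metric (lift_metric lam) U e"
    "\<And>t. t \<in> I \<Longrightarrow> t *\<^sub>R e \<in> U"
    by (rule coord_curve_through[of \<gamma> m "b / 2", folded e_def, OF \<gamma>]) blast
  have "inj (chart_deriv (lift :: 'n coords \<Rightarrow> 'n cmat) ((b / 2) *\<^sub>R e))"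
    using UI unfolding coord_curve_def chart_def bij_betw_def by blast
  then have "J (b / 2) \<noteq> 0" unfolding J_def using yn cd0 by (metis injD)
  moreover have "J 0 = 0" "J b = 0" unfolding J_def y0 cd0 by simp_all
  ultimately have "conjugate_along g \<gamma> 0 b"
    unfolding conjugate_along_def using jac geo[OF inv] assms(5) by blast
  then show ?thesis
    unfolding equigeodesic_def using geo inv pert assms(5) by blast
qed

end
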